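(* Let $R>0$, let $M=T^2_{1,R}=S^1_1\times S^1_R$ with polar coordinates $(\theta,\phi)\in\mathbb{R}^2/(2\pi\mathbb{Z})^2$, $\rho_0=(2\pi)^{-2}\mathrm{d}\theta\,\mathrm{d}\phi$, $h(\theta,\phi)=(\theta+\pi,\phi+\pi)$, and let $$\boldsymbol{\mu}^*=\tfrac12(\mathrm{Id},\zeta^0)_\#\rho_0+\tfrac12(\psi^1,\zeta^1)_\#\rho_0,$$ with $\zeta^0_t(\theta,\phi)=\sqrt2\sin(\pi t/T)$, $\zeta^1_t(\theta,\phi)=\sqrt2|\cos(\pi t/T)|$, and $\psi^1_t(\theta,\phi)=(\theta,\phi)$ for $t\le T/2$, $\psi^1_t(\theta,\phi)=(\theta+\pi,\phi+\pi)$ for $t>T/2$. There exists a sequence of continuous flow maps $\varphi^n:[0,T]\times M\to M$, $n\in\mathbb{N}$, such that for every $t\in[0,T]$, $\varphi^n_t:M\to M$ is smooth almost everywhere, and: - for all $n\in\mathbb{N}$, $\varphi^n_0=\mathrm{Id}$ and $\varphi^n_T=h$; - the sequence $\boldsymbol{\mu}_n:=(\varphi^n,\sqrt{\mathrm{Jac}(\varphi^n)})_\#\rho_0$ can be rescaled to a sequence $\tilde{\boldsymbol{\mu}}_n$ converging narrowly to $\boldsymbol{\mu}^*$; - $\mathcal{A}(\tilde{\boldsymbol{\mu}}_n)\to\mathcal{A}(\boldsymbol{\mu}^* )$.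
   Context: Setting. $S^1_R=\mathbb{R}/2\pi R\mathbb{Z}$ is the circle of radius $R$; $M=S^1_1\times S^1_R$ is the flat torus, polar coordinates $(\theta,\phi)$ corresponding to arc-length coordinates $(\theta,R\phi)$, so that the metric is $g=\mathrm{d}\theta^2+R^2\mathrm{d}\phi^2$. $T>0$ is fixed. $\mathcal{C}=(M\times\mathbb{R}_{\ge0})/(M\times\{0\})$ is the cone over $M$, with points $[x,r]$ and apex $o=[x,0]$. Fix $\bar x\in M$; $\pi_x([x,r])=x$ if $r>0$, $\pi_x(o)=\bar x$, $\pi_r([x,r])=r$. The cone carries the metric tensor $g_{\mathcal{C}}=r^2g+\mathrm{d}r^2$ on $M\times\mathbb{R}_{>0}$ and the distance $d_{\mathcal{C}}([x_1,r_1],[x_2,r_2])^2=r_1^2+r_2^2-2r_1r_2\cos(\min(d_M(x_1,x_2),\pi))$, with $d_M$ the geodesic distance on $M$. $\Omega=C^0([0,T];\mathcal{C})$ (sup distance) is the space of continuous paths $\mathrm{z}:t\mapsto z_t=[x_t,r_t]$, with $x_t=\pi_x(z_t)$, $r_t=\pi_r(z_t)$. $AC^2([0,T];\mathcal{C})$ is the set of absolutely continuous paths whose metric derivative is in $L^2$; for such paths $|\dot z_t|^2_{g_{\mathcal{C}}}=r_t^2|\dot x_t|^2+\dot r_t^2$ where $r_t>0$ and the derivatives exist, and $0$ otherwise. $\mathcal{A}(\mathrm{z})=\int_0^T|\dot z_t|^2_{g_{\mathcal{C}}}\mathrm{d}t$ if $\mathrm{z}\in AC^2([0,T];\mathcal{C})$,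 $+\infty$ otherwise; $\mathcal{A}(\boldsymbol{\mu})=\int_\Omega\mathcal{A}(\mathrm{z})\,\mathrm{d}\boldsymbol{\mu}(\mathrm{z})$. Narrow convergence in $\mathcal{P}(\Omega)$ is convergence against bounded continuous functions on $\Omega$. For time-dependent maps $\varphi_t:M\to M$ and $\lambda_t:M\to\mathbb{R}_{\ge0}$ such that $t\mapsto[\varphi_t(x),\lambda_t(x)]$ is a continuous path in $\mathcal{C}$ for a.e. $x$, $(\varphi,\lambda)_\#\rho_0\in\mathcal{P}(\Omega)$ is the push-forward of $\rho_0$ under $x\mapsto(t\mapsto[\varphi_t(x),\lambda_t(x)])$. $\mathrm{Jac}(\varphi_t)$ is the Jacobian determinant. Rescaling. For $\theta:\Omega\to\mathbb{R}$ with $\theta>0$ $\boldsymbol{\mu}$-a.e., let $\mathrm{prod}_\theta(\mathrm{z})=(t\mapsto[x_t,r_t/\theta(\mathrm{z})])$ and $\mathrm{dil}_{\theta,2}(\boldsymbol{\mu})=(\mathrm{prod}_\theta)_\#(\theta^2\boldsymbol{\mu})$. A functional $\sigma:\Omega\to\mathbb{R}$ is 1-homogeneous if $\sigma(t\mapsto[x_t,\lambda r_t])=\lambda\sigma(\mathrm{z})$ for all $\lambda>0$. A measure $\boldsymbol{\mu}$ can be rescaled to $\tilde{\boldsymbol{\mu}}$ if $\tilde{\boldsymbol{\mu}}=\mathrm{dil}_{\sigma/C,2}(\boldsymbol{\mu})$ for some (Borel) 1-homogeneous $\sigma$ with $\sigma>0$ $\boldsymbol{\mu}$-a.e. and $C=(\int_\Omega\sigma^2\mathrm{d}\boldsymbol{\mu})^{1/2}<\infty$.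 *)

theory Defs
  imports "HOL-Analysis.Analysis"
begin

section \<open>The flat torus\<close>

definition torus_rel :: "real \<times> real \<Rightarrow> real \<times> real \<Rightarrow> bool" where
  "torus_rel u v \<longleftrightarrow>
     (\<exists>k l :: int. fst v = fst u + 2 * pi * of_int k \<and> snd v = snd u + 2 * pi * of_int l)"

lemma equivp_torus_rel: "equivp torus_rel"
proof (rule equivpI)
  show "reflp torus_rel"
    by (auto simp: reflp_def torus_rel_def intro!: exI[of _ 0])
  show "symp torus_rel"
  proof (rule sympI)
    fix u v assume "torus_rel u v"
    then obtain k l where "fst v = fst u + 2 * pi * of_int k" "snd v = snd u + 2 * pi * of_int l"
      unfolding torus_rel_def by blast
    then show "torus_rel v u"
      unfolding torus_rel_def by (intro exI[of _ "- k"] exI[of _ "- l"]) simp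
  qed
  show "transp torus_rel"
  proof (rule transpI)
    fix u v w assume "torus_rel u v" "torus_rel v w"
    then obtain k l k' l' where "fst v = fst u + 2 * pi * of_int k" "snd v = snd u + 2 * pi * of_int l"
       "fst w = fst v + 2 * pi * of_int k'" "snd w = snd v + 2 * pi * of_int l'"
      unfolding torus_rel_def by blast
    then show "torus_rel u w"
      unfolding torus_rel_def
      by (intro exI[of _ "k + k'"] exI[of _ "l + l'"]) (simp add: algebra_simps)
  qed
qed

text \<open>The type of points does not depend on the radius \<open>R\<close> of the second circle:
  \<open>R\<close> enters only through the metric.\<close>

quotient_type torus = "real \<times> real" / torus_rel
  by (rule equivp_torus_rel)

lift_definition torus_of :: "real \<times> real \<Rightarrow> torus" is "\<lambda>u. u" .

lift_definition torus_shift :: "real \<times> real \<Rightarrow> torus \<Rightarrow> torus" is "\<lambda>v u. u + v"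
  by (auto simp: torus_rel_def)

instantiation torus :: topological_space
begin

definition open_torus :: "torus set \<Rightarrow> bool" where
  "open_torus U \<longleftrightarrow> open (torus_of -` U)"

instance
proof
  show "open (UNIV :: torus set)" by (simp add: open_torus_def)
  show "open (S \<inter> T)" if "open S" "open T" for S T :: "torus set"
    using that by (auto simp: open_torus_def)
  show "open (\<Union>K)" if "\<forall>S\<in>K. open S" for K :: "torus set set"
    using that by (auto simp: open_torus_def vimage_Union)
qed

end

text \<open>The norm of a tangent vector, in the coordinates \<open>(\<theta>, \<phi>)\<close>, for the metric
  \<open>d\<theta>\<^sup>2 + R\<^sup>2 d\<phi>\<^sup>2\<close>.\<close>

definition torus_norm :: "real \<Rightarrow> real \<times> real \<Rightarrow> real" where
  "torus_norm R v = sqrt ((fst v)\<^sup>2 + R\<^sup>2 * (snd v)\<^sup>2)"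

text \<open>Curves in the torus are described by their lifts to the plane.\<close>

definition torus_dist :: "real \<Rightarrow> torus \<Rightarrow> torus \<Rightarrow> real" where
  "torus_dist R x y =
     Inf {integral {0..1} (\<lambda>s. torus_norm R (vector_derivative u (at s))) | u.
            u C1_differentiable_on {0..1} \<and> torus_of (u 0) = x \<and> torus_of (u 1) = y}"

lemma torus_of_eq_iff: "torus_of u = torus_of v \<longleftrightarrow> torus_rel u v"
  by transfer simp

lemma torus_of_surj: obtains u where "torus_of u = x"
  by (metis Quotient_torus Quotient_abs_rep torus_of.abs_eq)

lemma torus_norm_eq: "torus_norm R v = norm (fst v, R * snd v)"
  by (simp add: torus_norm_def norm_Pair power_mult_distrib)

lemma torus_norm_ge_0 [simp]: "0 \<le> torus_norm R v"
  by (simp add: torus_norm_eq)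

lemma torus_norm_triangle: "torus_norm R (u + v) \<le> torus_norm R u + torus_norm R v"
  using norm_triangle_ineq[of "(fst u, R * snd u)" "(fst v, R * snd v)"]
  by (simp add: torus_norm_eq algebra_simps)

lemma torus_norm_minus: "torus_norm R (u - v) = torus_norm R (v - u)"
  by (simp add: torus_norm_def power2_commute)

lemma torus_lifts_nonempty: "{torus_norm R (v - u) | u v. torus_of u = x \<and> torus_of v = y} \<noteq> {}"
proof -
  obtain u v where "torus_of u = x" "torus_of v = y" by (metis torus_of_surj)
  then show ?thesis by blast
qed

lemma torus_dist_eq:
  "torus_dist R x y = Inf {torus_norm R (v - u) | u v. torus_of u = x \<and> torus_of v = y}"
    (is "_ = Inf ?N")
proof -
  let ?L = "{integral {0..1} (\<lambda>s. torus_norm R (vector_derivative u (at s))) | u.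
            u C1_differentiable_on {0..1} \<and> torus_of (u 0) = x \<and> torus_of (u 1) = y}"
  have sub: "?N \<subseteq> ?L"
  proof
    fix l assume "l \<in> ?N"
    then obtain u v where uv: "l = torus_norm R (v - u)" "torus_of u = x" "torus_of v = y"
      by blast
    define c where "c = (\<lambda>s::real. u + s *\<^sub>R (v - u))"
    have d: "(c has_vector_derivative (v - u)) (at s)" for s
      unfolding c_def by (auto intro!: derivative_eq_intros)
    have "c C1_differentiable_on {0..1}"
      unfolding C1_differentiable_on_def using d by (intro exI[of _ "\<lambda>_. v - u"]) auto
    moreover have "l = integral {0..1} (\<lambda>s. torus_norm R (vector_derivative c (at s)))"
      using uv by (simp add: vector_derivative_at[OF d])
    moreover have "c 0 = u" "c 1 = v" by (auto simp: c_def)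
    ultimately show "l \<in> ?L" using uv by blast
  qed
  have ne: "?N \<noteq> {}"
    by (rule torus_lifts_nonempty)
  have dom: "\<exists>b\<in>?N. b \<le> l" if lL: "l \<in> ?L" for l
  proof -
    obtain u where u: "l = integral {0..1} (\<lambda>s. torus_norm R (vector_derivative u (at s)))"
       "u C1_differentiable_on {0..1}" "torus_of (u 0) = x" "torus_of (u 1) = y"
      using lL by blast
    let ?d = "\<lambda>s. vector_derivative u (at s)"
    let ?E = "\<lambda>v::real\<times>real. (fst v, R * snd v)"
    have bl: "bounded_linear ?E"
      by (intro bounded_linear_Pair bounded_linear_fst bounded_linear_const_mult bounded_linear_snd)
    have cont: "continuous_on {0..1} ?d" and
      der: "\<And>s. s \<in> {0..1} \<Longrightarrow> (u has_vector_derivative ?d s) (at s within {0..1})"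
      using u(2) unfolding C1_differentiable_on_eq
      by (auto simp: vector_derivative_works[symmetric] intro: has_vector_derivative_at_within)
    have hi: "(?d has_integral (u 1 - u 0)) {0..1}"
      using fundamental_theorem_of_calculus[of 0 1 u ?d] der by simp
    have hi2: "((\<lambda>s. ?E (?d s)) has_integral ?E (u 1 - u 0)) {0..1}"
      using has_integral_linear[OF hi bl] by (simp add: o_def)
    have contE: "continuous_on {0..1} (\<lambda>s. ?E (?d s))"
      by (intro continuous_intros cont)
    have "norm (integral {0..1} (\<lambda>s. ?E (?d s))) \<le> integral {0..1} (\<lambda>s. norm (?E (?d s)))"
      by (intro integral_norm_bound_integral integrable_continuous_real contE
            continuous_on_norm) auto
    then have "torus_norm R (u 1 - u 0) \<le> l"
      using hi2 by (simp add: u(1) torus_norm_eq integral_unique)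
    then show ?thesis using u by blast
  qed
  have bdd: "bdd_below ?N" "bdd_below ?L"
  proof -
    show "bdd_below ?N" by (rule bdd_belowI[of _ 0]) auto
    show "bdd_below ?L"
    proof (rule bdd_belowI[of _ 0])
      fix l assume "l \<in> ?L"
      then obtain b where "b \<in> ?N" "b \<le> l" using dom by blast
      moreover have "0 \<le> b" using \<open>b \<in> ?N\<close> by auto
      ultimately show "0 \<le> l" by simp
    qed
  qed
  have "Inf ?L \<le> Inf ?N" using ne sub bdd by (intro cInf_superset_mono) auto
  moreover have "Inf ?N \<le> Inf ?L"
  proof (rule cInf_mono)
    show "?L \<noteq> {}" using ne sub by blast
    show "bdd_below ?N" by (rule bdd)
    show "\<And>b. b \<in> ?L \<Longrightarrow> \<exists>a\<in>?N. a \<le> b" by (rule dom)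
  qed
  ultimately show ?thesis unfolding torus_dist_def by (rule antisym)
qed

lemma torus_dist_le: "torus_dist R (torus_of u) (torus_of v) \<le> torus_norm R (v - u)"
  unfolding torus_dist_eq by (rule cInf_lower) (blast, auto intro!: bdd_belowI[of _ 0])

lemma torus_dist_less_obtain:
  assumes "torus_dist R x y < e" "torus_of u = x"
  obtains v where "torus_of v = y" "torus_norm R (v - u) < e"
proof -
  let ?N = "{torus_norm R (v - u) | u v. torus_of u = x \<and> torus_of v = y}"
  have "?N \<noteq> {}" by (rule torus_lifts_nonempty)
  moreover have "bdd_below ?N" by (rule bdd_belowI[of _ 0]) auto
  ultimately obtain u' v' where uv: "torus_of u' = x" "torus_of v' = y" "torus_norm R (v' - u') < e"
    using assms(1) unfolding torus_dist_eq by (subst (asm) cInf_less_iff) auto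
  have "torus_rel u' u" using uv(1) assms(2) by (simp flip: torus_of_eq_iff)
  then have "torus_rel v' (v' + (u - u'))"
    unfolding torus_rel_def by auto
  then have "torus_of (v' + (u - u')) = y" using uv(2) torus_of_eq_iff by metis
  moreover have "torus_norm R (v' + (u - u') - u) < e" using uv(3) by simp
  ultimately show ?thesis using that by blast
qed

lemma torus_dist_ge_0: "0 \<le> torus_dist R x y"
  unfolding torus_dist_eq by (rule cInf_greatest[OF torus_lifts_nonempty]) auto

lemma Metric_space_torus:
  assumes R: "0 < R"
  shows "Metric_space UNIV (torus_dist R)"
proof
  fix x y z
  show "0 \<le> torus_dist R x y" by (rule torus_dist_ge_0)
  have le: "torus_dist R x y \<le> torus_dist R y x" for x y
  proof (rule field_le_epsilon)
    fix e :: real assume e: "0 < e"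
    obtain u where u: "torus_of u = y" by (rule torus_of_surj)
    obtain v where v: "torus_of v = x" "torus_norm R (v - u) < torus_dist R y x + e"
      using torus_dist_less_obtain[OF _ u, of R x "torus_dist R y x + e"] e by auto
    show "torus_dist R x y \<le> torus_dist R y x + e"
      using torus_dist_le[of R v u] u v by (simp add: torus_norm_minus)
  qed
  show "torus_dist R x y = torus_dist R y x" by (intro antisym le)
  show "torus_dist R x z \<le> torus_dist R x y + torus_dist R y z"
  proof (rule field_le_epsilon)
    fix e :: real assume e: "0 < e"
    obtain u where u: "torus_of u = x" by (rule torus_of_surj)
    obtain v where v: "torus_of v = y" "torus_norm R (v - u) < torus_dist R x y + e / 2"
      using torus_dist_less_obtain[OF _ u, of R y "torus_dist R x y + e / 2"] e by auto
    obtain w where w: "torus_of w = z" "torus_norm R (w - v) < torus_dist R y z + e / 2"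
      using torus_dist_less_obtain[OF _ v(1), of R z "torus_dist R y z + e / 2"] e by auto
    have "torus_norm R (w - u) \<le> torus_norm R (v - u) + torus_norm R (w - v)"
      using torus_norm_triangle[of R "v - u" "w - v"] by simp
    then show "torus_dist R x z \<le> torus_dist R x y + torus_dist R y z + e"
      using torus_dist_le[of R u w] u v w by simp
  qed
  show "torus_dist R x y = 0 \<longleftrightarrow> x = y"
  proof
    assume "x = y"
    obtain u where "torus_of u = x" by (rule torus_of_surj)
    then show "torus_dist R x y = 0"
      using torus_dist_le[of R u u] torus_dist_ge_0[of R x y] \<open>x = y\<close>
      by (simp add: torus_norm_def)
  next
    assume 0: "torus_dist R x y = 0"
    define m where "m = min 1 R"
    have m: "0 < m" using R by (simp add: m_def)
    obtain u where u: "torus_of u = x" by (rule torus_of_surj)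
    obtain v where v: "torus_of v = y" "torus_norm R (v - u) < m"
      using torus_dist_less_obtain[OF _ u, of R y m] 0 m by auto
    have "torus_norm R (v - u) = 0"
    proof (rule ccontr)
      assume "torus_norm R (v - u) \<noteq> 0"
      then have "0 < torus_norm R (v - u)" using torus_norm_ge_0[of R "v - u"] by linarith
      then obtain w where w: "torus_of w = y" "torus_norm R (w - u) < torus_norm R (v - u)"
        using torus_dist_less_obtain[OF _ u, of R y] 0 by auto
      have "torus_rel v w" using v w by (simp flip: torus_of_eq_iff)
      then obtain k l where kl: "fst w = fst v + 2 * pi * of_int k" "snd w = snd v + 2 * pi * of_int l"
        unfolding torus_rel_def by blast
      have lt: "torus_norm R (w - v) < 2 * m"
        using torus_norm_triangle[of R "w - u" "u - v"] torus_norm_minus[of R u v] v w by simp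
      have a1: "\<bar>fst (w - v)\<bar> \<le> torus_norm R (w - v)"
        using norm_fst_le[of "fst (w - v)" "R * snd (w - v)"] by (simp add: torus_norm_eq)
      have a2: "\<bar>R * snd (w - v)\<bar> \<le> torus_norm R (w - v)"
        using norm_snd_le[of "R * snd (w - v)" "fst (w - v)"] by (simp add: torus_norm_eq)
      have aux: "k = 0" if "\<bar>2 * pi * real_of_int k\<bar> < 2" for k
      proof (rule ccontr)
        assume "k \<noteq> 0"
        then have "1 \<le> \<bar>real_of_int k\<bar>" by linarith
        then have "pi * 1 \<le> pi * \<bar>real_of_int k\<bar>" by (intro mult_left_mono) auto
        moreover have "pi * \<bar>real_of_int k\<bar> < 1" using that by (simp add: abs_mult)
        ultimately show False using pi_gt3 by linarith
      qed
      have "k = 0" using a1 lt kl by (intro aux) (simp add: m_def)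
      have "R * \<bar>2 * pi * real_of_int l\<bar> < R * 2"
      proof -
        have "R * \<bar>2 * pi * real_of_int l\<bar> = \<bar>R * snd (w - v)\<bar>"
          using kl R by (simp add: abs_mult)
        also have "\<dots> < 2 * m" using a2 lt by linarith
        also have "\<dots> \<le> R * 2" by (simp add: m_def)
        finally show ?thesis .
      qed
      then have "\<bar>2 * pi * real_of_int l\<bar> < 2"
        by (rule mult_left_less_imp_less) (use R in simp)
      then have "l = 0" by (rule aux)
      with \<open>k = 0\<close> have "w = v" using kl by (simp add: prod_eq_iff)
      then show False using w by simp
    qed
    then have "v = u" using R by (simp add: torus_norm_eq prod_eq_iff)
    then show "x = y" using u v by simp
  qed
qed

definition torus_measure :: "torus measure" where
  "torus_measure = distr (uniform_measure lborel ({0..<2 * pi} \<times> {0..<2 * pi})) borel torus_of"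

section \<open>Regularity of self-maps of the torus\<close>

primrec Ck_on :: "nat \<Rightarrow> 'a::euclidean_space set \<Rightarrow> ('a \<Rightarrow> 'b::real_normed_vector) \<Rightarrow> bool" where
  "Ck_on 0 U f \<longleftrightarrow> continuous_on U f"
| "Ck_on (Suc k) U f \<longleftrightarrow>
     (\<forall>u\<in>U. f differentiable (at u)) \<and> (\<forall>v. Ck_on k U (\<lambda>u. frechet_derivative f (at u) v))"

definition torus_smooth_at :: "(torus \<Rightarrow> torus) \<Rightarrow> torus \<Rightarrow> bool" where
  "torus_smooth_at f x \<longleftrightarrow>
     (\<exists>U g. open U \<and> x \<in> torus_of ` U \<and> (\<forall>u\<in>U. f (torus_of u) = torus_of (g u)) \<and>
            (\<forall>k. Ck_on k U g))"

text \<open>The differential of \<open>f\<close> at \<open>x\<close> in the coordinates \<open>(\<theta>, \<phi>)\<close>, at the source and at the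
  target. It depends neither on the lift \<open>g\<close> nor on the representative \<open>u\<close>.\<close>

definition torus_has_derivative ::
    "(torus \<Rightarrow> torus) \<Rightarrow> (real \<times> real \<Rightarrow> real \<times> real) \<Rightarrow> torus \<Rightarrow> bool" where
  "torus_has_derivative f D x \<longleftrightarrow>
     (\<exists>u g. torus_of u = x \<and> (\<forall>\<^sub>F v in nhds u. f (torus_of v) = torus_of (g v)) \<and>
            (g has_derivative D) (at u))"

text \<open>The determinant is the same in the coordinates \<open>(\<theta>, \<phi>)\<close> and in the arc-length coordinates
  \<open>(\<theta>, R\<phi>)\<close>, since the two differentials are conjugate.\<close>

definition torus_jac :: "(torus \<Rightarrow> torus) \<Rightarrow> torus \<Rightarrow> real" where
  "torus_jac f x =
     (let D = (THE D. torus_has_derivative f D x)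
      in det (vector [vector [fst (D (1, 0)), fst (D (0, 1))],
                      vector [snd (D (1, 0)), snd (D (0, 1))]] :: real^2^2))"

definition torus_has_velocity ::
    "(real \<Rightarrow> torus) \<Rightarrow> real \<times> real \<Rightarrow> real \<Rightarrow> real set \<Rightarrow> bool" where
  "torus_has_velocity x v t S \<longleftrightarrow>
     (\<exists>u. torus_of (u t) = x t \<and> (\<forall>\<^sub>F s in at t within S. torus_of (u s) = x s) \<and>
          (u has_vector_derivative v) (at t within S))"

definition torus_velocity :: "(real \<Rightarrow> torus) \<Rightarrow> real \<Rightarrow> real set \<Rightarrow> real \<times> real" where
  "torus_velocity x t S = (THE v. torus_has_velocity x v t S)"

section \<open>The cone\<close>

definition cone_rel :: "'a \<times> real \<Rightarrow> 'a \<times> real \<Rightarrow> bool" where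
  "cone_rel p q \<longleftrightarrow> 0 \<le> snd p \<and> snd p = snd q \<and> (snd p = 0 \<or> fst p = fst q)"

lemma part_equivp_cone_rel: "part_equivp cone_rel"
  by (rule part_equivpI)
     (auto simp: cone_rel_def symp_def transp_def intro!: exI[of _ "(undefined, 0)"])

quotient_type 'a cone = "'a \<times> real" / partial: cone_rel
  by (rule part_equivp_cone_rel)

text \<open>The point \<open>[x, r]\<close>; meaningful only for \<open>0 \<le> r\<close>.\<close>

definition cone_pt :: "'a \<Rightarrow> real \<Rightarrow> 'a cone" where
  "cone_pt x r = abs_cone (x, r)"

lift_definition cone_r :: "'a cone \<Rightarrow> real" is snd
  by (auto simp: cone_rel_def)

lift_definition cone_x :: "'a \<Rightarrow> 'a cone \<Rightarrow> 'a" is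
  "\<lambda>xbar p. if 0 < snd p then fst p else xbar"
  by (auto simp: cone_rel_def)

lift_definition cone_dist :: "('a \<Rightarrow> 'a \<Rightarrow> real) \<Rightarrow> 'a cone \<Rightarrow> 'a cone \<Rightarrow> real" is
  "\<lambda>d p q. sqrt ((snd p)\<^sup>2 + (snd q)\<^sup>2
                 - 2 * snd p * snd q * cos (min (d (fst p) (fst q)) pi))"
  by (auto simp: cone_rel_def)

lemma cone_cases:
  obtains x r where "z = cone_pt x r" "0 \<le> r"
  unfolding cone_pt_def
  by (induct z) (auto simp: cone_rel_def)

lemma cone_pt_eq_iff:
  assumes "0 \<le> r" "0 \<le> s"
  shows "cone_pt x r = cone_pt y s \<longleftrightarrow> r = s \<and> (r = 0 \<or> x = y)"
proof -
  have "cone_rel (x, r) (y, s) \<longleftrightarrow> cone_rel (x, r) (x, r) \<and> cone_rel (y, s) (y, s)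
          \<and> abs_cone (x, r) = abs_cone (y, s)"
    using Quotient_rel[OF Quotient_cone, of "(x, r)" "(y, s)"] by auto
  then show ?thesis
    using assms by (auto simp: cone_pt_def cone_rel_def)
qed

lemma cone_r_pt [simp]: "0 \<le> r \<Longrightarrow> cone_r (cone_pt x r) = r"
  unfolding cone_pt_def by (subst cone_r.abs_eq) (auto simp: cone_rel_def)

lemma cone_x_pt [simp]: "0 < r \<Longrightarrow> cone_x xbar (cone_pt x r) = x"
  unfolding cone_pt_def by (subst cone_x.abs_eq) (auto simp: cone_rel_def)

lemma cone_x_apex [simp]: "cone_x xbar (cone_pt x 0) = xbar"
  unfolding cone_pt_def by (subst cone_x.abs_eq) (auto simp: cone_rel_def)

lemma cone_dist_pt:
  "0 \<le> r \<Longrightarrow> 0 \<le> s \<Longrightarrow>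
     cone_dist d (cone_pt x r) (cone_pt y s) = sqrt (r\<^sup>2 + s\<^sup>2 - 2 * r * s * cos (min (d x y) pi))"
  unfolding cone_pt_def by (subst cone_dist.abs_eq) (auto simp: cone_rel_def)

lemma cone_dist_plane:
  assumes "0 \<le> r" "0 \<le> s"
  shows "sqrt (r\<^sup>2 + s\<^sup>2 - 2 * r * s * cos (a - b)) = cmod (rcis r a - rcis s b)"
proof -
  have "r\<^sup>2 + s\<^sup>2 - 2 * r * s * cos (a - b) =
        (r * cos a - s * cos b)\<^sup>2 + (r * sin a - s * sin b)\<^sup>2"
  proof -
    have "(r * cos a - s * cos b)\<^sup>2 + (r * sin a - s * sin b)\<^sup>2 =
       r\<^sup>2 * ((sin a)\<^sup>2 + (cos a)\<^sup>2) + s\<^sup>2 * ((sin b)\<^sup>2 + (cos b)\<^sup>2)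
         - 2 * r * s * (cos a * cos b + sin a * sin b)"
      by algebra
    then show ?thesis by (simp add: cos_diff)
  qed
  then show ?thesis by (simp add: cmod_def)
qed

lemma Metric_space_cone:
  assumes "Metric_space UNIV d"
  shows "Metric_space UNIV (cone_dist d)"
proof -
  interpret d: Metric_space UNIV d by (rule assms)
  define a where "a x y = min (d x y) pi" for x y
  have a: "0 \<le> a x y" "a x y \<le> pi" "a x y = a y x" for x y
    by (auto simp: a_def d.commute)
  have tri: "a x z \<le> a x y + a y z" for x y z
    using d.triangle[of x y z] d.nonneg[of x y] d.nonneg[of y z]
    unfolding a_def min_def by (smt (verit) UNIV_I pi_ge_zero)
  have mono: "sqrt (r\<^sup>2 + s\<^sup>2 - 2 * r * s * cos b) \<le> sqrt (r\<^sup>2 + s\<^sup>2 - 2 * r * s * cos c)"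
    if "0 \<le> r" "0 \<le> s" "0 \<le> b" "b \<le> c" "c \<le> pi" for r s b c
    using that cos_monotone_0_pi_le[of b c] mult_left_mono[of "cos c" "cos b" "2 * r * s"] by simp
  have dist: "cone_dist d (cone_pt x r) (cone_pt y s) = sqrt (r\<^sup>2 + s\<^sup>2 - 2 * r * s * cos (a x y))"
    if "0 \<le> r" "0 \<le> s" for x y r s
    using that by (simp add: cone_dist_pt a_def)
  show ?thesis
  proof
    fix p q w :: "'a cone"
    obtain x r where p: "p = cone_pt x r" "0 \<le> r" by (rule cone_cases)
    obtain y s where q: "q = cone_pt y s" "0 \<le> s" by (rule cone_cases)
    obtain z t where w: "w = cone_pt z t" "0 \<le> t" by (rule cone_cases)
    have pq: "cone_dist d p q = cmod (rcis r (a x y) - rcis s 0)"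
      using p q cone_dist_plane[of r s "a x y" 0] by (simp add: dist)
    then show "0 \<le> cone_dist d p q" by simp
    show "cone_dist d p q = cone_dist d q p"
      using p q a(3)[of x y] by (simp add: dist algebra_simps)
    show "cone_dist d p q = 0 \<longleftrightarrow> p = q"
    proof
      assume "p = q"
      moreover have "cone_dist d (cone_pt x r) (cone_pt x r) = 0"
        using p(2) by (simp add: dist a_def power2_eq_square)
      ultimately show "cone_dist d p q = 0"
        using p(1) by simp
    next
      assume "cone_dist d p q = 0"
      then have eq: "rcis r (a x y) = rcis s 0" using pq by simp
      then have rs: "r = s" using p q by (metis abs_of_nonneg complex_mod_rcis)
      show "p = q"
      proof (cases "r = 0")
        case True
        then show ?thesis using p q rs by (simp add: cone_pt_eq_iff)
      next
        case False
        then have "cos (a x y) = 1" using eq rs by (auto simp: complex_eq_iff)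
        then have "a x y = 0"
          using a[of x y] cos_monotone_0_pi[of 0 "a x y"] by (cases "a x y = 0") auto
        then have "x = y" by (auto simp: a_def min_def split: if_splits)
        then show ?thesis using p q rs by simp
      qed
    qed
    show "cone_dist d p w \<le> cone_dist d p q + cone_dist d q w"
    proof (cases "a x y + a y z \<le> pi")
      case True
      have "cone_dist d p w \<le> sqrt (r\<^sup>2 + t\<^sup>2 - 2 * r * t * cos (a x y + a y z))"
        using p w True tri[of x z y] a by (simp add: dist del: real_sqrt_le_iff) (intro mono, auto)
      also have "\<dots> = cmod (rcis r (a x y) - rcis t (- a y z))"
        using p w cone_dist_plane[of r t "a x y" "- a y z"] by simp
      also have "\<dots> \<le> cmod (rcis r (a x y) - rcis s 0) + cmod (rcis s 0 - rcis t (- a y z))"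
        by (metis dist_norm dist_triangle)
      also have "\<dots> = cone_dist d p q + cone_dist d q w"
        using p q w cone_dist_plane[of r s "a x y" 0] cone_dist_plane[of s t 0 "- a y z"]
        by (simp add: dist)
      finally show ?thesis .
    next
      case False
      have "cone_dist d p w \<le> sqrt (r\<^sup>2 + t\<^sup>2 - 2 * r * t * cos pi)"
        using p w a[of x z] by (simp add: dist del: real_sqrt_le_iff cos_pi) (intro mono, auto)
      also have "\<dots> = cmod (rcis r (a x y) - rcis t (a x y - pi))"
        using p w cone_dist_plane[of r t "a x y" "a x y - pi"] by simp
      also have "\<dots> \<le> cmod (rcis r (a x y) - rcis s 0) + cmod (rcis s 0 - rcis t (a x y - pi))"
        by (metis dist_norm dist_triangle)
      also have "\<dots> = cone_dist d p q + sqrt (s\<^sup>2 + t\<^sup>2 - 2 * s * t * cos (pi - a x y))"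
        using p q w cone_dist_plane[of r s "a x y" 0] cone_dist_plane[of s t 0 "a x y - pi"]
        by (simp add: dist)
      also have "\<dots> \<le> cone_dist d p q + sqrt (s\<^sup>2 + t\<^sup>2 - 2 * s * t * cos (a y z))"
        using q w False a[of x y] a[of y z]
        by (intro add_left_mono mono) auto
      also have "\<dots> = cone_dist d p q + cone_dist d q w"
        using q w by (simp add: dist)
      finally show ?thesis .
    qed
  qed
qed

definition cone_metric :: "real \<Rightarrow> torus cone metric" where
  "cone_metric R = metric (UNIV, cone_dist (torus_dist R))"

lemma mspace_cone_metric: "0 < R \<Longrightarrow> mspace (cone_metric R) = UNIV"
  and mdist_cone_metric: "0 < R \<Longrightarrow> mdist (cone_metric R) = cone_dist (torus_dist R)"
  using Metric_space_cone[OF Metric_space_torus[of R]]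
  by (simp_all add: cone_metric_def Metric_space.mspace_metric Metric_space.mdist_metric)

section \<open>Continuous paths in the cone\<close>

definition path_space :: "real \<Rightarrow> real \<Rightarrow> (real \<Rightarrow> torus cone) metric" where
  "path_space T R = cfunspace (top_of_set {0..T}) (cone_metric R)"

definition path_borel :: "real \<Rightarrow> real \<Rightarrow> (real \<Rightarrow> torus cone) measure" where
  "path_borel T R =
     sigma (mspace (path_space T R)) {U. openin (mtopology_of (path_space T R)) U}"

definition path_abs_continuous ::
    "real \<Rightarrow> ('a \<Rightarrow> 'a \<Rightarrow> real) \<Rightarrow> (real \<Rightarrow> 'a) \<Rightarrow> bool" where
  "path_abs_continuous T d z \<longleftrightarrow>
     (\<exists>m :: real \<Rightarrow> real. set_integrable lborel {0..T} m \<and>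
        (\<forall>s t. 0 \<le> s \<and> s \<le> t \<and> t \<le> T \<longrightarrow> d (z s) (z t) \<le> (LINT \<tau>:{s..t}|lborel. m \<tau>)))"

definition path_AC2 :: "real \<Rightarrow> ('a \<Rightarrow> 'a \<Rightarrow> real) \<Rightarrow> (real \<Rightarrow> 'a) \<Rightarrow> bool" where
  "path_AC2 T d z \<longleftrightarrow>
     path_abs_continuous T d z \<and>
     (\<exists>m\<in>borel_measurable lborel.
        (AE t in lborel. t \<in> {0..T} \<longrightarrow>
           ((\<lambda>s. d (z s) (z t) / \<bar>s - t\<bar>) \<longlongrightarrow> m t) (at t within {0..T})) \<and>
        set_integrable lborel {0..T} (\<lambda>t. (m t)\<^sup>2))"

definition cone_speed_sq ::
    "torus \<Rightarrow> real \<Rightarrow> real \<Rightarrow> (real \<Rightarrow> torus cone) \<Rightarrow> real \<Rightarrow> real" where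
  "cone_speed_sq xbar T R z t =
     (let x = (\<lambda>s. cone_x xbar (z s)); r = (\<lambda>s. cone_r (z s)); S = {0..T}
      in if 0 < r t \<and> (\<exists>v. torus_has_velocity x v t S) \<and> r differentiable (at t within S)
         then (r t)\<^sup>2 * (torus_norm R (torus_velocity x t S))\<^sup>2
              + (vector_derivative r (at t within S))\<^sup>2
         else 0)"

definition path_action ::
    "torus \<Rightarrow> real \<Rightarrow> real \<Rightarrow> (real \<Rightarrow> torus cone) \<Rightarrow> ennreal" where
  "path_action xbar T R z =
     (if path_AC2 T (cone_dist (torus_dist R)) z
      then \<integral>\<^sup>+t\<in>{0..T}. ennreal (cone_speed_sq xbar T R z t) \<partial>lborel
      else \<infinity>)"

definition action ::
    "torus \<Rightarrow> real \<Rightarrow> real \<Rightarrow> (real \<Rightarrow> torus cone) measure \<Rightarrow> ennreal" where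
  "action xbar T R \<mu> = (\<integral>\<^sup>+z. path_action xbar T R z \<partial>\<mu>)"

definition narrow_conv ::
    "real \<Rightarrow> real \<Rightarrow> (nat \<Rightarrow> (real \<Rightarrow> torus cone) measure) \<Rightarrow> (real \<Rightarrow> torus cone) measure \<Rightarrow> bool" where
  "narrow_conv T R \<mu> \<nu> \<longleftrightarrow>
     (\<forall>f. continuous_map (mtopology_of (path_space T R)) euclideanreal f \<and>
          bounded (f ` mspace (path_space T R)) \<longrightarrow>
          (\<lambda>n. \<integral>z. f z \<partial>(\<mu> n)) \<longlonglongrightarrow> (\<integral>z. f z \<partial>\<nu>))"

section \<open>Generalized flows\<close>

definition cone_path ::
    "real \<Rightarrow> (real \<Rightarrow> torus \<Rightarrow> torus) \<Rightarrow> (real \<Rightarrow> torus \<Rightarrow> real) \<Rightarrow> torus \<Rightarrow> real \<Rightarrow> torus cone" where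
  "cone_path T \<phi> l x = (\<lambda>t\<in>{0..T}. cone_pt (\<phi> t x) (l t x))"

definition is_cone_path ::
    "real \<Rightarrow> real \<Rightarrow> (real \<Rightarrow> torus \<Rightarrow> torus) \<Rightarrow> (real \<Rightarrow> torus \<Rightarrow> real) \<Rightarrow> torus \<Rightarrow> bool" where
  "is_cone_path T R \<phi> l x \<longleftrightarrow>
     (\<forall>t\<in>{0..T}. 0 \<le> l t x) \<and> cone_path T \<phi> l x \<in> mspace (path_space T R)"

text \<open>The push-forward of the normalized measure of the torus by an almost everywhere defined map.
  The value at points whose path is not a continuous path in the cone is immaterial (here: the
  constant path at the apex); completing the measure makes the push-forward independent of what
  happens on a null set.\<close>

definition flow_measure ::
    "real \<Rightarrow> real \<Rightarrow> (real \<Rightarrow> torus \<Rightarrow> torus) \<Rightarrow> (real \<Rightarrow> torus \<Rightarrow> real) \<Rightarrow> (real \<Rightarrow> torus cone) measure" where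
  "flow_measure T R \<phi> l =
     distr (completion torus_measure) (path_borel T R)
       (\<lambda>x. if is_cone_path T R \<phi> l x then cone_path T \<phi> l x
            else (\<lambda>t\<in>{0..T}. cone_pt x 0))"

definition half_sum :: "'a measure \<Rightarrow> 'a measure \<Rightarrow> 'a measure" where
  "half_sum \<mu> \<nu> = measure_of (space \<mu>) (sets \<mu>) (\<lambda>A. (emeasure \<mu> A + emeasure \<nu> A) / 2)"

definition path_rescale ::
    "torus \<Rightarrow> real \<Rightarrow> ((real \<Rightarrow> torus cone) \<Rightarrow> real) \<Rightarrow> (real \<Rightarrow> torus cone) \<Rightarrow> real \<Rightarrow> torus cone" where
  "path_rescale xbar T \<theta> z = (\<lambda>t\<in>{0..T}. cone_pt (cone_x xbar (z t)) (cone_r (z t) / \<theta> z))"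

definition dilation ::
    "torus \<Rightarrow> real \<Rightarrow> real \<Rightarrow> ((real \<Rightarrow> torus cone) \<Rightarrow> real) \<Rightarrow> (real \<Rightarrow> torus cone) measure
       \<Rightarrow> (real \<Rightarrow> torus cone) measure" where
  "dilation xbar T R \<theta> \<mu> =
     distr (density \<mu> (\<lambda>z. ennreal ((\<theta> z)\<^sup>2))) (path_borel T R) (path_rescale xbar T \<theta>)"

definition one_homogeneous ::
    "torus \<Rightarrow> real \<Rightarrow> real \<Rightarrow> ((real \<Rightarrow> torus cone) \<Rightarrow> real) \<Rightarrow> bool" where
  "one_homogeneous xbar T R \<sigma> \<longleftrightarrow>
     (\<forall>z\<in>mspace (path_space T R). \<forall>c>0.
        \<sigma> (\<lambda>t\<in>{0..T}. cone_pt (cone_x xbar (z t)) (c * cone_r (z t))) = c * \<sigma> z)"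

definition rescales_to ::
    "torus \<Rightarrow> real \<Rightarrow> real \<Rightarrow> (real \<Rightarrow> torus cone) measure \<Rightarrow> (real \<Rightarrow> torus cone) measure \<Rightarrow> bool" where
  "rescales_to xbar T R \<mu> \<nu> \<longleftrightarrow>
     (\<exists>\<sigma>\<in>borel_measurable (path_borel T R).
        one_homogeneous xbar T R \<sigma> \<and> (AE z in \<mu>. 0 < \<sigma> z) \<and> integrable \<mu> (\<lambda>z. (\<sigma> z)\<^sup>2) \<and>
        \<nu> = dilation xbar T R (\<lambda>z. \<sigma> z / sqrt (\<integral>z. (\<sigma> z)\<^sup>2 \<partial>\<mu>)) \<mu>)"

text \<open>The maps of a flow are invertible; here they are only required to be homeomorphisms, since
  they need not be smooth everywhere.\<close>

definition continuous_flow :: "real \<Rightarrow> (real \<Rightarrow> torus \<Rightarrow> torus) \<Rightarrow> bool" where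
  "continuous_flow T \<phi> \<longleftrightarrow>
     continuous_on ({0..T} \<times> UNIV) (\<lambda>(t, x). \<phi> t x) \<and>
     (\<forall>t\<in>{0..T}. \<exists>\<psi>. homeomorphism UNIV UNIV (\<phi> t) \<psi>)"

definition sqrt_jac :: "(real \<Rightarrow> torus \<Rightarrow> torus) \<Rightarrow> real \<Rightarrow> torus \<Rightarrow> real" where
  "sqrt_jac \<phi> t x = sqrt (torus_jac (\<phi> t) x)"

text \<open>For almost every particle, \<open>Jac(\<phi>\<^sub>t)\<close> makes sense at all times and
  \<open>t \<mapsto> [\<phi>\<^sub>t(x), sqrt (Jac(\<phi>\<^sub>t)(x))]\<close> is a continuous path in the cone.\<close>

definition lifts_to_cone :: "real \<Rightarrow> real \<Rightarrow> (real \<Rightarrow> torus \<Rightarrow> torus) \<Rightarrow> bool" where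
  "lifts_to_cone T R \<phi> \<longleftrightarrow>
     (AE x in torus_measure.
        (\<forall>t\<in>{0..T}. \<exists>D. torus_has_derivative (\<phi> t) D x) \<and> is_cone_path T R \<phi> (sqrt_jac \<phi>) x)"

section \<open>The limit generalized flow\<close>

definition half_turn :: "torus \<Rightarrow> torus" where
  "half_turn = torus_shift (pi, pi)"

definition zeta0 :: "real \<Rightarrow> real \<Rightarrow> torus \<Rightarrow> real" where
  "zeta0 T t x = sqrt 2 * sin (pi * t / T)"

definition zeta1 :: "real \<Rightarrow> real \<Rightarrow> torus \<Rightarrow> real" where
  "zeta1 T t x = sqrt 2 * \<bar>cos (pi * t / T)\<bar>"

definition psi1 :: "real \<Rightarrow> real \<Rightarrow> torus \<Rightarrow> torus" where
  "psi1 T t x = (if t \<le> T / 2 then x else half_turn x)"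

definition mu_star :: "real \<Rightarrow> real \<Rightarrow> (real \<Rightarrow> torus cone) measure" where
  "mu_star T R =
     half_sum (flow_measure T R (\<lambda>t x. x) (zeta0 T)) (flow_measure T R (psi1 T) (zeta1 T))"

end

theory Submission
  imports Defs
begin

text \<open>In the coordinates \<open>a = \<theta> - \<phi>\<close>, \<open>b = \<phi>\<close> the half turn is the translation \<open>b \<mapsto> b + \<pi>\<close>, so it can be
  realised by shears along closed geodesics. The torus is cut into many thin stripes \<open>a \<in> I\<close>, and each stripe into
  a thick part (relative width \<open>1 - \<epsilon>\<close>) and a thin part (relative width \<open>\<epsilon>\<close>). A piecewise affine flow lets
  the thin parts swell until they fill almost everything at time \<open>T / 2\<close> and shrink back afterwards. The particles
  of the thick parts are sheared by \<open>\<pi>\<close> just before \<open>T / 2\<close>, those of the thin parts just before \<open>T\<close>: at those times their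
  Jacobian is of order \<open>\<epsilon>\<close>, so the shear costs little action. Rescaling by the larger of the radii at times \<open>0\<close> and \<open>T / 2\<close>
  gives both kinds of particles mass \<open>1 / 2\<close>, and as the stripes and \<open>\<epsilon>\<close> become small, the two halves
  converge to the two parts of the limit flow. The action is bounded below by its radial part and above by
  its radial part plus the small cost of the displacements.\<close>

text \<open>At every point the limit carries two different motions at once, so an invertible flow
  has to interleave two populations that together keep the torus full. Their relative widths at time
  \<open>t\<close> are \<epsilon> plus \<open>1 - 2 * \<epsilon>\<close> times the squared cosine,
  respectively sine, of \<open>pi * t / T\<close>. That these add up to 1 is conservation of volume,
  and it is the origin of the two limit radii.

  A shear that differs between the populations would tear the torus; hence the ramps of
  \<open>plateau\<close>. A particle in a ramp turns partly while its radius is not small, at a cost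
  of order \<open>1 / \<delta>^2\<close> per unit of mass, so \<kappa> must be small compared with
  \<open>\<delta>^2\<close>. A turn at the right time costs order
  \<open>(\<epsilon> + \<delta>^2) / \<delta>\<close>, so \<epsilon> must be small compared with
  \<delta>.

  The thin population has total mass \<epsilon>, but its squared radius reaches order
  \<open>1 / \<epsilon>\<close>; weighting by the squared peak radius therefore balances the two
  populations.

  Measurability of \<open>path_action\<close> is not established. The integral of it is treated as a
  lower integral: measurable minorants give the upper bounds, Borel sets of full measure the lower
  ones.\<close>

section \<open>The torus in sheared coordinates\<close>

text \<open>In the coordinates \<open>(a, b) = (\<theta> - \<phi>, \<phi>)\<close> the half turn moves \<open>b\<close> only.\<close>

definition skew :: "real \<times> real \<Rightarrow> torus" where
  "skew u = torus_of (fst u + snd u, snd u)"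

lemma torus_of_eq_skew: "torus_of u = skew (fst u - snd u, snd u)"
  by (simp add: skew_def)

lemma skew_eq_iff: "skew u = skew v \<longleftrightarrow> torus_rel u v"
proof
  assume "skew u = skew v"
  then obtain k l where kl: "fst v + snd v = fst u + snd u + 2 * pi * of_int k" "snd v = snd u + 2 * pi * of_int l"
    by (auto simp: skew_def torus_of_eq_iff torus_rel_def)
  then show "torus_rel u v"
    unfolding torus_rel_def by (intro exI[of _ "k - l"] exI[of _ l]) (auto simp: algebra_simps)
next
  assume "torus_rel u v"
  then obtain k l where kl: "fst v = fst u + 2 * pi * of_int k" "snd v = snd u + 2 * pi * of_int l"
    by (auto simp: torus_rel_def)
  then show "skew u = skew v"
    unfolding skew_def torus_of_eq_iff torus_rel_def
    by (intro exI[of _ "k + l"] exI[of _ l]) (auto simp: algebra_simps)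
qed

lemma skew_surj: obtains u where "skew u = x"
  by (metis torus_of_eq_skew torus_of_surj)

lemma half_turn_skew: "half_turn (skew u) = skew (fst u, snd u + pi)"
  unfolding half_turn_def skew_def by transfer (auto simp: torus_rel_def)

text \<open>The preimage of the image is the union of all lattice translates of
  \<open>U\<close>.\<close>

lemma open_torus_of_image:
  assumes "open U"
  shows "open (torus_of ` U)"
proof -
  have "torus_of -` torus_of ` U = (\<Union>(k::int, l::int)\<in>UNIV. (+) (2 * pi * of_int k, 2 * pi * of_int l) ` U)"
    (is "?L = ?R")
  proof (intro set_eqI iffI)
    fix v assume "v \<in> ?L"
    then obtain u where "u \<in> U" "torus_of u = torus_of v" by auto
    then obtain k l where "fst v = fst u + 2 * pi * of_int k" "snd v = snd u + 2 * pi * of_int l"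
      by (auto simp: torus_of_eq_iff torus_rel_def)
    then have "v = (2 * pi * of_int k, 2 * pi * of_int l) + u" by (simp add: prod_eq_iff)
    then show "v \<in> ?R" using \<open>u \<in> U\<close> by auto
  next
    fix v assume "v \<in> ?R"
    then obtain k l u where "u \<in> U" "v = (2 * pi * of_int k, 2 * pi * of_int l) + u" by auto
    then have "torus_of u = torus_of v" by (auto simp: torus_of_eq_iff torus_rel_def)
    then have "torus_of v \<in> torus_of ` U" using \<open>u \<in> U\<close> by (metis imageI)
    then show "v \<in> ?L" by simp
  qed
  moreover have "open ?R"
    using assms by (auto intro!: open_UN open_translation)
  ultimately show ?thesis by (simp add: open_torus_def)
qed

text \<open>\<open>skew\<close> is \<open>torus_of\<close> after a linear automorphism of the plane,
  hence it induces the same quotient topology.\<close>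

lemma open_vimage_skew_iff: "open (skew -` U) \<longleftrightarrow> open U"
proof -
  have 1: "skew -` U = (\<lambda>u. (fst u + snd u, snd u)) -` (torus_of -` U)"
    by (auto simp: skew_def)
  have 2: "torus_of -` U = (\<lambda>u. (fst u - snd u, snd u)) -` (skew -` U)"
    by (auto simp: torus_of_eq_skew)
  show ?thesis
  proof
    assume "open (skew -` U)"
    then have "open ((\<lambda>u. (fst u - snd u, snd u)) -` (skew -` U))"
      by (rule open_vimage) (intro continuous_intros)
    then have "open (torus_of -` U)" by (simp add: 2[symmetric])
    then show "open U" by (simp add: open_torus_def)
  next
    assume "open U"
    then have "open (torus_of -` U)" by (simp add: open_torus_def)
    then have "open ((\<lambda>u. (fst u + snd u, snd u)) -` (torus_of -` U))"
      by (rule open_vimage) (intro continuous_intros)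
    then show "open (skew -` U)" by (simp add: 1[symmetric])
  qed
qed

lemma continuous_on_skew: "continuous_on UNIV skew"
  by (simp add: continuous_on_open_vimage open_vimage_skew_iff)

lemma measurable_torus_of [measurable]: "torus_of \<in> borel_measurable borel"
  by (rule borel_measurable_continuous_onI) (simp add: continuous_on_open_vimage open_torus_def[symmetric])

lemma measurable_skew [measurable]: "skew \<in> borel_measurable borel"
  by (rule borel_measurable_continuous_onI[OF continuous_on_skew])

lemma open_skew_image:
  assumes "open U"
  shows "open (skew ` U)"
proof -
  have "skew ` U = torus_of ` ((\<lambda>u. (fst u - snd u, snd u)) -` U)"
  proof (intro set_eqI iffI)
    fix x assume "x \<in> skew ` U"
    then obtain u where "u \<in> U" "x = torus_of (fst u + snd u, snd u)" by (auto simp: skew_def)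
    then show "x \<in> torus_of ` ((\<lambda>u. (fst u - snd u, snd u)) -` U)" by (intro image_eqI) auto
  next
    fix x assume "x \<in> torus_of ` ((\<lambda>u. (fst u - snd u, snd u)) -` U)"
    then obtain u where u: "(fst u - snd u, snd u) \<in> U" "x = torus_of u" by auto
    then show "x \<in> skew ` U" unfolding torus_of_eq_skew by blast
  qed
  then show ?thesis
    using assms by (auto intro!: open_torus_of_image open_vimage continuous_intros)
qed

text \<open>Continuity descends through the quotient map because that map is open.\<close>

lemma continuous_on_torus_prod:
  fixes F :: "'a::topological_space \<Rightarrow> torus \<Rightarrow> torus" and G :: "'a \<Rightarrow> real \<times> real \<Rightarrow> real \<times> real"
  assumes G: "continuous_on (S \<times> UNIV) (\<lambda>(t, u). G t u)"
    and FG: "\<And>t u. t \<in> S \<Longrightarrow> F t (skew u) = skew (G t u)"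
  shows "continuous_on (S \<times> UNIV) (\<lambda>(t, x). F t x)"
  unfolding continuous_on_topological
proof (intro ballI allI impI)
  fix p B assume p: "p \<in> S \<times> (UNIV :: torus set)" and B: "open B" "(case p of (t, x) \<Rightarrow> F t x) \<in> B"
  obtain t u where tu: "p = (t, skew u)" "t \<in> S"
    using p by (metis SigmaE skew_surj)
  have "continuous_on (S \<times> UNIV) (skew \<circ> (\<lambda>(t, u). G t u))"
    by (intro continuous_on_compose G continuous_on_subset[OF continuous_on_skew]) auto
  moreover have "(t, u) \<in> S \<times> UNIV" "(skew \<circ> (\<lambda>(t, u). G t u)) (t, u) \<in> B"
    using tu B FG by auto
  ultimately obtain A where A: "open A" "(t, u) \<in> A"
     "\<forall>y\<in>S \<times> UNIV. y \<in> A \<longrightarrow> (skew \<circ> (\<lambda>(t, u). G t u)) y \<in> B"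
    using B(1) unfolding continuous_on_topological by metis
  obtain V W where VW: "open V" "open W" "(t, u) \<in> V \<times> W" "V \<times> W \<subseteq> A"
    using open_prod_elim[OF A(1,2)] by metis
  show "\<exists>A. open A \<and> p \<in> A \<and> (\<forall>y\<in>S \<times> UNIV. y \<in> A \<longrightarrow> (case y of (t, x) \<Rightarrow> F t x) \<in> B)"
  proof (intro exI[of _ "V \<times> skew ` W"] conjI ballI impI)
    show "open (V \<times> skew ` W)" using VW by (intro open_Times open_skew_image)
    show "p \<in> V \<times> skew ` W" using VW tu by auto
    fix y assume "y \<in> S \<times> (UNIV :: torus set)" "y \<in> V \<times> skew ` W"
    then obtain s w where "y = (s, skew w)" "s \<in> S" "s \<in> V" "w \<in> W" by auto
    then show "(case y of (t, x) \<Rightarrow> F t x) \<in> B"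
      using bspec[OF A(3), of "(s, w)"] subsetD[OF VW(4), of "(s, w)"] FG[of s w] by simp
  qed
qed

lemma continuous_on_torus:
  fixes f :: "torus \<Rightarrow> torus"
  assumes "continuous_on UNIV g" and "\<And>u. f (skew u) = skew (g u)"
  shows "continuous_on UNIV f"
proof -
  have "continuous_on UNIV (skew \<circ> g)"
    by (intro continuous_on_compose assms continuous_on_subset[OF continuous_on_skew]) auto
  then have "open (skew -` f -` B)" if "open B" for B
    using that by (simp add: continuous_on_open_vimage vimage_def assms(2))
  then show ?thesis
    by (simp add: continuous_on_open_vimage open_vimage_skew_iff)
qed

lemma torus_norm_le: "0 \<le> R \<Longrightarrow> torus_norm R v \<le> \<bar>fst v\<bar> + R * \<bar>snd v\<bar>"
  using norm_Pair_le[of "fst v" "R * snd v"] by (simp add: torus_norm_eq abs_mult)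

text \<open>A step in \<open>b\<close> moves both angles: it contributes once through \<theta> and
  \<open>R\<close> times through \<phi>, hence the weight \<open>1 + R\<close>.\<close>

lemma torus_dist_skew_le:
  assumes "0 < R"
  shows "torus_dist R (skew u) (skew v) \<le> \<bar>fst v - fst u\<bar> + (1 + R) * \<bar>snd v - snd u\<bar>"
proof -
  have "torus_dist R (skew u) (skew v) \<le> torus_norm R ((fst v + snd v, snd v) - (fst u + snd u, snd u))"
    unfolding skew_def by (rule torus_dist_le)
  also have "\<dots> \<le> \<bar>(fst v - fst u) + (snd v - snd u)\<bar> + R * \<bar>snd v - snd u\<bar>"
    using torus_norm_le[of R "(fst v + snd v, snd v) - (fst u + snd u, snd u)"] assms
    by (simp add: algebra_simps)
  also have "\<dots> \<le> \<bar>fst v - fst u\<bar> + (1 + R) * \<bar>snd v - snd u\<bar>"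
    by (simp add: algebra_simps) 
  finally show ?thesis .
qed

text \<open>Injectivity radius: the other lifts of the end point are at least
  \<open>2 * pi * min 1 R\<close> away from \<open>v\<close>, so by the triangle inequality none of
  them is nearer to \<open>u\<close> when the displacement is below half of that.\<close>

lemma torus_dist_eq_norm:
  assumes "0 < R" and small: "torus_norm R (v - u) < pi * min 1 R"
  shows "torus_dist R (torus_of u) (torus_of v) = torus_norm R (v - u)"
proof (rule antisym)
  show "torus_dist R (torus_of u) (torus_of v) \<le> torus_norm R (v - u)" by (rule torus_dist_le)
  show "torus_norm R (v - u) \<le> torus_dist R (torus_of u) (torus_of v)"
  proof (rule ccontr)
    assume "\<not> ?thesis"
    then obtain w where w: "torus_of w = torus_of v" "torus_norm R (w - u) < torus_norm R (v - u)"
      using torus_dist_less_obtain[of R "torus_of u" "torus_of v" "torus_norm R (v - u)" u] by auto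
    then have "torus_rel v w" by (simp flip: torus_of_eq_iff)
    then obtain k l where kl: "fst w = fst v + 2 * pi * of_int k" "snd w = snd v + 2 * pi * of_int l"
      unfolding torus_rel_def by blast
    then have wv: "w - v = (2 * pi * of_int k, 2 * pi * of_int l)" by (simp add: prod_eq_iff)
    have "w \<noteq> v" using w(2) by auto
  then have "(k, l) \<noteq> (0, 0)" using kl by (auto simp: prod_eq_iff[of w v])
    have "2 * pi * min 1 R \<le> torus_norm R (w - v)"
    proof (cases "k = 0")
      case False
      then have "1 \<le> \<bar>real_of_int k\<bar>" by linarith
      then have "2 * pi * min 1 R \<le> \<bar>2 * pi * real_of_int k\<bar>"
        by (simp add: abs_mult mult_le_cancel_left_pos)
      also have "\<dots> \<le> torus_norm R (w - v)"
        using norm_fst_le[of "2 * pi * real_of_int k" "R * (2 * pi * of_int l)"] by (simp add: torus_norm_eq wv)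
      finally show ?thesis .
    next
      case True
      then have "1 \<le> \<bar>real_of_int l\<bar>" using \<open>(k, l) \<noteq> (0, 0)\<close> by simp
      then have "R * 1 \<le> R * \<bar>real_of_int l\<bar>" using assms(1) by (intro mult_left_mono) auto
      then have "min 1 R \<le> R * \<bar>real_of_int l\<bar>" by linarith
      then have "2 * pi * min 1 R \<le> \<bar>R * (2 * pi * real_of_int l)\<bar>"
        using assms(1) by (simp add: abs_mult mult.left_commute[of R] mult_le_cancel_left_pos)
      also have "\<dots> \<le> torus_norm R (w - v)"
        using norm_snd_le[of "R * (2 * pi * real_of_int l)" "2 * pi * of_int k"] by (simp add: torus_norm_eq wv)
      finally show ?thesis .
    qed
    also have "\<dots> \<le> torus_norm R (w - u) + torus_norm R (v - u)"
      using torus_norm_triangle[of R "w - u" "u - v"] torus_norm_minus[of R u v] by simp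
    finally show False using w small by linarith
  qed
qed

section \<open>Distances in the cone\<close>

abbreviation cdist :: "real \<Rightarrow> torus cone \<Rightarrow> torus cone \<Rightarrow> real" where
  "cdist R \<equiv> cone_dist (torus_dist R)"

abbreviation paths :: "real \<Rightarrow> real \<Rightarrow> (real \<Rightarrow> torus cone) set" where
  "paths T R \<equiv> mspace (path_space T R)"

abbreviation pdist :: "real \<Rightarrow> real \<Rightarrow> (real \<Rightarrow> torus cone) \<Rightarrow> (real \<Rightarrow> torus cone) \<Rightarrow> real" where
  "pdist T R \<equiv> mdist (path_space T R)"

abbreviation path_topology :: "real \<Rightarrow> real \<Rightarrow> (real \<Rightarrow> torus cone) topology" where
  "path_topology T R \<equiv> mtopology_of (path_space T R)"

lemma torus_dist_refl [simp]: "0 < R \<Longrightarrow> torus_dist R x x = 0"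
  by (rule Metric_space.zero[OF Metric_space_torus, THEN iffD2]) auto

lemma cone_dist_triangle:
  "0 < R \<Longrightarrow> cdist R p q \<le> cdist R p w + cdist R w q"
  using Metric_space.triangle[OF Metric_space_cone[OF Metric_space_torus[of R]]] by auto

lemma cone_dist_ge_0: "0 < R \<Longrightarrow> 0 \<le> cdist R p q"
  using Metric_space.nonneg[OF Metric_space_cone[OF Metric_space_torus[of R]]] by auto

lemma cone_dist_commute: "0 < R \<Longrightarrow> cdist R p q = cdist R q p"
  using Metric_space.commute[OF Metric_space_cone[OF Metric_space_torus[of R]]] by auto

lemma cone_dist_same_point:
  "0 < R \<Longrightarrow> 0 \<le> r \<Longrightarrow> 0 \<le> s \<Longrightarrow> cdist R (cone_pt x r) (cone_pt x s) = \<bar>r - s\<bar>"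
  by (simp add: cone_dist_pt power2_diff[symmetric])

lemma one_minus_cos_eq: "1 - cos x = 2 * (sin (x / 2))\<^sup>2" for x :: real
  using cos_double_sin[of "x / 2"] by simp

text \<open>Half-angle form of the law of cosines. Radial and angular contributions become a sum of
  nonnegative terms, which suits both the elementary bounds below and the computation of metric
  derivatives.\<close>

lemma cone_dist_pt_alt:
  assumes "0 \<le> r" "0 \<le> s"
  shows "cone_dist d (cone_pt x r) (cone_pt y s) = sqrt ((r - s)\<^sup>2 + 4 * r * s * (sin (min (d x y) pi / 2))\<^sup>2)"
proof -
  have "r\<^sup>2 + s\<^sup>2 - 2 * r * s * cos (min (d x y) pi) = (r - s)\<^sup>2 + 2 * r * s * (1 - cos (min (d x y) pi))"
    by (simp add: power2_diff algebra_simps)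
  then show ?thesis using assms by (simp add: cone_dist_pt one_minus_cos_eq)
qed

lemma cone_dist_ge_radius:
  assumes "0 \<le> r" "0 \<le> s"
  shows "\<bar>r - s\<bar> \<le> cone_dist d (cone_pt x r) (cone_pt y s)"
  unfolding cone_dist_pt_alt[OF assms] using assms by (intro real_le_rsqrt) auto

lemma cone_r_dist_le: "\<bar>cone_r p - cone_r q\<bar> \<le> cone_dist d p q"
  by (metis cone_cases cone_dist_ge_radius cone_r_pt)

text \<open>The right-hand side is the length of the route through the apex. It does not see the
  base points, so it controls paths that turn, or even jump, close to the apex.\<close>

lemma cone_dist_le_sum:
  assumes "0 \<le> r" "0 \<le> s"
  shows "cone_dist d (cone_pt x r) (cone_pt y s) \<le> r + s"
proof -
  have "4 * r * s * (sin (min (d x y) pi / 2))\<^sup>2 \<le> 4 * r * s * 1"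
    using assms by (intro mult_left_mono) (auto simp: abs_square_le_1)
  then have "(r - s)\<^sup>2 + 4 * r * s * (sin (min (d x y) pi / 2))\<^sup>2 \<le> (r + s)\<^sup>2"
    by (simp add: power2_eq_square algebra_simps)
  then show ?thesis
    unfolding cone_dist_pt_alt[OF assms] using assms by (intro real_le_lsqrt) auto
qed

lemma cone_dist_same_radius:
  assumes "0 \<le> r" "0 \<le> d x y"
  shows "cone_dist d (cone_pt x r) (cone_pt y r) \<le> r * d x y"
proof -
  have "\<bar>sin (min (d x y) pi / 2)\<bar> \<le> \<bar>min (d x y) pi / 2\<bar>" by (rule abs_sin_x_le_abs_x)
  also have "\<dots> \<le> d x y / 2" using assms by auto
  finally have "2 * r * \<bar>sin (min (d x y) pi / 2)\<bar> \<le> 2 * r * (d x y / 2)"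
    using assms by (intro mult_left_mono) auto
  then have "\<bar>2 * r * sin (min (d x y) pi / 2)\<bar> \<le> r * d x y" using assms by (simp add: abs_mult)
  moreover have "cone_dist d (cone_pt x r) (cone_pt y r) = \<bar>2 * r * sin (min (d x y) pi / 2)\<bar>"
    using assms by (simp add: cone_dist_pt_alt real_sqrt_abs[symmetric] power_mult_distrib power2_eq_square algebra_simps del: real_sqrt_abs)
  ultimately show ?thesis by simp
qed

text \<open>The detour changes the radius above \<open>x\<close> and then moves at constant radius
  \<open>s\<close>.\<close>

lemma cone_dist_le:
  assumes "0 < R" "0 \<le> r" "0 \<le> s"
  shows "cdist R (cone_pt x r) (cone_pt y s) \<le> \<bar>r - s\<bar> + s * torus_dist R x y"
  using cone_dist_triangle[OF assms(1), of "cone_pt x r" "cone_pt y s" "cone_pt x s"]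
    cone_dist_same_point[of R r s x] cone_dist_same_radius[of s "torus_dist R" x y] assms torus_dist_ge_0[of R x y]
  by linarith

lemma cone_dist_scale:
  assumes "0 \<le> r" "0 \<le> s" "0 \<le> c"
  shows "cone_dist d (cone_pt x (c * r)) (cone_pt y (c * s)) = c * cone_dist d (cone_pt x r) (cone_pt y s)"
proof -
  have "(c * r)\<^sup>2 + (c * s)\<^sup>2 - 2 * (c * r) * (c * s) * cos (min (d x y) pi) =
        c\<^sup>2 * (r\<^sup>2 + s\<^sup>2 - 2 * r * s * cos (min (d x y) pi))" by (simp add: power2_eq_square algebra_simps)
  then show ?thesis
    using assms by (simp add: cone_dist_pt real_sqrt_mult)
qed

lemma cone_pt_radius_0: "cone_pt x 0 = cone_pt y 0"
  by (simp add: cone_pt_eq_iff)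

lemma cone_r_ge_0: "0 \<le> cone_r p"
  by (metis cone_cases cone_r_pt)

lemma cone_pt_eta [simp]: "cone_pt (cone_x xbar p) (cone_r p) = p"
  by (rule cone_cases[of p]) (metis cone_pt_radius_0 cone_r_pt cone_x_pt less_eq_real_def)

section \<open>The space of paths\<close>

text \<open>\<open>cfunspace\<close> also asks for a bounded image; here compactness of the interval
  provides it.\<close>

lemma path_space_iff:
  assumes "0 < R"
  shows "z \<in> paths T R \<longleftrightarrow>
     z \<in> extensional {0..T} \<and> continuous_map (top_of_set {0..T}) (mtopology_of (cone_metric R)) z"
proof
  show "z \<in> paths T R \<Longrightarrow>
     z \<in> extensional {0..T} \<and> continuous_map (top_of_set {0..T}) (mtopology_of (cone_metric R)) z"
    by (simp add: path_space_def)
  assume z: "z \<in> extensional {0..T} \<and> continuous_map (top_of_set {0..T}) (mtopology_of (cone_metric R)) z"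
  interpret C: Metric_space UNIV "cdist R"
    by (rule Metric_space_cone[OF Metric_space_torus[OF assms]])
  have top: "mtopology_of (cone_metric R) = C.mtopology"
    using assms by (simp add: mtopology_of_def mspace_cone_metric mdist_cone_metric)
  have "compactin (top_of_set {0..T}) {0..T}" by (simp add: compactin_subtopology)
  then have "compactin C.mtopology (z ` {0..T})"
    using z top image_compactin by metis
  then have "C.mbounded (z ` {0..T})" by (rule C.compactin_imp_mbounded)
  then show "z \<in> paths T R"
    using z assms by (simp add: path_space_def mspace_cone_metric mdist_cone_metric)
qed

lemma path_space_continuous:
  assumes "0 < R"
  shows "z \<in> paths T R \<longleftrightarrow> z \<in> extensional {0..T} \<and>
     (\<forall>t\<in>{0..T}. \<forall>e>0. \<exists>d>0. \<forall>s\<in>{0..T}. \<bar>s - t\<bar> < d \<longrightarrow> cdist R (z t) (z s) < e)"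
proof -
  interpret S: Metric_space "{0..T}" dist by (rule Met_TC.subspace) simp
  have C: "Metric_space UNIV (cdist R)"
    by (rule Metric_space_cone[OF Metric_space_torus[OF assms]])
  have top: "top_of_set {0..T} = S.mtopology"
    using mtopology_of_submetric[of euclidean_metric "{0..T}"]
    by (simp add: mtopology_of_def)
  have top2: "mtopology_of (cone_metric R) = Metric_space.mtopology UNIV (cdist R)"
    using assms by (simp add: mtopology_of_def mspace_cone_metric mdist_cone_metric)
  show ?thesis
    unfolding path_space_iff[OF assms] top top2 S.metric_continuous_map[OF C]
    by (simp add: dist_real_def abs_minus_commute Ball_def imp_conjL)
qed

lemma lipschitz_path_mem:
  assumes "0 < R" and L: "\<And>s t. s \<in> {0..T} \<Longrightarrow> t \<in> {0..T} \<Longrightarrow> cdist R (z s) (z t) \<le> L * \<bar>s - t\<bar>"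
  shows "(\<lambda>t\<in>{0..T}. z t) \<in> paths T R"
  unfolding path_space_continuous[OF assms(1)]
proof (intro conjI ballI allI impI)
  fix t e :: real assume t: "t \<in> {0..T}" and e: "0 < e"
  show "\<exists>d>0. \<forall>s\<in>{0..T}. \<bar>s - t\<bar> < d \<longrightarrow>
     cdist R ((\<lambda>t\<in>{0..T}. z t) t) ((\<lambda>t\<in>{0..T}. z t) s) < e"
  proof (intro exI[of _ "e / (\<bar>L\<bar> + 1)"] conjI ballI impI)
    fix s assume s: "s \<in> {0..T}" "\<bar>s - t\<bar> < e / (\<bar>L\<bar> + 1)"
    have "cdist R (z t) (z s) \<le> (\<bar>L\<bar> + 1) * \<bar>s - t\<bar>"
      using L[OF t s(1)] by (rule order_trans) (auto intro!: mult_mono simp: abs_minus_commute)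
    also have "\<dots> < e" using s(2) by (simp add: field_simps)
    finally show "cdist R ((\<lambda>t\<in>{0..T}. z t) t) ((\<lambda>t\<in>{0..T}. z t) s) < e"
      using s t by simp
  qed (use e in auto)
qed auto

lemma mdist_path_space_le:
  assumes "0 < R" "0 \<le> T" "z \<in> paths T R" "z' \<in> paths T R"
  shows "pdist T R z z' \<le> e \<longleftrightarrow> (\<forall>t\<in>{0..T}. cdist R (z t) (z' t) \<le> e)"
  using assms cfunspace_mdist_le[of z "top_of_set {0..T}" "cone_metric R" z']
  by (simp add: path_space_def mdist_cone_metric)

lemma cone_dist_path_le:
  assumes "0 < R" "z \<in> paths T R" "z' \<in> paths T R" "t \<in> {0..T}"
  shows "cdist R (z t) (z' t) \<le> pdist T R z z'"
  using assms mdist_path_space_le[of R T z z' "pdist T R z z'"] by auto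

lemma space_path_borel [simp]: "space (path_borel T R) = paths T R"
  by (simp add: path_borel_def space_measure_of_conv)

lemma sets_path_borel:
  "sets (path_borel T R) = sigma_sets (paths T R) {U. openin (path_topology T R) U}"
  unfolding path_borel_def
  by (rule sets_measure_of) (metis (no_types, lifting) Pow_iff mem_Collect_eq openin_subset subsetI topspace_mtopology_of)

lemma openin_path_borel: "openin (path_topology T R) U \<Longrightarrow> U \<in> sets (path_borel T R)"
  by (simp add: sets_path_borel sigma_sets.Basic)

lemma closedin_path_borel:
  assumes "closedin (path_topology T R) K"
  shows "K \<in> sets (path_borel T R)"
proof -
  have "space (path_borel T R) - (paths T R - K) \<in> sets (path_borel T R)"
    using assms by (intro sets.compl_sets openin_path_borel) (auto simp: closedin_def)
  moreover have "K \<subseteq> paths T R" using assms by (auto simp: closedin_def)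
  ultimately show ?thesis by (simp add: double_diff)
qed

lemma measurable_path_borelI:
  assumes "\<And>x. x \<in> space M \<Longrightarrow> X x \<in> paths T R"
    and "\<And>U. openin (path_topology T R) U \<Longrightarrow> X -` U \<inter> space M \<in> sets M"
  shows "X \<in> measurable M (path_borel T R)"
  unfolding path_borel_def
  by (rule measurable_measure_of) (use assms in \<open>auto simp: openin_subset[of "path_topology T R", simplified] dest!: openin_subset\<close>)

lemma measurable_path_real:
  assumes "continuous_map (path_topology T R) euclideanreal f"
  shows "f \<in> borel_measurable (path_borel T R)"
proof (rule borel_measurableI)
  fix S :: "real set" assume "open S"
  then have "openin (path_topology T R) {z \<in> paths T R. f z \<in> S}"
    using openin_continuous_map_preimage[OF assms, of S] by simp
  moreover have "{z \<in> paths T R. f z \<in> S} = f -` S \<inter> space (path_borel T R)" by auto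
  ultimately show "f -` S \<inter> space (path_borel T R) \<in> sets (path_borel T R)"
    using openin_path_borel by metis
qed

section \<open>Measures on the torus\<close>

abbreviation fund_square :: "(real \<times> real) set" where
  "fund_square \<equiv> {0..<2 * pi} \<times> {0..<2 * pi}"

lemma measurable_fst_real_pair [measurable]: "(fst :: real \<times> real \<Rightarrow> real) \<in> borel_measurable borel"
  and measurable_snd_real_pair [measurable]: "(snd :: real \<times> real \<Rightarrow> real) \<in> borel_measurable borel"
  by (auto intro!: borel_measurable_continuous_onI continuous_intros)

lemma sets_fund_square [measurable]: "fund_square \<in> sets borel"
  by (subst borel_prod[symmetric]) auto

definition square_measure :: "(real \<times> real) measure" where
  "square_measure = uniform_measure lborel fund_square"

lemma emeasure_fund_square: "emeasure lborel fund_square = ennreal (4 * pi\<^sup>2)"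
proof -
  have "emeasure lborel fund_square = emeasure (lborel \<Otimes>\<^sub>M lborel) fund_square"
    by (simp add: lborel_prod)
  also have "\<dots> = emeasure lborel {0..<2 * pi} * emeasure lborel {0..<2 * pi :: real}"
    by (rule lborel.emeasure_pair_measure_Times) auto
  also have "\<dots> = ennreal (4 * pi\<^sup>2)"
    by (simp add: ennreal_mult[symmetric] power2_eq_square)
  finally show ?thesis .
qed

lemma space_square_measure [simp]: "space square_measure = UNIV"
  and sets_square_measure [simp, measurable_cong]: "sets square_measure = sets borel"
  by (simp_all add: square_measure_def)

lemma prob_space_square_measure: "emeasure square_measure UNIV = 1"
  unfolding square_measure_def using sets_fund_square
  by (subst emeasure_uniform_measure) (auto simp: emeasure_fund_square)

lemma nn_integral_square_measure:
  assumes [measurable]: "f \<in> borel_measurable borel"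
  shows "(\<integral>\<^sup>+u. f u \<partial>square_measure) =
    (\<integral>\<^sup>+b\<in>{0..<2 * pi}. (\<integral>\<^sup>+a\<in>{0..<2 * pi}. f (a, b) \<partial>lborel) \<partial>lborel) / ennreal (4 * pi\<^sup>2)"
proof -
  have "(\<integral>\<^sup>+u. f u \<partial>square_measure) = (\<integral>\<^sup>+u. f u * indicator fund_square u \<partial>lborel) / ennreal (4 * pi\<^sup>2)"
    unfolding square_measure_def using sets_fund_square
    by (subst nn_integral_uniform_measure) (auto simp: emeasure_fund_square)
  also have "(\<integral>\<^sup>+u. f u * indicator fund_square u \<partial>lborel) =
     (\<integral>\<^sup>+u. f u * indicator fund_square u \<partial>(lborel \<Otimes>\<^sub>M lborel))"
    by (simp add: lborel_prod)
  also have "\<dots> = (\<integral>\<^sup>+b. (\<integral>\<^sup>+a. f (a, b) * indicator fund_square (a, b) \<partial>lborel) \<partial>lborel)"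
    by (rule lborel_pair.nn_integral_snd[symmetric]) (simp add: lborel_prod)
  also have "\<dots> = (\<integral>\<^sup>+b\<in>{0..<2 * pi}. (\<integral>\<^sup>+a\<in>{0..<2 * pi}. f (a, b) \<partial>lborel) \<partial>lborel)"
    by (intro nn_integral_cong) (auto simp: indicator_def)
  finally show ?thesis .
qed

lemma AE_square_measure:
  assumes "AE u in lborel. P u"
  shows "AE u in square_measure. P u"
  unfolding square_measure_def using assms sets_fund_square by (intro AE_uniform_measureI) auto

lemma AE_square_measure_fst:
  assumes "countable (A :: real set)"
  shows "AE u in square_measure. fst u \<notin> A"
proof (rule AE_square_measure)
  have A: "A \<in> sets borel" by (rule sets.countable[OF _ assms]) simp
  have "emeasure lborel A = 0" by (rule emeasure_lborel_countable[OF assms])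
  then have "emeasure (lborel \<Otimes>\<^sub>M lborel) (A \<times> (UNIV :: real set)) = 0"
    using A by (subst lborel.emeasure_pair_measure_Times) auto
  then have "A \<times> (UNIV :: real set) \<in> null_sets lborel"
    using borel_Times[OF A, of "UNIV :: real set"] by (simp add: null_sets_def lborel_prod)
  then show "AE u in (lborel :: (real \<times> real) measure). fst u \<notin> A"
    by (rule AE_I') auto
qed

text \<open>\<open>c\<close> is reduced modulo the period; after the translation, the piece that
  sticks out beyond \<open>p\<close> is moved back by one period.\<close>

lemma nn_integral_periodic_shift:
  fixes H :: "real \<Rightarrow> ennreal"
  assumes [measurable]: "H \<in> borel_measurable borel" and per: "\<And>a. H (a + p) = H a" and p: "0 < p"
  shows "(\<integral>\<^sup>+a\<in>{0..<p}. H (a + c) \<partial>lborel) = (\<integral>\<^sup>+a\<in>{0..<p}. H a \<partial>lborel)"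
proof -
  have per_int: "H (a + p * of_int k) = H a" for a and k :: int
  proof (induction k arbitrary: a rule: int_induct[where k = 0])
    case (step1 i)
    then show ?case using per[of "a + p * of_int i"] by (simp add: algebra_simps)
  next
    case (step2 i)
    then show ?case using per[of "a + p * (of_int i - 1)"] by (simp add: algebra_simps)
  qed simp
  define c' where "c' = c - p * of_int \<lfloor>c / p\<rfloor>"
  have c': "0 \<le> c'" "c' < p"
    using mult_left_mono[OF of_int_floor_le[of "c / p"], of p]
      mult_strict_left_mono[OF real_of_int_floor_add_one_gt[of "c / p"] p] p
    by (simp_all add: c'_def distrib_left)
  have "H (a + c) = H (a + c')" for a
    using per_int[of "a + c'" "\<lfloor>c / p\<rfloor>"] by (simp add: c'_def)
  then have "(\<integral>\<^sup>+a\<in>{0..<p}. H (a + c) \<partial>lborel) = (\<integral>\<^sup>+a. H (c' + 1 * a) * indicator {c'..<c' + p} (c' + 1 * a) \<partial>lborel)"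
    by (intro nn_integral_cong) (auto simp: indicator_def add.commute)
  also have "\<dots> = (\<integral>\<^sup>+a. H a * indicator {c'..<c' + p} a \<partial>lborel)"
    by (subst nn_integral_real_affine[of "\<lambda>a. H a * indicator {c'..<c' + p} a" 1 c']) auto
  also have "\<dots> = (\<integral>\<^sup>+a. H a * indicator {c'..<p} a + H a * indicator {p..<c' + p} a \<partial>lborel)"
    using c' by (intro nn_integral_cong) (auto simp: indicator_def)
  also have "\<dots> = (\<integral>\<^sup>+a. H a * indicator {c'..<p} a \<partial>lborel) + (\<integral>\<^sup>+a. H a * indicator {p..<c' + p} a \<partial>lborel)"
    by (intro nn_integral_add) auto
  also have "(\<integral>\<^sup>+a. H a * indicator {p..<c' + p} a \<partial>lborel) =
      (\<integral>\<^sup>+a. H (p + 1 * a) * indicator {p..<c' + p} (p + 1 * a) \<partial>lborel)"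
    by (subst nn_integral_real_affine[of "\<lambda>a. H a * indicator {p..<c' + p} a" 1 p]) auto
  also have "\<dots> = (\<integral>\<^sup>+a. H a * indicator {0..<c'} a \<partial>lborel)"
    using per by (intro nn_integral_cong) (auto simp: indicator_def add.commute)
  also have "(\<integral>\<^sup>+a. H a * indicator {c'..<p} a \<partial>lborel) + (\<integral>\<^sup>+a. H a * indicator {0..<c'} a \<partial>lborel) =
      (\<integral>\<^sup>+a. H a * indicator {c'..<p} a + H a * indicator {0..<c'} a \<partial>lborel)"
    by (intro nn_integral_add[symmetric]) auto
  also have "\<dots> = (\<integral>\<^sup>+a\<in>{0..<p}. H a \<partial>lborel)"
    using c' by (intro nn_integral_cong) (auto simp: indicator_def)
  finally show ?thesis .
qed

text \<open>On each line of constant \<open>b\<close>, \<open>skew\<close> differs from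
  \<open>torus_of\<close> by a translation of the first coordinate, which leaves the integral over a
  full period unchanged.\<close>

lemma torus_measure_eq: "torus_measure = distr square_measure borel skew"
proof (rule measure_eqI)
  show "sets torus_measure = sets (distr square_measure borel skew)"
    by (simp add: torus_measure_def)
  fix A assume "A \<in> sets torus_measure"
  then have A [measurable]: "A \<in> sets borel" by (simp add: torus_measure_def)
  have ind: "(\<lambda>u. indicator A (torus_of u) :: ennreal) \<in> borel_measurable borel"
    "(\<lambda>u. indicator A (skew u) :: ennreal) \<in> borel_measurable borel"
    by measurable
  have "emeasure torus_measure A = (\<integral>\<^sup>+u. indicator A (torus_of u) \<partial>square_measure)"
    unfolding torus_measure_def square_measure_def[symmetric]
    by (subst nn_integral_indicator[symmetric], simp, subst nn_integral_distr) auto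
  also have "\<dots> = (\<integral>\<^sup>+u. indicator A (skew u) \<partial>square_measure)"
  proof -
    have "(\<integral>\<^sup>+a\<in>{0..<2 * pi}. indicator A (torus_of (a, b)) \<partial>lborel) =
          (\<integral>\<^sup>+a\<in>{0..<2 * pi}. indicator A (skew (a, b)) \<partial>lborel)" for b
    proof -
      have "(\<lambda>a. indicator A (torus_of (a, b)) :: ennreal) \<in> borel_measurable borel"
        by measurable
      moreover have "torus_of (a + 2 * pi, b) = torus_of (a, b)" for a
        unfolding torus_of_eq_iff torus_rel_def by (intro exI[of _ "-1"] exI[of _ 0]) auto
      ultimately show ?thesis
        using nn_integral_periodic_shift[of "\<lambda>a. indicator A (torus_of (a, b))" "2 * pi" b]
        by (simp add: skew_def)
    qed
    then show ?thesis
      unfolding nn_integral_square_measure[OF ind(1)] nn_integral_square_measure[OF ind(2)] by simp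
  qed
  also have "\<dots> = emeasure (distr square_measure borel skew) A"
    by (subst nn_integral_indicator[symmetric], simp, subst nn_integral_distr) auto
  finally show "emeasure torus_measure A = emeasure (distr square_measure borel skew) A" .
qed

lemma space_torus_measure [simp]: "space torus_measure = UNIV"
  and sets_torus_measure [simp, measurable_cong]: "sets torus_measure = sets borel"
  by (simp_all add: torus_measure_def)

text \<open>\<open>stretch \<ell> \<alpha> \<beta>\<close> maps every cell \<open>[k\<ell>, (k+1)\<ell>)\<close> affinely onto its part \<open>[(k+\<alpha>)\<ell>, (k+\<beta>)\<ell>)\<close>.\<close>

definition stretch :: "real \<Rightarrow> real \<Rightarrow> real \<Rightarrow> real \<Rightarrow> real" where
  "stretch l \<alpha> \<beta> a = l * (of_int \<lfloor>a / l\<rfloor> + \<alpha> + (\<beta> - \<alpha>) * frac (a / l))"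

lemma measurable_frac [measurable]: "(frac :: real \<Rightarrow> real) \<in> borel_measurable borel"
  unfolding frac_def by measurable

lemma measurable_stretch [measurable]: "stretch l \<alpha> \<beta> \<in> borel_measurable borel"
  unfolding stretch_def by measurable

text \<open>An affine change of variables of ratio \<open>\<beta> - \<alpha>\<close> on each cell.
  As the interval consists of exactly \<open>N\<close> cells, no incomplete cell is left
  over.\<close>

lemma nn_integral_stretch:
  fixes N :: nat
  assumes [measurable]: "H \<in> borel_measurable borel" and N: "0 < N" and l: "l = p / N" "0 < p"
    and ab: "0 \<le> \<alpha>" "\<alpha> < \<beta>" "\<beta> \<le> 1"
  shows "(\<integral>\<^sup>+a\<in>{0..<p}. indicator {\<alpha>..<\<beta>} (frac (a / l)) * H a \<partial>lborel) =
     ennreal (\<beta> - \<alpha>) * (\<integral>\<^sup>+a\<in>{0..<p}. H (stretch l \<alpha> \<beta> a) \<partial>lborel)"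
proof -
  have l0: "0 < l" using l N by simp
  let ?C = "\<lambda>k. {l * real k..<l * (real k + 1)}"
  have fl: "\<lfloor>a / l\<rfloor> = int k" if "a \<in> ?C k" for a k
    using that l0 by (intro floor_unique) (auto simp: field_simps)
  have cells: "(indicator {0..<p} a :: ennreal) = (\<Sum>k<N. indicator (?C k) a)" for a
  proof (cases "a \<in> {0..<p}")
    case True
    define k where "k = nat \<lfloor>a / l\<rfloor>"
    have "0 \<le> a / l" using True l0 by auto
    then have kk: "real k \<le> a / l" "a / l < real k + 1" by (auto simp: k_def of_nat_nat)
    have "a / l < real N" using True l N l0 by (simp add: pos_divide_less_eq mult.commute)
    then have "k < N" using kk by linarith
    moreover have "indicator (?C j) a = (if j = k then 1 else 0 :: ennreal)" for j
    proof -
      have "a \<in> ?C k" using kk l0 by (auto simp: field_simps)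
      then have "a \<in> ?C j \<longleftrightarrow> j = k" using fl[of a j] fl[of a k] by (metis of_nat_eq_iff)
      then show ?thesis by (simp only: indicator_def) simp
    qed
    ultimately show ?thesis using True by simp
  next
    case False
    have "a \<notin> ?C k" if "k < N" for k
    proof
      assume "a \<in> ?C k"
      moreover have "0 \<le> l * real k" using l0 by simp
      ultimately have "0 \<le> a" "a < l * (real k + 1)" by simp_all
      moreover have "l * (real k + 1) \<le> l * real N" using l0 that by (intro mult_left_mono) auto
      ultimately show False using False l N by auto
    qed
    then show ?thesis using False by simp
  qed
  have cell: "(\<integral>\<^sup>+a. indicator {\<alpha>..<\<beta>} (frac (a / l)) * H a * indicator (?C k) a \<partial>lborel) =
     ennreal (\<beta> - \<alpha>) * (\<integral>\<^sup>+a. H (stretch l \<alpha> \<beta> a) * indicator (?C k) a \<partial>lborel)" for k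
  proof -
    let ?D = "{l * (real k + \<alpha>)..<l * (real k + \<beta>)}"
    \<comment> \<open>With this offset, \<open>a \<mapsto> t + (\<beta> - \<alpha>) * a\<close> maps
      the \<open>k\<close>-th cell onto its part \<open>?D\<close>, where it agrees with
      \<open>stretch\<close>.\<close>
    define t where "t = l * (real k + \<alpha>) - (\<beta> - \<alpha>) * (l * real k)"
    have 1: "indicator {\<alpha>..<\<beta>} (frac (a / l)) * H a * indicator (?C k) a = H a * indicator ?D a" for a
    proof (cases "a \<in> ?C k")
      case True
      then have "frac (a / l) = a / l - real k" using fl[OF True] by (simp add: frac_def)
      moreover have "\<alpha> \<le> a / l - real k \<longleftrightarrow> l * (real k + \<alpha>) \<le> a"
        using pos_le_divide_eq[OF l0, of "real k + \<alpha>" a] by (simp add: mult.commute le_diff_eq add.commute)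
      moreover have "a / l - real k < \<beta> \<longleftrightarrow> a < l * (real k + \<beta>)"
        using pos_divide_less_eq[OF l0, of a "real k + \<beta>"] by (simp add: mult.commute diff_less_eq add.commute)
      ultimately show ?thesis using True by (simp add: indicator_def)
    next
      case False
      have "l * (real k + \<alpha>) \<ge> l * real k" "l * (real k + \<beta>) \<le> l * (real k + 1)"
        using l0 ab by (auto intro!: mult_left_mono)
      then show ?thesis using False by (auto simp: indicator_def)
    qed
    have 2: "H (t + (\<beta> - \<alpha>) * a) * indicator ?D (t + (\<beta> - \<alpha>) * a) =
       H (stretch l \<alpha> \<beta> a) * indicator (?C k) a" for a
    proof -
      have "t + (\<beta> - \<alpha>) * a \<in> ?D \<longleftrightarrow> (\<beta> - \<alpha>) * (l * real k) \<le> (\<beta> - \<alpha>) * a \<and> (\<beta> - \<alpha>) * a < (\<beta> - \<alpha>) * (l * (real k + 1))"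
        by (auto simp: t_def algebra_simps)
      also have "\<dots> \<longleftrightarrow> a \<in> ?C k"
        using ab by (auto simp: mult_le_cancel_left_pos mult_less_cancel_left_pos)
      finally have "t + (\<beta> - \<alpha>) * a \<in> ?D \<longleftrightarrow> a \<in> ?C k" .
      moreover have "stretch l \<alpha> \<beta> a = t + (\<beta> - \<alpha>) * a" if "a \<in> ?C k"
        using fl[OF that] l0 by (simp add: stretch_def frac_def t_def field_simps)
      ultimately show ?thesis by (auto simp: indicator_def)
    qed
    have "(\<integral>\<^sup>+a. H a * indicator ?D a \<partial>lborel) =
       ennreal (\<beta> - \<alpha>) * (\<integral>\<^sup>+a. H (t + (\<beta> - \<alpha>) * a) * indicator ?D (t + (\<beta> - \<alpha>) * a) \<partial>lborel)"
      using ab by (subst nn_integral_real_affine[of "\<lambda>a. H a * indicator ?D a" "\<beta> - \<alpha>" t]) auto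
    then show ?thesis by (simp add: 1 2)
  qed
  have "(\<integral>\<^sup>+a\<in>{0..<p}. indicator {\<alpha>..<\<beta>} (frac (a / l)) * H a \<partial>lborel) =
     (\<Sum>k<N. \<integral>\<^sup>+a. indicator {\<alpha>..<\<beta>} (frac (a / l)) * H a * indicator (?C k) a \<partial>lborel)"
    by (subst nn_integral_sum[symmetric]) (auto simp: cells sum_distrib_left)
  also have "\<dots> = ennreal (\<beta> - \<alpha>) * (\<Sum>k<N. \<integral>\<^sup>+a. H (stretch l \<alpha> \<beta> a) * indicator (?C k) a \<partial>lborel)"
    by (simp add: cell sum_distrib_left)
  also have "(\<Sum>k<N. \<integral>\<^sup>+a. H (stretch l \<alpha> \<beta> a) * indicator (?C k) a \<partial>lborel) =
     (\<integral>\<^sup>+a\<in>{0..<p}. H (stretch l \<alpha> \<beta> a) \<partial>lborel)"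
    by (subst nn_integral_sum[symmetric]) (auto simp: cells sum_distrib_left)
  finally show ?thesis .
qed

lemma nn_integral_square_stretch:
  fixes N :: nat
  assumes [measurable]: "F \<in> borel_measurable borel" and N: "0 < N" and l: "l = 2 * pi / N"
    and ab: "0 \<le> \<alpha>" "\<alpha> < \<beta>" "\<beta> \<le> 1"
  shows "(\<integral>\<^sup>+u. indicator {\<alpha>..<\<beta>} (frac (fst u / l)) * F u \<partial>square_measure) =
     ennreal (\<beta> - \<alpha>) * (\<integral>\<^sup>+u. F (stretch l \<alpha> \<beta> (fst u), snd u) \<partial>square_measure)"
proof -
  have 1: "(\<integral>\<^sup>+a\<in>{0..<2 * pi}. indicator {\<alpha>..<\<beta>} (frac (a / l)) * F (a, b) \<partial>lborel) =
     ennreal (\<beta> - \<alpha>) * (\<integral>\<^sup>+a\<in>{0..<2 * pi}. F (stretch l \<alpha> \<beta> a, b) \<partial>lborel)" for b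
    using N l ab by (intro nn_integral_stretch) auto
  have [measurable]: "(\<lambda>b. \<integral>\<^sup>+a\<in>{0..<2 * pi}. F (stretch l \<alpha> \<beta> a, b) \<partial>lborel) \<in> borel_measurable borel"
    by measurable
  show ?thesis
    by (subst (1 2) nn_integral_square_measure)
      (measurable, measurable, simp add: 1[unfolded mult.assoc] nn_integral_cmult mult.assoc ennreal_times_divide)
qed

lemma emeasure_square_frac:
  fixes N :: nat
  assumes N: "0 < N" and l: "l = 2 * pi / N" and ab: "0 \<le> \<alpha>" "\<alpha> < \<beta>" "\<beta> \<le> 1"
  shows "emeasure square_measure {u. frac (fst u / l) \<in> {\<alpha>..<\<beta>}} = ennreal (\<beta> - \<alpha>)"
proof -
  have [measurable]: "{u :: real \<times> real. frac (fst u / l) \<in> {\<alpha>..<\<beta>}} \<in> sets borel"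
    using measurable_sets[of "\<lambda>u :: real \<times> real. frac (fst u / l)" borel borel "{\<alpha>..<\<beta>}"]
    by (simp add: vimage_def)
  have "emeasure square_measure {u. frac (fst u / l) \<in> {\<alpha>..<\<beta>}} =
    (\<integral>\<^sup>+u. indicator {\<alpha>..<\<beta>} (frac (fst u / l)) * 1 \<partial>square_measure)"
    by (subst nn_integral_indicator[symmetric]) (simp, intro nn_integral_cong, simp add: indicator_def)
  also have "\<dots> = ennreal (\<beta> - \<alpha>) * (\<integral>\<^sup>+u. 1 \<partial>square_measure)"
    by (rule nn_integral_square_stretch[OF _ assms]) auto
  finally show ?thesis using prob_space_square_measure by simp
qed

section \<open>Half sums and push-forwards\<close>

abbreviation push :: "real \<Rightarrow> real \<Rightarrow> (real \<times> real \<Rightarrow> real \<Rightarrow> torus cone) \<Rightarrow> (real \<Rightarrow> torus cone) measure" where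
  "push T R \<equiv> distr square_measure (path_borel T R)"

lemma space_half_sum [simp]: "space (half_sum \<mu> \<nu>) = space \<mu>"
  by (simp add: half_sum_def space_measure_of_conv)

lemma sets_half_sum [simp, measurable_cong]: "sets (half_sum \<mu> \<nu>) = sets \<mu>"
  unfolding half_sum_def by (rule sets.sets_measure_of_eq)

text \<open>\<open>measure_of\<close> takes on the prescribed values only after countable additivity
  has been verified.\<close>

lemma emeasure_half_sum:
  assumes "sets \<nu> = sets \<mu>" "A \<in> sets \<mu>"
  shows "emeasure (half_sum \<mu> \<nu>) A = (emeasure \<mu> A + emeasure \<nu> A) / 2"
proof -
  have "countably_additive (sets \<mu>) (\<lambda>A. (emeasure \<mu> A + emeasure \<nu> A) / 2)"
  proof (rule countably_additiveI)
    fix F :: "nat \<Rightarrow> 'a set" assume F: "range F \<subseteq> sets \<mu>" "disjoint_family F"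
    have "(\<Sum>i. (emeasure \<mu> (F i) + emeasure \<nu> (F i)) / 2) = (\<Sum>i. emeasure \<mu> (F i) + emeasure \<nu> (F i)) / 2"
      by (simp add: divide_ennreal_def)
    also have "\<dots> = ((\<Sum>i. emeasure \<mu> (F i)) + (\<Sum>i. emeasure \<nu> (F i))) / 2"
      by (simp add: suminf_add)
    also have "\<dots> = (emeasure \<mu> (\<Union>i. F i) + emeasure \<nu> (\<Union>i. F i)) / 2"
      using F assms by (simp add: suminf_emeasure)
    finally show "(\<Sum>i. (emeasure \<mu> (F i) + emeasure \<nu> (F i)) / 2) =
       (emeasure \<mu> (\<Union>i. F i) + emeasure \<nu> (\<Union>i. F i)) / 2" .
  qed
  then show ?thesis
    unfolding half_sum_def using assms
    by (subst emeasure_measure_of_sigma) (auto simp: positive_def sets.sigma_algebra_axioms)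
qed

lemma nn_integral_half_sum_measurable:
  assumes s: "sets \<nu> = sets \<mu>" and "f \<in> borel_measurable \<mu>"
  shows "(\<integral>\<^sup>+z. f z \<partial>half_sum \<mu> \<nu>) = ((\<integral>\<^sup>+z. f z \<partial>\<mu>) + (\<integral>\<^sup>+z. f z \<partial>\<nu>)) / 2"
  using assms(2)
proof (induction rule: borel_measurable_induct)
  case (cong f g)
  have "space \<nu> = space \<mu>" by (rule sets_eq_imp_space_eq[OF s])
  then have "(\<integral>\<^sup>+z. f z \<partial>half_sum \<mu> \<nu>) = (\<integral>\<^sup>+z. g z \<partial>half_sum \<mu> \<nu>)"
     "(\<integral>\<^sup>+z. f z \<partial>\<mu>) = (\<integral>\<^sup>+z. g z \<partial>\<mu>)" "(\<integral>\<^sup>+z. f z \<partial>\<nu>) = (\<integral>\<^sup>+z. g z \<partial>\<nu>)"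
    using cong(3) by (auto intro!: nn_integral_cong)
  then show ?case using cong by simp
next
  case (set A)
  then show ?case using s by (simp add: emeasure_half_sum)
next
  case (mult u c)
  have [measurable]: "u \<in> borel_measurable \<nu>" "u \<in> borel_measurable (half_sum \<mu> \<nu>)"
    using mult(2) s by (auto cong: measurable_cong_sets)
  show ?case using mult
    by (simp add: nn_integral_cmult distrib_left[symmetric] ennreal_times_divide)
next
  case (add u v)
  have [measurable]: "u \<in> borel_measurable \<nu>" "u \<in> borel_measurable (half_sum \<mu> \<nu>)"
     "v \<in> borel_measurable \<nu>" "v \<in> borel_measurable (half_sum \<mu> \<nu>)"
    using add s by (auto cong: measurable_cong_sets)
  show ?case using add
    by (simp add: nn_integral_add divide_ennreal_def distrib_right algebra_simps)
next
  case (seq U)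
  have U: "U i \<in> borel_measurable M" if "sets M = sets \<mu>" for i M
    using seq(1) that by (auto cong: measurable_cong_sets)
  have "(\<integral>\<^sup>+z. (SUP i. U i) z \<partial>half_sum \<mu> \<nu>) = (SUP i. ((\<integral>\<^sup>+z. U i z \<partial>\<mu>) + (\<integral>\<^sup>+z. U i z \<partial>\<nu>)) / 2)"
    using seq U by (simp add: image_comp SUP_apply nn_integral_monotone_convergence_SUP)
  also have "\<dots> = (SUP i. (\<integral>\<^sup>+z. U i z \<partial>\<mu>) + (\<integral>\<^sup>+z. U i z \<partial>\<nu>)) / 2"
    by (simp add: divide_ennreal_def SUP_mult_right_ennreal)
  also have "(SUP i. (\<integral>\<^sup>+z. U i z \<partial>\<mu>) + (\<integral>\<^sup>+z. U i z \<partial>\<nu>)) = (SUP i. \<integral>\<^sup>+z. U i z \<partial>\<mu>) + (SUP i. \<integral>\<^sup>+z. U i z \<partial>\<nu>)"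
    using \<open>incseq U\<close> by (intro ennreal_SUP_add) (auto simp: incseq_def le_fun_def intro!: nn_integral_mono)
  also have "\<dots> = (\<integral>\<^sup>+z. (SUP i. U i) z \<partial>\<mu>) + (\<integral>\<^sup>+z. (SUP i. U i) z \<partial>\<nu>)"
    using seq U s by (simp add: image_comp SUP_apply nn_integral_monotone_convergence_SUP)
  finally show ?case .
qed

text \<open>For an integrand that is not known to be measurable, \<open>nn_integral\<close> is the lower integral, which
  is the supremum of the integrals of the measurable minorants.\<close>

lemma nn_integral_le_measurable:
  assumes "\<And>g. g \<in> borel_measurable M \<Longrightarrow> (\<And>x. g x \<le> f x) \<Longrightarrow> (\<integral>\<^sup>+x. g x \<partial>M) \<le> C"
  shows "(\<integral>\<^sup>+x. f x \<partial>M) \<le> C"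
  unfolding nn_integral_def[of M f]
proof (rule SUP_least)
  fix g assume "g \<in> {g. simple_function M g \<and> g \<le> f}"
  then have g: "simple_function M g" "g \<le> f" by auto
  then have "integral\<^sup>S M g = (\<integral>\<^sup>+x. g x \<partial>M)" by (simp add: nn_integral_eq_simple_integral)
  also have "\<dots> \<le> C" using g by (intro assms borel_measurable_simple_function) (auto simp: le_fun_def)
  finally show "integral\<^sup>S M g \<le> C" .
qed

lemma nn_integral_half_sum_le:
  assumes "sets \<nu> = sets \<mu>"
  shows "(\<integral>\<^sup>+z. f z \<partial>half_sum \<mu> \<nu>) \<le> ((\<integral>\<^sup>+z. f z \<partial>\<mu>) + (\<integral>\<^sup>+z. f z \<partial>\<nu>)) / 2"
proof (rule nn_integral_le_measurable)
  fix g assume g: "g \<in> borel_measurable (half_sum \<mu> \<nu>)" "\<And>x. g x \<le> f x"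
  then have "(\<integral>\<^sup>+z. g z \<partial>half_sum \<mu> \<nu>) = ((\<integral>\<^sup>+z. g z \<partial>\<mu>) + (\<integral>\<^sup>+z. g z \<partial>\<nu>)) / 2"
    using assms by (intro nn_integral_half_sum_measurable) (auto cong: measurable_cong_sets)
  also have "\<dots> \<le> ((\<integral>\<^sup>+z. f z \<partial>\<mu>) + (\<integral>\<^sup>+z. f z \<partial>\<nu>)) / 2"
    using g(2) by (intro divide_right_mono_ennreal add_mono nn_integral_mono) auto
  finally show "(\<integral>\<^sup>+z. g z \<partial>half_sum \<mu> \<nu>) \<le> ((\<integral>\<^sup>+z. f z \<partial>\<mu>) + (\<integral>\<^sup>+z. f z \<partial>\<nu>)) / 2" .
qed

text \<open>The pointwise maximum of \<open>c\<close> on \<open>K\<close> and \<open>d\<close> on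
  \<open>L\<close> is one measurable minorant of \<open>f\<close> that serves both halves, so the
  bound holds for the lower integral of an arbitrary \<open>f\<close>.\<close>

lemma nn_integral_half_sum_ge:
  assumes "sets \<nu> = sets \<mu>"
    and K: "K \<in> sets \<mu>" "AE z in \<mu>. z \<in> K" "\<And>z. z \<in> K \<Longrightarrow> c \<le> f z" "emeasure \<mu> (space \<mu>) = 1"
    and L: "L \<in> sets \<nu>" "AE z in \<nu>. z \<in> L" "\<And>z. z \<in> L \<Longrightarrow> d \<le> f z" "emeasure \<nu> (space \<nu>) = 1"
  shows "(c + d) / 2 \<le> (\<integral>\<^sup>+z. f z \<partial>half_sum \<mu> \<nu>)"
proof -
  have sp: "space \<nu> = space \<mu>" by (rule sets_eq_imp_space_eq[OF assms(1)])
  have [measurable]: "K \<in> sets \<mu>" "L \<in> sets \<mu>" "K \<in> sets \<nu>" "L \<in> sets \<nu>" using K L assms(1) by auto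
  let ?g = "\<lambda>z. max (c * indicator K z) (d * indicator L z)"
  have g1: "c * indicator K z \<le> ?g z" "d * indicator L z \<le> ?g z" for z by auto
  have "c = (\<integral>\<^sup>+z. c * indicator K z \<partial>\<mu>)"
  proof -
    have "emeasure \<mu> K = 1"
      using emeasure_eq_AE[where M = \<mu> and A = K and B = "space \<mu>"] K by auto
    then show ?thesis by (simp add: nn_integral_cmult)
  qed
  also have "\<dots> \<le> (\<integral>\<^sup>+z. ?g z \<partial>\<mu>)" using g1 by (intro nn_integral_mono) auto
  finally have c: "c \<le> (\<integral>\<^sup>+z. ?g z \<partial>\<mu>)" .
  have "d = (\<integral>\<^sup>+z. d * indicator L z \<partial>\<nu>)"
  proof -
    have "emeasure \<nu> L = 1"
      using emeasure_eq_AE[where M = \<nu> and A = L and B = "space \<nu>"] L by auto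
    then show ?thesis by (simp add: nn_integral_cmult)
  qed
  also have "\<dots> \<le> (\<integral>\<^sup>+z. ?g z \<partial>\<nu>)" using g1 by (intro nn_integral_mono) auto
  finally have d: "d \<le> (\<integral>\<^sup>+z. ?g z \<partial>\<nu>)" .
  have "(c + d) / 2 \<le> ((\<integral>\<^sup>+z. ?g z \<partial>\<mu>) + (\<integral>\<^sup>+z. ?g z \<partial>\<nu>)) / 2"
    using c d by (intro divide_right_mono_ennreal add_mono)
  also have "\<dots> = (\<integral>\<^sup>+z. ?g z \<partial>half_sum \<mu> \<nu>)"
    using assms(1) by (intro nn_integral_half_sum_measurable[symmetric]) auto
  also have "\<dots> \<le> (\<integral>\<^sup>+z. f z \<partial>half_sum \<mu> \<nu>)"
    using K(3) L(3) by (intro nn_integral_mono) (auto simp: indicator_def)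
  finally show ?thesis .
qed

text \<open>Measurable minorants of \<open>f\<close> pull back to minorants of the composition. Only
  an inequality is claimed, since a minorant of the composition need not factor through
  \<open>X\<close>.\<close>

lemma nn_integral_distr_le:
  assumes [measurable]: "X \<in> measurable M N"
  shows "(\<integral>\<^sup>+z. f z \<partial>distr M N X) \<le> (\<integral>\<^sup>+x. f (X x) \<partial>M)"
proof (rule nn_integral_le_measurable)
  fix g assume g: "g \<in> borel_measurable (distr M N X)" "\<And>x. g x \<le> f x"
  then have "(\<integral>\<^sup>+z. g z \<partial>distr M N X) = (\<integral>\<^sup>+x. g (X x) \<partial>M)" by (simp add: nn_integral_distr)
  also have "\<dots> \<le> (\<integral>\<^sup>+x. f (X x) \<partial>M)" using g(2) by (intro nn_integral_mono)
  finally show "(\<integral>\<^sup>+z. g z \<partial>distr M N X) \<le> (\<integral>\<^sup>+x. f (X x) \<partial>M)" .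
qed

text \<open>For nonnegative bounded functions this is the statement for \<open>nn_integral\<close>;
  positive and negative parts are then recombined.\<close>

lemma integral_half_sum_bounded:
  fixes f :: "'a \<Rightarrow> real"
  assumes s: "sets \<nu> = sets \<mu>" and f: "f \<in> borel_measurable \<mu>" and B: "\<And>z. z \<in> space \<mu> \<Longrightarrow> \<bar>f z\<bar> \<le> B"
    and fin: "finite_measure \<mu>" "finite_measure \<nu>"
  shows "(\<integral>z. f z \<partial>half_sum \<mu> \<nu>) = ((\<integral>z. f z \<partial>\<mu>) + (\<integral>z. f z \<partial>\<nu>)) / 2"
proof -
  have sp: "space \<nu> = space \<mu>" by (rule sets_eq_imp_space_eq[OF s])
  have hs: "finite_measure (half_sum \<mu> \<nu>)"
  proof
    have "emeasure \<mu> (space \<mu>) \<noteq> \<infinity>" "emeasure \<nu> (space \<mu>) \<noteq> \<infinity>"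
      using fin sp by (auto simp: finite_measure.emeasure_finite)
    then show "emeasure (half_sum \<mu> \<nu>) (space (half_sum \<mu> \<nu>)) \<noteq> \<infinity>"
      using s by (simp add: emeasure_half_sum ennreal_divide_eq_top_iff)
  qed
  have f': "f \<in> borel_measurable \<nu>" "f \<in> borel_measurable (half_sum \<mu> \<nu>)"
    using f s by (auto cong: measurable_cong_sets)
  have eq: "(\<integral>z. g z \<partial>half_sum \<mu> \<nu>) = ((\<integral>z. g z \<partial>\<mu>) + (\<integral>z. g z \<partial>\<nu>)) / 2"
    if g: "g \<in> borel_measurable \<mu>" and gB: "\<And>z. z \<in> space \<mu> \<Longrightarrow> 0 \<le> g z \<and> g z \<le> C" for g :: "'a \<Rightarrow> real" and C
  proof -
    have g': "g \<in> borel_measurable \<nu>" "g \<in> borel_measurable (half_sum \<mu> \<nu>)"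
      using g s by (auto cong: measurable_cong_sets)
    have int: "integrable \<mu> g" "integrable \<nu> g" "integrable (half_sum \<mu> \<nu>) g"
      using gB sp g g' fin hs by (auto intro!: finite_measure.integrable_const_bound[where B = C] AE_I2)
    have nn: "(\<integral>\<^sup>+z. ennreal (g z) \<partial>M) = ennreal (\<integral>z. g z \<partial>M)" "0 \<le> (\<integral>z. g z \<partial>M)"
      if "M \<in> {\<mu>, \<nu>, half_sum \<mu> \<nu>}" for M
      using that int gB sp
      by (auto intro!: nn_integral_eq_integral integral_nonneg_AE AE_I2)
    have "ennreal (\<integral>z. g z \<partial>half_sum \<mu> \<nu>) = (ennreal (\<integral>z. g z \<partial>\<mu>) + ennreal (\<integral>z. g z \<partial>\<nu>)) / 2"
      using nn_integral_half_sum_measurable[OF s, of "\<lambda>z. ennreal (g z)"] g nn by simp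
    also have "\<dots> = ennreal (((\<integral>z. g z \<partial>\<mu>) + (\<integral>z. g z \<partial>\<nu>)) / 2)"
      using nn(2) by (simp add: ennreal_plus[symmetric] divide_ennreal[symmetric] del: ennreal_plus)
    finally show ?thesis using nn(2) by (subst (asm) ennreal_inj) auto
  qed
  have bd: "\<bar>max 0 (f z)\<bar> \<le> B" "\<bar>max 0 (- f z)\<bar> \<le> B" if "z \<in> space \<mu>" for z
    using B[OF that] by auto
  have split: "(\<integral>z. f z \<partial>M) = (\<integral>z. max 0 (f z) \<partial>M) - (\<integral>z. max 0 (- f z) \<partial>M)"
    if "M \<in> {\<mu>, \<nu>, half_sum \<mu> \<nu>}" for M
  proof -
    have M: "f \<in> borel_measurable M" "finite_measure M" "space M = space \<mu>"
      using that f f' fin hs sp space_half_sum[of \<mu> \<nu>] by (blast, blast, blast)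
    have "integrable M (\<lambda>z. max 0 (f z))" "integrable M (\<lambda>z. max 0 (- f z))"
      using M bd by (auto intro!: finite_measure.integrable_const_bound[where B = B] AE_I2)
    then have "(\<integral>z. max 0 (f z) \<partial>M) - (\<integral>z. max 0 (- f z) \<partial>M) = (\<integral>z. max 0 (f z) - max 0 (- f z) \<partial>M)"
      by simp
    also have "\<dots> = (\<integral>z. f z \<partial>M)" by (intro Bochner_Integration.integral_cong) auto
    finally show ?thesis ..
  qed
  have B': "0 \<le> max 0 (f z) \<and> max 0 (f z) \<le> B" "0 \<le> max 0 (- f z) \<and> max 0 (- f z) \<le> B" if "z \<in> space \<mu>" for z
    using B[OF that] by auto
  show ?thesis
    using eq[OF _ B'(1)] eq[OF _ B'(2)] f by (simp add: split field_simps)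
qed

text \<open>The completion in \<open>flow_measure\<close> is harmless: the measure can be computed from any Borel map
  that represents the paths of almost all particles.\<close>

lemma flow_measure_eq:
  assumes P [measurable]: "P \<in> measurable torus_measure (path_borel T R)"
    and eq: "AE x in torus_measure. is_cone_path T R \<phi> l x \<and> cone_path T \<phi> l x = P x"
    and apex: "\<And>x. (\<lambda>t\<in>{0..T}. cone_pt x 0) \<in> paths T R"
  shows "flow_measure T R \<phi> l = push T R (\<lambda>u. P (skew u))"
proof -
  let ?F = "\<lambda>x. if is_cone_path T R \<phi> l x then cone_path T \<phi> l x else (\<lambda>t\<in>{0..T}. cone_pt x 0)"
  have eqF: "AE x in torus_measure. ?F x = P x" using eq by eventually_elim auto
  then obtain N where N: "N \<in> null_sets torus_measure" "{x. ?F x \<noteq> P x} \<subseteq> N"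
    by (auto simp: eventually_ae_filter)
  have "?F -` A \<inter> space torus_measure \<in> sets (completion torus_measure) \<and>
        emeasure (completion torus_measure) (?F -` A \<inter> space torus_measure) = emeasure torus_measure (P -` A \<inter> space torus_measure)"
    if A: "A \<in> sets (path_borel T R)" for A
  proof -
    have PA: "P -` A \<inter> space torus_measure \<in> sets torus_measure" using A by measurable
    \<comment> \<open>Outside the null set \<open>N\<close> the two preimages agree, and inside
      \<open>N\<close> every subset is measurable for the completion.\<close>
    have dec: "?F -` A \<inter> space torus_measure = ((P -` A \<inter> space torus_measure) - N) \<union> ((?F -` A \<inter> space torus_measure) \<inter> N)"
      using N(2) by auto
    have "(?F -` A \<inter> space torus_measure) \<inter> N \<in> null_sets (completion torus_measure)"
      using N(1) by (intro null_sets_completion_subset[OF _ null_sets_completionI]) auto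
    moreover have "(P -` A \<inter> space torus_measure) - N \<in> sets (completion torus_measure)"
      using PA N(1) by auto
    ultimately have 1: "?F -` A \<inter> space torus_measure \<in> sets (completion torus_measure)"
      by (subst dec) (intro sets.Un; (assumption | erule null_setsD2))
    have "AE x in completion torus_measure. ?F x = P x"
      by (rule AE_completion[OF eqF])
    then have "emeasure (completion torus_measure) (?F -` A \<inter> space torus_measure) =
       emeasure (completion torus_measure) (P -` A \<inter> space torus_measure)"
      using 1 PA by (intro emeasure_eq_AE) (auto elim!: eventually_mono)
    then show ?thesis using 1 PA by simp
  qed
  then have FA: "?F -` A \<inter> space torus_measure \<in> sets (completion torus_measure)"
      "emeasure (completion torus_measure) (?F -` A \<inter> space torus_measure) = emeasure torus_measure (P -` A \<inter> space torus_measure)"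
    if "A \<in> sets (path_borel T R)" for A using that by blast+
  have "?F x \<in> paths T R" for x
    using apex by (auto simp: is_cone_path_def)
  then have [measurable]: "?F \<in> measurable (completion torus_measure) (path_borel T R)"
    using FA(1) by (intro measurableI) auto
  have "flow_measure T R \<phi> l = distr torus_measure (path_borel T R) P"
    unfolding flow_measure_def
    by (rule measure_eqI) (use FA(2) in \<open>auto simp: emeasure_distr\<close>)
  also have "\<dots> = push T R (\<lambda>u. P (skew u))"
    unfolding torus_measure_eq
    by (subst distr_distr) (use P in \<open>auto simp: o_def cong: measurable_cong_sets\<close>)
  finally show ?thesis .
qed

section \<open>Uniqueness of derivatives on the torus\<close>

text \<open>Both differences lie in the lattice of periods, whose distinct points are at least
  \<open>2 * pi\<close> apart.\<close>

lemma lattice_rigid: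
  assumes "torus_rel u u'" "torus_rel v v'" "norm ((u' - u) - (v' - v)) < 1"
  shows "u' - u = v' - v"
proof -
  obtain k l where u: "fst u' = fst u + 2 * pi * of_int k" "snd u' = snd u + 2 * pi * of_int l"
    using assms(1) by (auto simp: torus_rel_def)
  obtain k' l' where v: "fst v' = fst v + 2 * pi * of_int k'" "snd v' = snd v + 2 * pi * of_int l'"
    using assms(2) by (auto simp: torus_rel_def)
  let ?d = "(u' - u) - (v' - v)"
  have z: "m = 0" if "\<bar>2 * pi * of_int m\<bar> < 1" for m :: int
  proof (rule ccontr)
    assume "m \<noteq> 0"
    then have "1 \<le> \<bar>real_of_int m\<bar>" by linarith
    then have "2 * pi * 1 \<le> 2 * pi * \<bar>real_of_int m\<bar>" by (intro mult_left_mono) auto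
    also have "\<dots> < 1" using that by (simp add: abs_mult)
    finally show False using pi_gt3 by simp
  qed
  have "\<bar>fst ?d\<bar> < 1" "\<bar>snd ?d\<bar> < 1"
    using assms(3) norm_fst_le[of "fst ?d" "snd ?d"] norm_snd_le[of "snd ?d" "fst ?d"]
    unfolding prod.collapse by (simp_all only: real_norm_def)
  then have "\<bar>2 * pi * of_int (k - k')\<bar> < 1" "\<bar>2 * pi * of_int (l - l')\<bar> < 1"
    using u v by (auto simp: algebra_simps)
  then have "k = k'" "l = l'" using z by fastforce+
  then show ?thesis using u v by (simp add: prod_eq_iff)
qed

text \<open>Two lifts differ by a lattice vector that depends continuously on the parameter, hence
  is locally constant. This makes velocities and differentials independent of the lift.\<close>

lemma lifts_differ_eventually:
  fixes g g' :: "'a::t2_space \<Rightarrow> real \<times> real"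
  assumes "\<forall>\<^sub>F s in at t within S. torus_of (g s) = torus_of (g' s)" "torus_of (g t) = torus_of (g' t)"
    and "continuous (at t within S) g" "continuous (at t within S) g'"
  shows "\<forall>\<^sub>F s in at t within S. g s - g t = g' s - g' t"
proof -
  have "((\<lambda>s. (g' s - g s) - (g' t - g t)) \<longlongrightarrow> (g' t - g t) - (g' t - g t)) (at t within S)"
    using assms(3,4) by (intro tendsto_intros) (auto simp: continuous_within)
  then have "\<forall>\<^sub>F s in at t within S. norm ((g' s - g s) - (g' t - g t)) < 1"
    by (auto simp: tendsto_iff dist_norm dest: spec[of _ 1])
  with assms(1) show ?thesis
  proof eventually_elim
    case (elim s)
    then have "g' s - g s = g' t - g t"
      using assms(2) by (intro lattice_rigid) (auto simp flip: torus_of_eq_iff)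
    then show ?case by (simp add: algebra_simps)
  qed
qed

lemma torus_velocity_unique:
  assumes T: "0 < T" "t \<in> {0..T}" and v: "torus_has_velocity x v t {0..T}" and v': "torus_has_velocity x v' t {0..T}"
  shows "v = v'"
proof -
  let ?F = "at t within {0..T}"
  obtain u where u: "torus_of (u t) = x t" "\<forall>\<^sub>F s in ?F. torus_of (u s) = x s" "(u has_vector_derivative v) ?F"
    using v by (auto simp: torus_has_velocity_def)
  obtain u' where u': "torus_of (u' t) = x t" "\<forall>\<^sub>F s in ?F. torus_of (u' s) = x s" "(u' has_vector_derivative v') ?F"
    using v' by (auto simp: torus_has_velocity_def)
  have "\<forall>\<^sub>F s in ?F. u s - u t = u' s - u' t"
  proof (rule lifts_differ_eventually)
    show "\<forall>\<^sub>F s in ?F. torus_of (u s) = torus_of (u' s)" using u(2) u'(2) by eventually_elim simp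
  qed (use u u' in \<open>auto intro: has_vector_derivative_continuous\<close>)
  then have ev: "\<forall>\<^sub>F s in ?F. u' s - u' t + u t = u s" by eventually_elim (simp add: algebra_simps)
  have "((\<lambda>s. u' s - u' t + u t) has_vector_derivative v') ?F"
    using u'(3) by (auto intro!: derivative_eq_intros)
  then have "(u has_vector_derivative v') ?F"
    unfolding has_vector_derivative_def
    by (rule has_derivative_transform_eventually) (use T ev in auto)
  moreover have "at t within {0..T} \<noteq> bot"
    using T by (simp add: trivial_limit_within islimpt_Icc)
  ultimately show ?thesis using u(3) vector_derivative_unique_within by blast
qed

lemma torus_velocity_eq:
  assumes "0 < T" "t \<in> {0..T}" "torus_has_velocity x v t {0..T}"
  shows "torus_velocity x t {0..T} = v"
  unfolding torus_velocity_def using assms torus_velocity_unique by blast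

lemma torus_derivative_unique:
  assumes D: "torus_has_derivative f D x" and D': "torus_has_derivative f D' x"
  shows "D = D'"
proof -
  obtain u g where u: "torus_of u = x" "\<forall>\<^sub>F v in nhds u. f (torus_of v) = torus_of (g v)" "(g has_derivative D) (at u)"
    using D by (auto simp: torus_has_derivative_def)
  obtain u' g' where u': "torus_of u' = x" "\<forall>\<^sub>F v in nhds u'. f (torus_of v) = torus_of (g' v)" "(g' has_derivative D') (at u')"
    using D' by (auto simp: torus_has_derivative_def)
  \<comment> \<open>The second lift is translated by a period, so that both lifts are based at the
    same representative \<open>u\<close>.\<close>
  define h where "h v = g' (v + (u' - u))" for v
  have per: "torus_of (v + (u' - u)) = torus_of v" for v
  proof -
    have "torus_rel u' u" using u(1) u'(1) by (simp flip: torus_of_eq_iff)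
    then obtain k l where "fst u = fst u' + 2 * pi * of_int k" "snd u = snd u' + 2 * pi * of_int l"
      by (auto simp: torus_rel_def)
    then show ?thesis unfolding torus_of_eq_iff torus_rel_def by (intro exI[of _ k] exI[of _ l]) auto
  qed
  have lim: "filterlim (\<lambda>v. v + (u' - u)) (nhds (u + (u' - u))) (nhds u)"
    by (intro tendsto_intros filterlim_ident)
  have "\<forall>\<^sub>F v in nhds (u + (u' - u)). f (torus_of v) = torus_of (g' v)"
    using u'(2) by simp
  then have "\<forall>\<^sub>F v in nhds u. f (torus_of (v + (u' - u))) = torus_of (g' (v + (u' - u)))"
    using lim by (rule eventually_compose_filterlim)
  then have h: "\<forall>\<^sub>F v in nhds u. f (torus_of v) = torus_of (h v)"
    unfolding per h_def[symmetric] .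
  have dh: "(h has_derivative D') (at u)"
  proof -
    have "((\<lambda>v. v + (u' - u)) has_derivative (\<lambda>v. v)) (at u)" by (auto intro!: derivative_eq_intros)
    from has_derivative_compose[OF this, of g' D'] u'(3) show ?thesis by (simp add: h_def[abs_def])
  qed
  have "\<forall>\<^sub>F v in at u. g v - g u = h v - h u"
  proof (rule lifts_differ_eventually)
    have "\<forall>\<^sub>F v in nhds u. torus_of (g v) = torus_of (h v)" using u(2) h by eventually_elim simp
    then show "\<forall>\<^sub>F v in at u. torus_of (g v) = torus_of (h v)" "torus_of (g u) = torus_of (h u)"
      by (auto simp: eventually_nhds_conv_at)
  qed (use u(3) dh in \<open>auto intro: has_derivative_continuous\<close>)
  then have ev: "\<forall>\<^sub>F v in at u. h v - h u + g u = g v" by eventually_elim (simp add: algebra_simps)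
  have "((\<lambda>v. h v - h u + g u) has_derivative D') (at u)"
    using dh by (auto intro!: derivative_eq_intros)
  then have "(g has_derivative D') (at u)"
    by (rule has_derivative_transform_eventually) (use ev in auto)
  then show ?thesis using u(3) by (rule has_derivative_unique[rotated])
qed

lemma torus_jac_eq:
  assumes "torus_has_derivative f D x"
  shows "torus_jac f x = fst (D (1, 0)) * snd (D (0, 1)) - fst (D (0, 1)) * snd (D (1, 0))"
proof -
  have "(THE D. torus_has_derivative f D x) = D"
    using assms torus_derivative_unique by blast
  then show ?thesis by (simp add: torus_jac_def Let_def det_2)
qed

section \<open>Action of Lipschitz paths\<close>

text \<open>The limit is taken along \<open>nhds 0\<close>, with the value 1 filled in at 0, because
  a displacement can vanish at times arbitrarily close to the one considered.\<close>

lemma sinc_tendsto_1: "((\<lambda>y::real. if y = 0 then 1 else sin y / y) \<longlongrightarrow> 1) (nhds 0)"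
proof -
  have "((\<lambda>y::real. sin y / y) \<longlongrightarrow> 1) (at 0)"
    using DERIV_sin[of 0] by (simp add: has_field_derivative_iff)
  then have "((\<lambda>y::real. if y = 0 then 1 else sin y / y) \<longlongrightarrow> 1) (at 0)"
    by (rule Lim_transform_eventually) (auto simp: eventually_at_filter)
  then show ?thesis by (simp add: tendsto_nhds_iff)
qed

lemma torus_norm_quotient_tendsto:
  assumes "(u has_vector_derivative v) (at t within S)"
  shows "((\<lambda>s. torus_norm R (u s - u t) / \<bar>s - t\<bar>) \<longlongrightarrow> torus_norm R v) (at t within S)"
proof -
  have "((\<lambda>s. fst (u s)) has_vector_derivative fst v) (at t within S)" "((\<lambda>s. snd (u s)) has_vector_derivative snd v) (at t within S)"
    using bounded_linear.has_vector_derivative[OF bounded_linear_fst assms]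
      bounded_linear.has_vector_derivative[OF bounded_linear_snd assms] by auto
  then have lim: "((\<lambda>s. (fst (u s) - fst (u t)) / (s - t)) \<longlongrightarrow> fst v) (at t within S)"
     "((\<lambda>s. (snd (u s) - snd (u t)) / (s - t)) \<longlongrightarrow> snd v) (at t within S)"
    by (auto simp: has_real_derivative_iff_has_vector_derivative[symmetric] has_field_derivative_iff)
  have eq: "torus_norm R (u s - u t) / \<bar>s - t\<bar> =
     sqrt (((fst (u s) - fst (u t)) / (s - t))\<^sup>2 + R\<^sup>2 * ((snd (u s) - snd (u t)) / (s - t))\<^sup>2)" for s
  proof -
    have "torus_norm R (u s - u t) / \<bar>s - t\<bar> =
      sqrt (((fst (u s) - fst (u t))\<^sup>2 + R\<^sup>2 * (snd (u s) - snd (u t))\<^sup>2) / (s - t)\<^sup>2)"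
      by (simp add: torus_norm_def real_sqrt_divide)
    then show ?thesis by (simp add: add_divide_distrib power_divide)
  qed
  show ?thesis
    unfolding eq torus_norm_def[of R v] by (intro tendsto_intros lim)
qed

text \<open>In the half-angle formula the angular term is
  \<open>\<rho> s * \<rho> t * (D s * sinc (D s / 2))\<^sup>2\<close>; after division by
  \<open>(s - t)\<^sup>2\<close> every factor has a limit.\<close>

lemma cone_metric_derivative:
  assumes R: "0 < R" and t: "t \<in> S" and v: "torus_has_velocity x v t S"
    and \<rho>: "\<And>s. s \<in> S \<Longrightarrow> 0 \<le> \<rho> s" and d\<rho>: "(\<rho> has_vector_derivative \<rho>') (at t within S)"
  shows "((\<lambda>s. cdist R (cone_pt (x s) (\<rho> s)) (cone_pt (x t) (\<rho> t)) / \<bar>s - t\<bar>)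
     \<longlongrightarrow> sqrt ((\<rho> t)\<^sup>2 * (torus_norm R v)\<^sup>2 + \<rho>'\<^sup>2)) (at t within S)"
proof -
  let ?F = "at t within S"
  obtain u where u: "torus_of (u t) = x t" "\<forall>\<^sub>F s in ?F. torus_of (u s) = x s" "(u has_vector_derivative v) ?F"
    using v by (auto simp: torus_has_velocity_def)
  define D where "D s = torus_norm R (u s - u t)" for s
  define sinc where "sinc y = (if y = 0 then 1 else sin y / y)" for y :: real
  have cont: "(u \<longlongrightarrow> u t) ?F" "(\<rho> \<longlongrightarrow> \<rho> t) ?F"
    using has_vector_derivative_continuous[OF u(3)] has_vector_derivative_continuous[OF d\<rho>]
    by (auto simp: continuous_within)
  have "((\<lambda>s. sqrt ((fst (u s - u t))\<^sup>2 + R\<^sup>2 * (snd (u s - u t))\<^sup>2)) \<longlongrightarrow>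
      sqrt ((fst (u t - u t))\<^sup>2 + R\<^sup>2 * (snd (u t - u t))\<^sup>2)) ?F"
    by (intro tendsto_intros cont)
  then have D0: "(D \<longlongrightarrow> 0) ?F" by (simp add: D_def[abs_def] torus_norm_def)
  have Dq: "((\<lambda>s. D s / \<bar>s - t\<bar>) \<longlongrightarrow> torus_norm R v) ?F"
    unfolding D_def by (rule torus_norm_quotient_tendsto[OF u(3)])
  have "((\<lambda>s. D s / 2) \<longlongrightarrow> 0) ?F" using tendsto_divide[OF D0 tendsto_const[of 2]] by simp
  then have sinc: "((\<lambda>s. sinc (D s / 2)) \<longlongrightarrow> 1) ?F"
    by (rule filterlim_compose[OF sinc_tendsto_1[folded sinc_def]])
  have q\<rho>: "((\<lambda>s. (\<rho> s - \<rho> t) / (s - t)) \<longlongrightarrow> \<rho>') ?F"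
    using d\<rho> by (auto simp: has_real_derivative_iff_has_vector_derivative[symmetric] has_field_derivative_iff)
  have "((\<lambda>s. sqrt (((\<rho> s - \<rho> t) / (s - t))\<^sup>2 + \<rho> s * \<rho> t * (D s / \<bar>s - t\<bar> * sinc (D s / 2))\<^sup>2)) \<longlongrightarrow>
      sqrt (\<rho>'\<^sup>2 + \<rho> t * \<rho> t * (torus_norm R v * 1)\<^sup>2)) ?F"
    by (intro tendsto_intros q\<rho> cont Dq sinc)
  then have lim: "((\<lambda>s. sqrt (((\<rho> s - \<rho> t) / (s - t))\<^sup>2 + \<rho> s * \<rho> t * (D s / \<bar>s - t\<bar> * sinc (D s / 2))\<^sup>2)) \<longlongrightarrow>
      sqrt ((\<rho> t)\<^sup>2 * (torus_norm R v)\<^sup>2 + \<rho>'\<^sup>2)) ?F"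
    by (simp add: power2_eq_square algebra_simps)
  \<comment> \<open>Close to \<open>t\<close> the displacement of the lift is below the injectivity
    radius, so it equals the torus distance, and the truncation of the angle at \<open>pi\<close> is
    inactive.\<close>
  have "\<forall>\<^sub>F s in ?F. D s < min pi (pi * min 1 R)"
    using D0 R by (intro order_tendstoD(2)[OF D0]) auto
  moreover have "\<forall>\<^sub>F s in ?F. s \<in> S \<and> s \<noteq> t" by (simp add: eventually_at_filter)
  ultimately have "\<forall>\<^sub>F s in ?F. sqrt (((\<rho> s - \<rho> t) / (s - t))\<^sup>2 + \<rho> s * \<rho> t * (D s / \<bar>s - t\<bar> * sinc (D s / 2))\<^sup>2) =
     cdist R (cone_pt (x s) (\<rho> s)) (cone_pt (x t) (\<rho> t)) / \<bar>s - t\<bar>"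
    using u(2)
  proof eventually_elim
    case (elim s)
    have "torus_norm R (u t - u s) < pi * min 1 R"
      using elim(1) by (simp add: D_def torus_norm_minus[of R "u t"])
    then have "torus_dist R (x s) (x t) = torus_norm R (u t - u s)"
      using torus_dist_eq_norm[OF R, of "u t" "u s"] elim(3) u(1) by metis
    then have dx: "torus_dist R (x s) (x t) = D s" by (simp add: D_def torus_norm_minus[of R "u t"])
    have s2: "2 * sin (D s / 2) = D s * sinc (D s / 2)" by (simp add: sinc_def)
    have "4 * \<rho> s * \<rho> t * (sin (D s / 2))\<^sup>2 = \<rho> s * \<rho> t * (2 * sin (D s / 2))\<^sup>2"
      by (simp add: power2_eq_square)
    also have "\<dots> = \<rho> s * \<rho> t * (D s * sinc (D s / 2))\<^sup>2" by (simp only: s2)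
    finally have s4: "4 * \<rho> s * \<rho> t * (sin (D s / 2))\<^sup>2 = \<rho> s * \<rho> t * (D s * sinc (D s / 2))\<^sup>2" .
    have "min (D s) pi = D s" using elim(1) by linarith
    with s4 have "cdist R (cone_pt (x s) (\<rho> s)) (cone_pt (x t) (\<rho> t)) =
        sqrt ((\<rho> s - \<rho> t)\<^sup>2 + \<rho> s * \<rho> t * (D s * sinc (D s / 2))\<^sup>2)"
      using \<rho>[of s] \<rho>[of t] t elim(2) by (simp only: cone_dist_pt_alt dx simp_thms)
    then have "cdist R (cone_pt (x s) (\<rho> s)) (cone_pt (x t) (\<rho> t)) / \<bar>s - t\<bar> =
        sqrt (((\<rho> s - \<rho> t)\<^sup>2 + \<rho> s * \<rho> t * (D s * sinc (D s / 2))\<^sup>2) / (s - t)\<^sup>2)"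
      by (simp add: real_sqrt_divide)
    also have "\<dots> = sqrt (((\<rho> s - \<rho> t) / (s - t))\<^sup>2 + \<rho> s * \<rho> t * (D s / \<bar>s - t\<bar> * sinc (D s / 2))\<^sup>2)"
      by (simp add: add_divide_distrib power_divide power_mult_distrib)
    finally show ?case by simp
  qed
  then show ?thesis by (rule Lim_transform_eventually[OF lim])
qed

text \<open>The Lipschitz constant serves as the integrable majorant in the definition of absolute
  continuity and bounds the metric derivative. \<open>F\<close> collects the times where the radius
  vanishes or a derivative is missing; being finite, it is a null set.\<close>

lemma path_action_eq:
  fixes x :: "real \<Rightarrow> torus" and \<rho> :: "real \<Rightarrow> real"
  defines "z \<equiv> \<lambda>t. cone_pt (x t) (\<rho> t)"
  assumes R: "0 < R" and T: "0 < T"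
    and L: "\<And>s t. s \<in> {0..T} \<Longrightarrow> t \<in> {0..T} \<Longrightarrow> cdist R (z s) (z t) \<le> L * \<bar>s - t\<bar>"
    and \<rho>: "\<And>t. t \<in> {0..T} \<Longrightarrow> 0 \<le> \<rho> t"
    and F: "finite F"
    and pos: "\<And>t. t \<in> {0..T} - F \<Longrightarrow> 0 < \<rho> t"
    and vel: "\<And>t. t \<in> {0..T} - F \<Longrightarrow> torus_has_velocity x (v t) t {0..T}"
    and d\<rho>: "\<And>t. t \<in> {0..T} - F \<Longrightarrow> (\<rho> has_vector_derivative \<rho>' t) (at t within {0..T})"
    and [measurable]: "\<rho> \<in> borel_measurable borel" "v \<in> borel_measurable borel" "\<rho>' \<in> borel_measurable borel"
  shows "path_action xbar T R (\<lambda>t\<in>{0..T}. z t) =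
    (\<integral>\<^sup>+t\<in>{0..T}. ennreal ((\<rho> t)\<^sup>2 * (torus_norm R (v t))\<^sup>2 + (\<rho>' t)\<^sup>2) \<partial>lborel)"
proof -
  define m where "m t = sqrt ((\<rho> t)\<^sup>2 * (torus_norm R (v t))\<^sup>2 + (\<rho>' t)\<^sup>2)" for t
  have [measurable]: "(\<lambda>t. torus_norm R (v t)) \<in> borel_measurable borel"
    unfolding torus_norm_def by measurable
  have m [measurable]: "m \<in> borel_measurable borel"
    unfolding m_def by measurable
  have lim: "((\<lambda>s. cdist R ((\<lambda>t\<in>{0..T}. z t) s) ((\<lambda>t\<in>{0..T}. z t) t) / \<bar>s - t\<bar>) \<longlongrightarrow> m t) (at t within {0..T})"
    if t: "t \<in> {0..T} - F" for t
  proof -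
    have "((\<lambda>s. cdist R (z s) (z t) / \<bar>s - t\<bar>) \<longlongrightarrow> m t) (at t within {0..T})"
      unfolding m_def z_def using t by (intro cone_metric_derivative R vel \<rho> d\<rho>) auto
    then show ?thesis
      by (rule Lim_transform_eventually) (use t in \<open>auto simp: eventually_at_filter\<close>)
  qed
  have m_le: "(m t)\<^sup>2 \<le> L\<^sup>2" if t: "t \<in> {0..T} - F" for t
  proof -
    have "m t \<le> L"
    proof (rule tendsto_upperbound[OF lim[OF t]])
      show "at t within {0..T} \<noteq> bot" using t T by (simp add: trivial_limit_within islimpt_Icc)
      have "\<forall>\<^sub>F s in at t within {0..T}. s \<in> {0..T} \<and> s \<noteq> t" by (simp add: eventually_at_filter)
      then show "\<forall>\<^sub>F s in at t within {0..T}. cdist R ((\<lambda>t\<in>{0..T}. z t) s) ((\<lambda>t\<in>{0..T}. z t) t) / \<bar>s - t\<bar> \<le> L"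
      proof eventually_elim
        case (elim s)
        then show ?case using L[of s t] t by (simp add: pos_divide_le_eq)
      qed
    qed
    moreover have "0 \<le> m t" by (simp add: m_def)
    ultimately show ?thesis by (rule power_mono)
  qed
  have AEF: "AE t in lborel. t \<notin> F"
    using finite_imp_null_set_lborel[OF F] by (rule AE_not_in)
  have AC: "path_AC2 T (cdist R) (\<lambda>t\<in>{0..T}. z t)"
    unfolding path_AC2_def path_abs_continuous_def
  proof (intro conjI exI[of _ "\<lambda>_. L"] bexI[of _ m] allI impI)
    show "set_integrable lborel {0..T} (\<lambda>_. L)"
      unfolding set_integrable_def
      by (intro integrable_scaleR_left integrable_real_indicator) (auto simp: emeasure_lborel_Icc_eq)
    fix s t assume st: "0 \<le> s \<and> s \<le> t \<and> t \<le> T"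
    then have "(LINT \<tau>:{s..t}|lborel. L) = L * \<bar>s - t\<bar>"
      by (simp add: set_lebesgue_integral_def)
    then show "cdist R ((\<lambda>t\<in>{0..T}. z t) s) ((\<lambda>t\<in>{0..T}. z t) t) \<le> (LINT \<tau>:{s..t}|lborel. L)"
      using L[of s t] st by simp
  next
    show "AE t in lborel. t \<in> {0..T} \<longrightarrow>
       ((\<lambda>s. cdist R ((\<lambda>t\<in>{0..T}. z t) s) ((\<lambda>t\<in>{0..T}. z t) t) / \<bar>s - t\<bar>) \<longlongrightarrow> m t) (at t within {0..T})"
      using AEF by eventually_elim (use lim in blast)
    show "set_integrable lborel {0..T} (\<lambda>t. (m t)\<^sup>2)"
      unfolding set_integrable_def
    proof (rule Bochner_Integration.integrable_bound)
      show "integrable lborel (\<lambda>t. indicator {0..T} t *\<^sub>R L\<^sup>2)"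
        by (intro integrable_scaleR_left integrable_real_indicator) (auto simp: emeasure_lborel_Icc_eq)
      show "AE t in lborel. norm (indicator {0..T} t *\<^sub>R (m t)\<^sup>2) \<le> norm (indicator {0..T} t *\<^sub>R L\<^sup>2)"
        using AEF by eventually_elim (use m_le in \<open>auto simp: indicator_def\<close>)
    qed simp
  qed (use m in simp)
  have speed: "cone_speed_sq xbar T R (\<lambda>t\<in>{0..T}. z t) t = (\<rho> t)\<^sup>2 * (torus_norm R (v t))\<^sup>2 + (\<rho>' t)\<^sup>2"
    if t: "t \<in> {0..T} - F" for t
  proof -
    let ?F = "at t within {0..T}"
    define r where "r s = cone_r ((\<lambda>t\<in>{0..T}. z t) s)" for s
    define y where "y s = cone_x xbar ((\<lambda>t\<in>{0..T}. z t) s)" for s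
    have r: "r s = \<rho> s" if "s \<in> {0..T}" for s using that \<rho> by (simp add: r_def z_def)
    have y: "y s = x s" if "s \<in> {0..T}" "0 < \<rho> s" for s using that by (simp add: y_def z_def)
    have "(\<rho> \<longlongrightarrow> \<rho> t) ?F"
      using has_vector_derivative_continuous[OF d\<rho>[OF t]] by (simp add: continuous_within)
    \<comment> \<open>Positivity of the radius at \<open>t\<close> persists nearby, where the base
      point of \<open>z s\<close> is \<open>x s\<close> and the default \<open>xbar\<close> does not
      intervene; hence the velocities agree.\<close>
    then have "\<forall>\<^sub>F s in ?F. 0 < \<rho> s" using pos[OF t] by (rule order_tendstoD)
    moreover have "\<forall>\<^sub>F s in ?F. s \<in> {0..T}" by (simp add: eventually_at_filter)
    ultimately have ev: "\<forall>\<^sub>F s in ?F. y s = x s" by eventually_elim (rule y)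
    have vy: "torus_has_velocity y (v t) t {0..T}"
    proof -
      obtain u where u: "torus_of (u t) = x t" "\<forall>\<^sub>F s in ?F. torus_of (u s) = x s" "(u has_vector_derivative v t) ?F"
        using vel[OF t] by (auto simp: torus_has_velocity_def)
      moreover have "\<forall>\<^sub>F s in ?F. torus_of (u s) = y s" using u(2) ev by eventually_elim simp
      ultimately show ?thesis
        unfolding torus_has_velocity_def using y[of t] t pos[OF t] by (intro exI[of _ u]) auto
    qed
    then have ex: "\<exists>v. torus_has_velocity y v t {0..T}" by blast
    have tv: "torus_velocity y t {0..T} = v t" using T t vy by (intro torus_velocity_eq) auto
    have dr: "(r has_vector_derivative \<rho>' t) ?F"
      using d\<rho>[OF t] r t by (intro has_vector_derivative_transform[of t "{0..T}" r \<rho>]) auto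
    then have "vector_derivative r ?F = \<rho>' t"
      using T t by (intro vector_derivative_within_cbox[of 0 T, simplified]) auto
    moreover have "r differentiable ?F" using dr by (rule differentiableI_vector)
    moreover have "0 < r t" "r t = \<rho> t" using r[of t] t pos[OF t] by auto
    ultimately show ?thesis
      unfolding cone_speed_sq_def Let_def r_def[symmetric] y_def[symmetric]
      using vy tv ex by simp
  qed
  have "path_action xbar T R (\<lambda>t\<in>{0..T}. z t) =
     (\<integral>\<^sup>+t\<in>{0..T}. ennreal (cone_speed_sq xbar T R (\<lambda>t\<in>{0..T}. z t) t) \<partial>lborel)"
    using AC by (simp add: path_action_def)
  also have "\<dots> = (\<integral>\<^sup>+t\<in>{0..T}. ennreal ((\<rho> t)\<^sup>2 * (torus_norm R (v t))\<^sup>2 + (\<rho>' t)\<^sup>2) \<partial>lborel)"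
  proof (rule nn_integral_cong_AE)
    show "AE t in lborel. ennreal (cone_speed_sq xbar T R (\<lambda>t\<in>{0..T}. z t) t) * indicator {0..T} t =
       ennreal ((\<rho> t)\<^sup>2 * (torus_norm R (v t))\<^sup>2 + (\<rho>' t)\<^sup>2) * indicator {0..T} t"
      using AEF by eventually_elim (use speed in \<open>auto simp: indicator_def\<close>)
  qed
  finally show ?thesis .
qed

section \<open>The striped flow\<close>

text \<open>Across a cell boundary the increment splits into a piece that ends at 1 and a piece that
  starts at 0, joined by \<open>h 0 = h 1\<close>; whole periods in between only lengthen
  \<open>y - x\<close>. The one-sided form is kept because for \<open>tent\<close> the upper rate is
  much better than the Lipschitz constant.\<close>

lemma periodic_extension_increase:
  fixes h :: "real \<Rightarrow> real"
  assumes h: "\<And>x y. 0 \<le> x \<Longrightarrow> x \<le> y \<Longrightarrow> y \<le> 1 \<Longrightarrow> h y - h x \<le> L * (y - x)" and "h 0 = h 1" and L: "0 \<le> L"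
    and xy: "x \<le> y"
  shows "h (frac y) - h (frac x) \<le> L * (y - x)"
proof (cases "\<lfloor>x\<rfloor> = \<lfloor>y\<rfloor>")
  case True
  then have "frac y - frac x = y - x" by (simp add: frac_def)
  then show ?thesis using h[of "frac x" "frac y"] xy frac_lt_1[of y] by (simp add: less_imp_le)
next
  case False
  then have "\<lfloor>x\<rfloor> + 1 \<le> \<lfloor>y\<rfloor>" using floor_mono[OF xy] by linarith
  then have "real_of_int \<lfloor>x\<rfloor> + 1 \<le> real_of_int \<lfloor>y\<rfloor>" by linarith
  then have le: "(1 - frac x) + frac y \<le> y - x" by (simp add: frac_def)
  have "h (frac y) - h (frac x) = (h (frac y) - h 0) + (h 1 - h (frac x))" using assms(2) by simp
  also have "\<dots> \<le> L * (frac y - 0) + L * (1 - frac x)"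
    using frac_lt_1[of x] frac_lt_1[of y] by (intro add_mono h) (auto simp: less_imp_le)
  also have "\<dots> = L * ((1 - frac x) + frac y)" by (simp add: algebra_simps)
  also have "\<dots> \<le> L * (y - x)" using le L by (rule mult_left_mono)
  finally show ?thesis .
qed

lemma periodic_extension_lipschitz:
  fixes h :: "real \<Rightarrow> real"
  assumes h: "\<And>x y. 0 \<le> x \<Longrightarrow> x \<le> y \<Longrightarrow> y \<le> 1 \<Longrightarrow> \<bar>h y - h x\<bar> \<le> L * (y - x)" and "h 0 = h 1" and L: "0 \<le> L"
  shows "\<bar>h (frac y) - h (frac x)\<bar> \<le> L * \<bar>y - x\<bar>"
proof -
  have 1: "\<bar>h (frac y) - h (frac x)\<bar> \<le> L * (y - x)" if "x \<le> y" for x y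
  proof -
    have "h (frac y) - h (frac x) \<le> L * (y - x)"
      by (rule periodic_extension_increase[OF _ assms(2) L that]) (use h in \<open>fastforce simp: abs_le_iff\<close>)
    moreover have "- h (frac y) - - h (frac x) \<le> L * (y - x)"
      by (rule periodic_extension_increase[of "\<lambda>x. - h x", OF _ _ L that])
        (use h assms(2) in \<open>fastforce simp: abs_le_iff\<close>)+
    ultimately show ?thesis by (simp add: abs_le_iff)
  qed
  show ?thesis
    using 1[of x y] 1[of y x] by (cases "x \<le> y") (auto simp: abs_minus_commute)
qed

lemma abs_sin_diff_le: "\<bar>sin x - sin y\<bar> \<le> \<bar>x - y\<bar>" for x y :: real
proof -
  have "\<bar>sin x - sin y\<bar> = 2 * \<bar>sin ((x - y) / 2)\<bar> * \<bar>cos ((x + y) / 2)\<bar>"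
    by (simp add: sin_diff_sin abs_mult)
  also have "\<dots> \<le> 2 * \<bar>(x - y) / 2\<bar> * 1"
    by (intro mult_mono mult_left_mono abs_sin_x_le_abs_x) auto
  finally show ?thesis by simp
qed

lemma abs_min_diff_le: "\<bar>a - c\<bar> \<le> e \<Longrightarrow> \<bar>b - d\<bar> \<le> e \<Longrightarrow> \<bar>min a b - min c d\<bar> \<le> e" for a :: real
  by (auto simp: min_def)

definition clamp01 :: "real \<Rightarrow> real" where
  "clamp01 x = max 0 (min 1 x)"

lemma clamp01_bounds [simp]: "0 \<le> clamp01 x" "clamp01 x \<le> 1"
  and clamp01_lipschitz: "\<bar>clamp01 x - clamp01 y\<bar> \<le> \<bar>x - y\<bar>"
  by (auto simp: clamp01_def)

lemma clamp01_eq: "x \<le> 0 \<Longrightarrow> clamp01 x = 0" "1 \<le> x \<Longrightarrow> clamp01 x = 1" "0 \<le> x \<Longrightarrow> x \<le> 1 \<Longrightarrow> clamp01 x = x"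
  by (auto simp: clamp01_def)

lemma lipschitz_imp_continuous:
  fixes f :: "real \<Rightarrow> real"
  assumes "\<And>x y. \<bar>f x - f y\<bar> \<le> L * \<bar>x - y\<bar>"
  shows "continuous_on UNIV f"
proof -
  have "(max L 0)-lipschitz_on UNIV f"
    by (rule lipschitz_onI) (auto simp: dist_real_def intro!: order_trans[OF assms mult_right_mono])
  then show ?thesis by (rule lipschitz_on_continuous_on)
qed

text \<open>The representative is chosen arbitrarily; for equivariant \<open>G\<close> the value
  does not depend on it.\<close>

definition descend :: "(real \<times> real \<Rightarrow> real \<times> real) \<Rightarrow> torus \<Rightarrow> torus" where
  "descend G x = skew (G (SOME u. skew u = x))"

definition equivariant :: "(real \<times> real \<Rightarrow> real \<times> real) \<Rightarrow> bool" where
  "equivariant G \<longleftrightarrow> (\<forall>u v. torus_rel u v \<longrightarrow> torus_rel (G u) (G v))"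

lemma descend_skew:
  assumes "equivariant G"
  shows "descend G (skew u) = skew (G u)"
proof -
  have "skew (SOME v. skew v = skew u) = skew u" by (rule someI) (rule refl)
  then have "torus_rel (G (SOME v. skew v = skew u)) (G u)"
    using assms skew_eq_iff unfolding equivariant_def by blast
  then show ?thesis
    unfolding descend_def by (rule skew_eq_iff[THEN iffD2])
qed

locale stripes =
  fixes N :: nat and T \<epsilon> \<delta> \<kappa> :: real
  assumes N: "0 < N" and T: "0 < T" and eps: "0 < \<epsilon>" "\<epsilon> < 1 / 2"
    and del: "0 < \<delta>" "\<delta> \<le> T / 2" and kap: "0 < \<kappa>" "\<kappa> < 1 / 2"
begin

text \<open>The torus is cut into \<open>N\<close> cells \<open>k \<ell> \<le> a < (k + 1) \<ell>\<close>. The first part of each cell, of relative width \<open>1 - \<epsilon>\<close>,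
  holds the particles that will follow \<open>(psi1, zeta1)\<close>, the rest those that will follow \<open>(Id, zeta0)\<close>;
  \<open>gain\<close> is the fraction of volume that has passed from the former to the latter. The two kinds of particles
  are sheared by \<open>\<pi>\<close> in \<open>b\<close> during a time \<open>\<delta>\<close> just before \<open>T / 2\<close> and \<open>T\<close>, respectively; \<open>plateau\<close> interpolates
  between the two shears on a fraction \<open>2 \<kappa>\<close> of the thin part.\<close>

definition ell :: real where "ell = 2 * pi / N"

text \<open>Displacement profile of one cell, with peak 1 at the border of the two parts. Both
  branches have the value 1 there, so \<open>min\<close> selects the right one. The two slopes
  \<open>1 / (1 - \<epsilon>)\<close> and \<open>- 1 / \<epsilon>\<close> produce the two
  Jacobians.\<close>

definition tent :: "real \<Rightarrow> real" where
  "tent y = min (frac y / (1 - \<epsilon>)) ((1 - frac y) / \<epsilon>)"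

definition plateau :: "real \<Rightarrow> real" where
  "plateau y = clamp01 (min ((frac y - (1 - \<epsilon>)) / (\<epsilon> * \<kappa>)) ((1 - frac y) / (\<epsilon> * \<kappa>)))"

definition turn :: "real \<Rightarrow> real \<Rightarrow> real" where
  "turn c t = pi * clamp01 ((t - c + \<delta>) / \<delta>)"

definition gain :: "real \<Rightarrow> real" where
  "gain t = (1 - 2 * \<epsilon>) * (sin (pi * t / T))\<^sup>2"

text \<open>As \<open>tent\<close> vanishes at the cell ends, each cell is mapped onto itself and
  only the border between its two parts slides to the left.\<close>

definition squeeze :: "real \<Rightarrow> real \<Rightarrow> real" where
  "squeeze t a = a - ell * gain t * tent (a / ell)"

definition shear :: "real \<Rightarrow> real \<Rightarrow> real" where
  "shear t a = turn (T / 2) t + plateau (a / ell) * (turn T t - turn (T / 2) t)"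

text \<open>\<open>shear\<close> is evaluated at the initial first coordinate: the shift belongs to
  the particle. The differential is therefore triangular and the shear does not affect the
  Jacobian.\<close>

definition pos :: "real \<Rightarrow> real \<times> real \<Rightarrow> real \<times> real" where
  "pos t u = (squeeze t (fst u), snd u + shear t (fst u))"

definition flow :: "real \<Rightarrow> torus \<Rightarrow> torus" where
  "flow t = descend (pos t)"

section \<open>Bounds and Lipschitz estimates for the profiles\<close>

lemma ell_pos: "0 < ell"
  using N by (simp add: ell_def)

lemma tent_bounds: "0 \<le> tent y" "tent y \<le> 1"
proof -
  show "0 \<le> tent y" using eps frac_lt_1[of y] by (auto simp: tent_def less_imp_le)
  show "tent y \<le> 1"
  proof (cases "frac y \<le> 1 - \<epsilon>")
    case True
    then have "frac y / (1 - \<epsilon>) \<le> 1" using eps by simp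
    then show ?thesis by (simp add: tent_def)
  next
    case False
    then have "(1 - frac y) / \<epsilon> \<le> 1" using eps by simp
    then show ?thesis by (simp add: tent_def)
  qed
qed

text \<open>On the falling branch the increments are negative, so the steep slope
  \<open>1 / \<epsilon>\<close> does not enter the upper bound. Since \<open>squeeze\<close>
  subtracts a multiple of \<open>tent\<close>, the moderate rate \<open>1 / (1 - \<epsilon>)\<close>
  is what keeps it strictly increasing.\<close>

lemma tent_increase: "x \<le> y \<Longrightarrow> tent y - tent x \<le> (y - x) / (1 - \<epsilon>)"
proof -
  assume xy: "x \<le> y"
  define h where "h z = min (z / (1 - \<epsilon>)) ((1 - z) / \<epsilon>)" for z
  have "h y - h x \<le> 1 / (1 - \<epsilon>) * (y - x)" if "x \<le> y" for x y
  proof -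
    have "y / (1 - \<epsilon>) = x / (1 - \<epsilon>) + 1 / (1 - \<epsilon>) * (y - x)" by (simp add: diff_divide_distrib)
    moreover have "0 \<le> 1 / (1 - \<epsilon>) * (y - x)" using that eps by simp
    moreover have "(1 - y) / \<epsilon> \<le> (1 - x) / \<epsilon>" using that eps by (intro divide_right_mono) auto
    ultimately show ?thesis unfolding h_def by linarith
  qed
  then have "h (frac y) - h (frac x) \<le> 1 / (1 - \<epsilon>) * (y - x)"
    using xy eps by (intro periodic_extension_increase) (auto simp: h_def)
  then show ?thesis by (simp add: h_def tent_def)
qed

lemma tent_lipschitz: "\<bar>tent y - tent x\<bar> \<le> 1 / \<epsilon> * \<bar>y - x\<bar>"
proof -
  define h where "h z = min (z / (1 - \<epsilon>)) ((1 - z) / \<epsilon>)" for z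
  have "\<bar>h y - h x\<bar> \<le> 1 / \<epsilon> * (y - x)" if "x \<le> y" for x y
    unfolding h_def
  proof (rule abs_min_diff_le)
    have "\<bar>y / (1 - \<epsilon>) - x / (1 - \<epsilon>)\<bar> = (y - x) / (1 - \<epsilon>)"
      using eps that by (simp add: diff_divide_distrib[symmetric])
    also have "\<dots> \<le> (y - x) / \<epsilon>" using eps that by (intro divide_left_mono) auto
    finally show "\<bar>y / (1 - \<epsilon>) - x / (1 - \<epsilon>)\<bar> \<le> 1 / \<epsilon> * (y - x)" by simp
    show "\<bar>(1 - y) / \<epsilon> - (1 - x) / \<epsilon>\<bar> \<le> 1 / \<epsilon> * (y - x)"
      using eps that by (simp add: diff_divide_distrib[symmetric])
  qed
  then have "\<bar>h (frac y) - h (frac x)\<bar> \<le> 1 / \<epsilon> * \<bar>y - x\<bar>"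
    using eps by (intro periodic_extension_lipschitz) (auto simp: h_def)
  then show ?thesis by (simp add: h_def tent_def)
qed

lemma plateau_bounds: "0 \<le> plateau y" "plateau y \<le> 1"
  by (simp_all add: plateau_def)

lemma plateau_lipschitz: "\<bar>plateau y - plateau x\<bar> \<le> 1 / (\<epsilon> * \<kappa>) * \<bar>y - x\<bar>"
proof -
  define h where "h z = clamp01 (min ((z - (1 - \<epsilon>)) / (\<epsilon> * \<kappa>)) ((1 - z) / (\<epsilon> * \<kappa>)))" for z
  have ek: "0 < \<epsilon> * \<kappa>" using eps kap by simp
  have "\<bar>h y - h x\<bar> \<le> 1 / (\<epsilon> * \<kappa>) * (y - x)" if "x \<le> y" for x y
    unfolding h_def
  proof (rule order_trans[OF clamp01_lipschitz abs_min_diff_le])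
    show "\<bar>(y - (1 - \<epsilon>)) / (\<epsilon> * \<kappa>) - (x - (1 - \<epsilon>)) / (\<epsilon> * \<kappa>)\<bar> \<le> 1 / (\<epsilon> * \<kappa>) * (y - x)"
      using eps kap ek that by (simp add: diff_divide_distrib[symmetric] abs_mult)
    show "\<bar>(1 - y) / (\<epsilon> * \<kappa>) - (1 - x) / (\<epsilon> * \<kappa>)\<bar> \<le> 1 / (\<epsilon> * \<kappa>) * (y - x)"
      using eps kap ek that by (simp add: diff_divide_distrib[symmetric] abs_mult)
  qed
  moreover have "h 0 = h 1"
  proof -
    have "(0 - (1 - \<epsilon>)) / (\<epsilon> * \<kappa>) \<le> 0" using eps ek by (intro divide_nonpos_pos) auto
    then have "h 0 = 0" unfolding h_def by (intro clamp01_eq(1)) linarith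
    moreover have "h 1 = 0" unfolding h_def by (intro clamp01_eq(1)) simp
    ultimately show ?thesis by simp
  qed
  ultimately have "\<bar>h (frac y) - h (frac x)\<bar> \<le> 1 / (\<epsilon> * \<kappa>) * \<bar>y - x\<bar>"
    using ek by (intro periodic_extension_lipschitz) auto
  then show ?thesis by (simp add: h_def plateau_def)
qed

lemma turn_bounds: "0 \<le> turn c t" "turn c t \<le> pi"
  by (simp_all add: turn_def mult_left_le)

lemma turn_lipschitz: "\<bar>turn c t - turn c s\<bar> \<le> pi / \<delta> * \<bar>t - s\<bar>"
proof -
  have "\<bar>turn c t - turn c s\<bar> = pi * \<bar>clamp01 ((t - c + \<delta>) / \<delta>) - clamp01 ((s - c + \<delta>) / \<delta>)\<bar>"
    by (simp add: turn_def right_diff_distrib[symmetric] abs_mult)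
  also have "\<dots> \<le> pi * \<bar>(t - c + \<delta>) / \<delta> - (s - c + \<delta>) / \<delta>\<bar>"
    by (intro mult_left_mono clamp01_lipschitz) auto
  also have "\<dots> = pi / \<delta> * \<bar>t - s\<bar>" using del by (simp add: diff_divide_distrib[symmetric])
  finally show ?thesis .
qed

lemma turn_before: "t \<le> c - \<delta> \<Longrightarrow> turn c t = 0"
  and turn_after: "c \<le> t \<Longrightarrow> turn c t = pi"
  using del by (auto simp: turn_def intro!: clamp01_eq divide_nonpos_pos)

lemma gain_bounds: "0 \<le> gain t" "gain t \<le> 1 - 2 * \<epsilon>"
  using eps by (auto simp: gain_def abs_square_le_1 intro!: mult_left_le)

lemma gain_lipschitz: "\<bar>gain t - gain s\<bar> \<le> 2 * pi / T * \<bar>t - s\<bar>"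
proof -
  let ?x = "pi * t / T" and ?y = "pi * s / T"
  have "\<bar>sin ?x - sin ?y\<bar> \<le> \<bar>?x - ?y\<bar>"
    by (rule abs_sin_diff_le)
  moreover have "\<bar>sin ?x + sin ?y\<bar> \<le> 2"
    using abs_sin_le_one[of ?x] abs_sin_le_one[of ?y] by linarith
  ultimately have "\<bar>sin ?x - sin ?y\<bar> * \<bar>sin ?x + sin ?y\<bar> \<le> \<bar>?x - ?y\<bar> * 2"
    by (intro mult_mono) auto
  moreover have "\<bar>(sin ?x)\<^sup>2 - (sin ?y)\<^sup>2\<bar> = \<bar>sin ?x - sin ?y\<bar> * \<bar>sin ?x + sin ?y\<bar>"
    unfolding abs_mult[symmetric] by (simp add: power2_eq_square algebra_simps)
  moreover have "\<bar>?x - ?y\<bar> * 2 = 2 * pi / T * \<bar>t - s\<bar>"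
    using T by (simp add: diff_divide_distrib[symmetric] right_diff_distrib[symmetric] abs_mult)
  ultimately have "\<bar>(sin ?x)\<^sup>2 - (sin ?y)\<^sup>2\<bar> \<le> 2 * pi / T * \<bar>t - s\<bar>" by simp
  moreover have "\<bar>gain t - gain s\<bar> = (1 - 2 * \<epsilon>) * \<bar>(sin ?x)\<^sup>2 - (sin ?y)\<^sup>2\<bar>"
    using eps by (simp add: gain_def right_diff_distrib[symmetric] abs_mult)
  moreover have "\<dots> \<le> 1 * \<bar>(sin ?x)\<^sup>2 - (sin ?y)\<^sup>2\<bar>"
    using eps by (intro mult_right_mono) auto
  ultimately show ?thesis by simp
qed

lemma gain_0 [simp]: "gain 0 = 0" and gain_T [simp]: "gain T = 0"
  using T by (simp_all add: gain_def)

lemma squeeze_increase: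
  assumes "a \<le> a'"
  shows "(1 - gain t / (1 - \<epsilon>)) * (a' - a) \<le> squeeze t a' - squeeze t a"
proof -
  have "tent (a' / ell) - tent (a / ell) \<le> (a' / ell - a / ell) / (1 - \<epsilon>)"
    using assms ell_pos by (intro tent_increase divide_right_mono) auto
  then have "ell * gain t * (tent (a' / ell) - tent (a / ell)) \<le> ell * gain t * ((a' / ell - a / ell) / (1 - \<epsilon>))"
    using ell_pos gain_bounds[of t] by (intro mult_left_mono) auto
  also have "\<dots> = gain t / (1 - \<epsilon>) * (a' - a)" using ell_pos by (simp add: diff_divide_distrib[symmetric])
  finally show ?thesis by (simp add: squeeze_def algebra_simps)
qed

lemma squeeze_lipschitz: "\<bar>squeeze t a' - squeeze t a\<bar> \<le> (1 + 1 / \<epsilon>) * \<bar>a' - a\<bar>"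
proof -
  have "\<bar>ell * gain t * (tent (a' / ell) - tent (a / ell))\<bar> = ell * gain t * \<bar>tent (a' / ell) - tent (a / ell)\<bar>"
    using ell_pos gain_bounds[of t] by (simp add: abs_mult)
  also have "\<dots> \<le> ell * 1 * (1 / \<epsilon> * \<bar>a' / ell - a / ell\<bar>)"
    using ell_pos gain_bounds[of t] eps by (intro mult_mono tent_lipschitz) auto
  also have "\<dots> = 1 / \<epsilon> * \<bar>a' - a\<bar>" using ell_pos by (simp add: diff_divide_distrib[symmetric])
  finally have "\<bar>ell * gain t * (tent (a' / ell) - tent (a / ell))\<bar> \<le> 1 / \<epsilon> * \<bar>a' - a\<bar>" .
  moreover have "squeeze t a' - squeeze t a = (a' - a) - ell * gain t * (tent (a' / ell) - tent (a / ell))"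
    by (simp add: squeeze_def algebra_simps)
  ultimately show ?thesis by (simp add: distrib_right)
qed

lemma squeeze_near: "\<bar>squeeze t a - a\<bar> \<le> ell"
proof -
  have "\<bar>squeeze t a - a\<bar> = ell * gain t * tent (a / ell)"
    using ell_pos gain_bounds[of t] tent_bounds[of "a / ell"] by (simp add: squeeze_def)
  also have "\<dots> \<le> ell * 1 * 1"
    using ell_pos gain_bounds[of t] tent_bounds[of "a / ell"] eps by (intro mult_mono) auto
  finally show ?thesis by simp
qed

lemma squeeze_time_lipschitz: "\<bar>squeeze t a - squeeze s a\<bar> \<le> 2 * pi / T * ell * \<bar>t - s\<bar>"
proof -
  have "\<bar>squeeze t a - squeeze s a\<bar> = ell * tent (a / ell) * \<bar>gain t - gain s\<bar>"
  proof -
    have "squeeze t a - squeeze s a = - (ell * tent (a / ell) * (gain t - gain s))"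
      by (simp add: squeeze_def algebra_simps)
    then have "\<bar>squeeze t a - squeeze s a\<bar> = \<bar>ell * tent (a / ell) * (gain t - gain s)\<bar>" by simp
    then show ?thesis using ell_pos tent_bounds[of "a / ell"] by (simp add: abs_mult)
  qed
  also have "\<dots> \<le> ell * 1 * (2 * pi / T * \<bar>t - s\<bar>)"
    using ell_pos tent_bounds[of "a / ell"] by (intro mult_mono gain_lipschitz) auto
  finally show ?thesis by (simp add: algebra_simps)
qed

lemma shear_time_lipschitz: "\<bar>shear t a - shear s a\<bar> \<le> pi / \<delta> * \<bar>t - s\<bar>"
proof -
  let ?p = "plateau (a / ell)"
  \<comment> \<open>\<open>shear\<close> is a convex combination of the two turns, which have the
    same Lipschitz constant.\<close>
  have "shear t a - shear s a = (1 - ?p) * (turn (T / 2) t - turn (T / 2) s) + ?p * (turn T t - turn T s)"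
    by (simp add: shear_def algebra_simps)
  also have "\<bar>\<dots>\<bar> \<le> (1 - ?p) * \<bar>turn (T / 2) t - turn (T / 2) s\<bar> + ?p * \<bar>turn T t - turn T s\<bar>"
    using plateau_bounds[of "a / ell"] by (intro order_trans[OF abs_triangle_ineq]) (simp add: abs_mult)
  also have "\<dots> \<le> (1 - ?p) * (pi / \<delta> * \<bar>t - s\<bar>) + ?p * (pi / \<delta> * \<bar>t - s\<bar>)"
    using plateau_bounds[of "a / ell"] by (intro add_mono mult_left_mono turn_lipschitz) auto
  finally show ?thesis by (simp add: algebra_simps)
qed

text \<open>The constant blows up as the stripes get thinner. This is harmless, for it only enters
  continuity statements about one fixed flow, never the estimates of distance or action.\<close>

lemma shear_lipschitz: "\<bar>shear t a' - shear t a\<bar> \<le> pi / (\<epsilon> * \<kappa> * ell) * \<bar>a' - a\<bar>"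
proof -
  have "\<bar>shear t a' - shear t a\<bar> = \<bar>plateau (a' / ell) - plateau (a / ell)\<bar> * \<bar>turn T t - turn (T / 2) t\<bar>"
    by (simp add: shear_def abs_mult[symmetric] algebra_simps)
  also have "\<dots> \<le> (1 / (\<epsilon> * \<kappa>) * \<bar>a' / ell - a / ell\<bar>) * pi"
    using turn_bounds[of T t] turn_bounds[of "T / 2" t] eps kap by (intro mult_mono plateau_lipschitz) auto
  also have "\<dots> = pi / (\<epsilon> * \<kappa> * ell) * \<bar>a' - a\<bar>"
    using ell_pos by (simp add: diff_divide_distrib[symmetric])
  finally show ?thesis .
qed

text \<open>A full turn consists of \<open>N\<close> cells, so translation by
  \<open>2 * pi * k\<close> shifts the quotient by the integer \<open>k * N\<close>.\<close>

lemma cell_periodic: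
  "tent ((a + 2 * pi * of_int k) / ell) = tent (a / ell)"
  "plateau ((a + 2 * pi * of_int k) / ell) = plateau (a / ell)"
  and frac_cell_periodic: "frac ((a + 2 * pi * of_int k) / ell) = frac (a / ell)"
proof -
  have "(a + 2 * pi * of_int k) / ell = a / ell + of_int (k * int N)"
    using N by (simp add: ell_def field_simps)
  then show "frac ((a + 2 * pi * of_int k) / ell) = frac (a / ell)"
    by (simp only: frac_add_of_int_right)
  then show "tent ((a + 2 * pi * of_int k) / ell) = tent (a / ell)"
    "plateau ((a + 2 * pi * of_int k) / ell) = plateau (a / ell)"
    by (simp_all add: tent_def plateau_def)
qed

lemma pos_translate: "pos t (a + 2 * pi * of_int k, b + 2 * pi * of_int l) = pos t (a, b) + (2 * pi * of_int k, 2 * pi * of_int l)"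
  by (simp add: pos_def squeeze_def shear_def cell_periodic)

lemma equivariant_pos: "equivariant (pos t)"
  unfolding equivariant_def
proof (intro allI impI)
  fix u v assume "torus_rel u v"
  then obtain k l where "v = (fst u + 2 * pi * of_int k, snd u + 2 * pi * of_int l)"
    by (auto simp: torus_rel_def prod_eq_iff)
  then show "torus_rel (pos t u) (pos t v)"
    using pos_translate[of t "fst u" k "snd u" l] by (auto simp: torus_rel_def)
qed

lemma flow_skew: "flow t (skew u) = skew (pos t u)"
  unfolding flow_def by (rule descend_skew[OF equivariant_pos])

lemma continuous_tent [continuous_intros]: "continuous_on S f \<Longrightarrow> continuous_on S (\<lambda>x. tent (f x))"
  using lipschitz_imp_continuous[of tent "1 / \<epsilon>"] tent_lipschitz
  by (auto intro!: continuous_on_compose2[of UNIV tent])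

lemma continuous_plateau [continuous_intros]: "continuous_on S f \<Longrightarrow> continuous_on S (\<lambda>x. plateau (f x))"
  using lipschitz_imp_continuous[of plateau "1 / (\<epsilon> * \<kappa>)"] plateau_lipschitz
  by (auto intro!: continuous_on_compose2[of UNIV plateau])

lemma continuous_turn [continuous_intros]: "continuous_on S f \<Longrightarrow> continuous_on S (\<lambda>x. turn c (f x))"
  using lipschitz_imp_continuous[of "turn c" "pi / \<delta>"] turn_lipschitz
  by (auto intro!: continuous_on_compose2[of UNIV "turn c"])

lemma continuous_pos: "continuous_on S (\<lambda>(t, u). pos t u)"
  unfolding pos_def squeeze_def shear_def gain_def split_beta
  using T ell_pos by (intro continuous_intros) auto

section \<open>Invertibility and continuity of the flow\<close>

lemma jac1_pos: "0 < 1 - gain t / (1 - \<epsilon>)"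
proof -
  have "gain t < 1 - \<epsilon>" using gain_bounds[of t] eps by linarith
  then show ?thesis using eps by simp
qed

text \<open>Injective by strict monotonicity. Surjective by the intermediate value theorem: no point
  moves by more than \<open>ell\<close>, so the values at \<open>y - ell\<close> and
  \<open>y + ell\<close> enclose \<open>y\<close>.\<close>

lemma bij_squeeze: "bij (squeeze t)"
proof (rule bijI)
  let ?J = "1 - gain t / (1 - \<epsilon>)"
  show "inj (squeeze t)"
  proof (rule linorder_injI)
    fix a a' :: real assume "a < a'"
    then have "0 < ?J * (a' - a)" using jac1_pos by (intro mult_pos_pos) auto
    then show "squeeze t a \<noteq> squeeze t a'" using squeeze_increase[of a a' t] \<open>a < a'\<close> by simp
  qed
  have cont: "continuous_on UNIV (squeeze t)"
    using squeeze_lipschitz by (rule lipschitz_imp_continuous)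
  show "surj (squeeze t)"
    unfolding surj_def
  proof
    fix y
    have "squeeze t (y - ell) \<le> y" "y \<le> squeeze t (y + ell)"
      using squeeze_near[of t "y - ell"] squeeze_near[of t "y + ell"] by linarith+
    then show "\<exists>a. y = squeeze t a"
      using IVT'[of "squeeze t" "y - ell" y "y + ell"] ell_pos continuous_on_subset[OF cont] by auto
  qed
qed

definition unpos :: "real \<Rightarrow> real \<times> real \<Rightarrow> real \<times> real" where
  "unpos t u = (inv (squeeze t) (fst u), snd u - shear t (inv (squeeze t) (fst u)))"

lemma pos_unpos: "pos t (unpos t u) = u"
  using surj_f_inv_f[OF bij_is_surj[OF bij_squeeze[of t]]] by (simp add: pos_def unpos_def)

lemma unpos_pos: "unpos t (pos t u) = u"
  using inv_f_f[OF bij_is_inj[OF bij_squeeze[of t]]] by (simp add: pos_def unpos_def)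

lemma equivariant_unpos: "equivariant (unpos t)"
  unfolding equivariant_def
proof (intro allI impI)
  fix u v assume "torus_rel u v"
  then obtain k l where v: "v = (fst u + 2 * pi * of_int k, snd u + 2 * pi * of_int l)"
    by (auto simp: torus_rel_def prod_eq_iff)
  let ?w = "unpos t u"
  have "pos t (fst ?w + 2 * pi * of_int k, snd ?w + 2 * pi * of_int l) = v"
    using pos_translate[of t "fst ?w" k "snd ?w" l] pos_unpos[of t u] v by (simp add: prod_eq_iff)
  then have "unpos t v = (fst ?w + 2 * pi * of_int k, snd ?w + 2 * pi * of_int l)"
    using unpos_pos by metis
  then show "torus_rel (unpos t u) (unpos t v)" by (auto simp: torus_rel_def)
qed

text \<open>\<open>squeeze t\<close> expands by at least \<open>?J > 0\<close>, hence its inverse is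
  Lipschitz with constant \<open>1 / ?J\<close>.\<close>

lemma continuous_unpos: "continuous_on UNIV (unpos t)"
proof -
  let ?J = "1 - gain t / (1 - \<epsilon>)" and ?f = "inv (squeeze t)"
  have f: "squeeze t (?f y) = y" for y
    using surj_f_inv_f[OF bij_is_surj[OF bij_squeeze[of t]]] by simp
  have le: "?f y - ?f x \<le> 1 / ?J * \<bar>y - x\<bar>" for x y
  proof (cases "?f x \<le> ?f y")
    case True
    then have "?J * (?f y - ?f x) \<le> y - x" using squeeze_increase[OF True, of t] by (simp add: f)
    then have "?f y - ?f x \<le> (y - x) / ?J" using jac1_pos[of t] by (simp add: pos_le_divide_eq mult.commute)
    also have "\<dots> \<le> \<bar>y - x\<bar> / ?J" using jac1_pos[of t] by (intro divide_right_mono) auto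
    finally show ?thesis by simp
  next
    case False
    moreover have "0 \<le> 1 / ?J * \<bar>y - x\<bar>" using jac1_pos[of t] by simp
    ultimately show ?thesis by linarith
  qed
  have "\<bar>?f y - ?f x\<bar> \<le> 1 / ?J * \<bar>y - x\<bar>" for x y
    using le[of y x] le[of x y] by (simp add: abs_le_iff abs_minus_commute)
  then have "continuous_on UNIV ?f" by (rule lipschitz_imp_continuous)
  then have 1: "continuous_on S (\<lambda>x. ?f (g x))" if "continuous_on S g" for S and g :: "real \<times> real \<Rightarrow> real"
    using that by (auto intro: continuous_on_compose2)
  have "continuous_on UNIV (shear t)"
    using shear_lipschitz by (rule lipschitz_imp_continuous)
  then have 2: "continuous_on S (\<lambda>x. shear t (g x))" if "continuous_on S g" for S and g :: "real \<times> real \<Rightarrow> real"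
    using that by (auto intro: continuous_on_compose2)
  show ?thesis
    unfolding unpos_def by (intro continuous_intros 1 2)
qed

lemma continuous_flow_flow: "continuous_flow T flow"
  unfolding continuous_flow_def
proof (intro conjI ballI)
  show "continuous_on ({0..T} \<times> UNIV) (\<lambda>(t, x). flow t x)"
    by (rule continuous_on_torus_prod[OF continuous_pos]) (rule flow_skew)
  fix t assume "t \<in> {0..T}"
  have inv1: "descend (unpos t) (flow t x) = x" for x
    by (metis descend_skew[OF equivariant_unpos] flow_skew skew_surj unpos_pos)
  have inv2: "flow t (descend (unpos t) x) = x" for x
    by (metis descend_skew[OF equivariant_unpos] flow_skew skew_surj pos_unpos)
  have "continuous_on UNIV (pos t)"
    using continuous_on_compose2[OF continuous_pos[of UNIV], of UNIV "\<lambda>u. (t, u)"] by (simp add: continuous_intros)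
  then have "continuous_on UNIV (flow t)"
    using flow_skew by (rule continuous_on_torus)
  moreover have "continuous_on UNIV (descend (unpos t))"
    using continuous_unpos descend_skew[OF equivariant_unpos] by (rule continuous_on_torus)
  ultimately have "homeomorphism UNIV UNIV (flow t) (descend (unpos t))"
    using inv1 inv2 by (intro homeomorphismI) auto
  then show "\<exists>\<psi>. homeomorphism UNIV UNIV (flow t) \<psi>" by blast
qed

lemma flow_0: "flow 0 = id"
proof
  fix x
  obtain u where u: "skew u = x" by (rule skew_surj)
  have "shear 0 a = 0" for a using turn_before[of 0 T] turn_before[of 0 "T / 2"] del T by (simp add: shear_def)
  then have "pos 0 u = u" by (simp add: pos_def squeeze_def)
  then show "flow 0 x = id x" using flow_skew[of 0 u] u by simp
qed

lemma flow_T: "flow T = half_turn"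
proof
  fix x
  obtain u where u: "skew u = x" by (rule skew_surj)
  have "shear T a = pi" for a using turn_after[of T T] turn_after[of "T / 2" T] T by (simp add: shear_def)
  then have "pos T u = (fst u, snd u + pi)" by (simp add: pos_def squeeze_def)
  then show "flow T x = half_turn x" using flow_skew[of T u] u half_turn_skew[of u] by simp
qed

text \<open>At fixed time the flow is piecewise affine, with kinks along finitely many closed curves.\<close>

definition kinks :: "real set" where
  "kinks = {a. frac (a / ell) \<in> {0, 1 - \<epsilon>, 1 - \<epsilon> + \<epsilon> * \<kappa>, 1 - \<epsilon> * \<kappa>}}"

definition slope :: "real \<Rightarrow> real" where
  "slope a = (if frac (a / ell) < 1 - \<epsilon> then 1 / (1 - \<epsilon>) else - 1 / \<epsilon>)"

lemma tent_eq:
  "frac y \<le> 1 - \<epsilon> \<Longrightarrow> tent y = frac y / (1 - \<epsilon>)"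
  "1 - \<epsilon> \<le> frac y \<Longrightarrow> tent y = (1 - frac y) / \<epsilon>"
proof -
  assume z: "frac y \<le> 1 - \<epsilon>"
  have "frac y / (1 - \<epsilon>) \<le> 1" "1 \<le> (1 - frac y) / \<epsilon>" using z eps by simp_all
  then show "tent y = frac y / (1 - \<epsilon>)" unfolding tent_def by linarith
next
  assume z: "1 - \<epsilon> \<le> frac y"
  have "1 \<le> frac y / (1 - \<epsilon>)" "(1 - frac y) / \<epsilon> \<le> 1" using z eps by simp_all
  then show "tent y = (1 - frac y) / \<epsilon>" unfolding tent_def by linarith
qed

lemma eps_kap: "0 < \<epsilon> * \<kappa>" "2 * (\<epsilon> * \<kappa>) < \<epsilon>"
  using eps kap mult_strict_left_mono[of \<kappa> "1 / 2" \<epsilon>] by auto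

text \<open>The bound on \<kappa> keeps the two ramps of width \<open>\<epsilon> * \<kappa>\<close>
  apart inside the thin part, so at most one entry of the minimum lies below 1 on that part.\<close>

lemma plateau_eq:
  "frac y \<le> 1 - \<epsilon> \<Longrightarrow> plateau y = 0"
  "1 - \<epsilon> \<le> frac y \<Longrightarrow> frac y \<le> 1 - \<epsilon> + \<epsilon> * \<kappa> \<Longrightarrow> plateau y = (frac y - (1 - \<epsilon>)) / (\<epsilon> * \<kappa>)"
  "1 - \<epsilon> + \<epsilon> * \<kappa> \<le> frac y \<Longrightarrow> frac y \<le> 1 - \<epsilon> * \<kappa> \<Longrightarrow> plateau y = 1"
  "1 - \<epsilon> * \<kappa> \<le> frac y \<Longrightarrow> plateau y = (1 - frac y) / (\<epsilon> * \<kappa>)"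
proof -
  let ?l = "(frac y - (1 - \<epsilon>)) / (\<epsilon> * \<kappa>)" and ?r = "(1 - frac y) / (\<epsilon> * \<kappa>)"
  note ek = eps_kap
  have r0: "0 \<le> ?r" using ek(1) frac_lt_1[of y] by simp
  show "plateau y = 0" if "frac y \<le> 1 - \<epsilon>"
  proof -
    have "?l \<le> 0" using that ek(1) by (intro divide_nonpos_pos) auto
    then show ?thesis unfolding plateau_def by (intro clamp01_eq(1)) linarith
  qed
  show "plateau y = ?l" if z: "1 - \<epsilon> \<le> frac y" "frac y \<le> 1 - \<epsilon> + \<epsilon> * \<kappa>"
  proof -
    have "0 \<le> ?l" "?l \<le> 1" "1 \<le> ?r" using z ek by (simp_all add: pos_le_divide_eq pos_divide_le_eq del: mult_pos_pos)
    then show ?thesis unfolding plateau_def by (subst clamp01_eq(3)) linarith+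
  qed
  show "plateau y = 1" if z: "1 - \<epsilon> + \<epsilon> * \<kappa> \<le> frac y" "frac y \<le> 1 - \<epsilon> * \<kappa>"
  proof -
    have "1 \<le> ?l" "1 \<le> ?r" using z ek by (simp_all add: pos_le_divide_eq)
    then show ?thesis unfolding plateau_def by (intro clamp01_eq(2)) linarith
  qed
  show "plateau y = ?r" if z: "1 - \<epsilon> * \<kappa> \<le> frac y"
  proof -
    have "1 \<le> ?l" "?r \<le> 1" using z ek by (simp_all add: pos_le_divide_eq pos_divide_le_eq)
    then show ?thesis using r0 unfolding plateau_def by (subst clamp01_eq(3)) linarith+
  qed
qed

lemma locally_affine:
  assumes "a0 \<notin> kinks"
  obtains e \<sigma> where "0 < e"
    "\<And>a. \<bar>a - a0\<bar> < e \<Longrightarrow> a \<notin> kinks"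
    "\<And>a. \<bar>a - a0\<bar> < e \<Longrightarrow> tent (a / ell) = tent (a0 / ell) + slope a0 * (a - a0) / ell"
    "\<And>a. \<bar>a - a0\<bar> < e \<Longrightarrow> plateau (a / ell) = plateau (a0 / ell) + \<sigma> * (a - a0)"
proof -
  define z0 where "z0 = frac (a0 / ell)"
  \<comment> \<open>The break points, together with the right end 1 of the cell: the distances to 0
    and 1 keep \<open>a / ell\<close> in the same cell, so that \<open>frac\<close> is affine near
    \<open>a0\<close>.\<close>
  define A where "A = {0, 1 - \<epsilon>, 1 - \<epsilon> + \<epsilon> * \<kappa>, 1 - \<epsilon> * \<kappa>, 1}"
  define m where "m = Min ((\<lambda>b. \<bar>z0 - b\<bar>) ` A)"
  have z0A: "z0 \<notin> A" using assms frac_lt_1[of "a0 / ell"] by (auto simp: kinks_def z0_def A_def)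
  have "finite A" "A \<noteq> {}" by (auto simp: A_def)
  then have m: "0 < m" "\<And>b. b \<in> A \<Longrightarrow> m \<le> \<bar>z0 - b\<bar>" using z0A by (auto simp: m_def)
  have z01: "0 < z0" "z0 < 1" using z0A frac_lt_1[of "a0 / ell"] by (auto simp: z0_def A_def less_le)
  have z: "frac (a / ell) = z0 + (a - a0) / ell \<and> (\<forall>b\<in>A. (frac (a / ell) < b \<longleftrightarrow> z0 < b) \<and> frac (a / ell) \<noteq> b)"
    if a: "\<bar>a - a0\<bar> < ell * m" for a
  proof -
    have d: "\<bar>(a - a0) / ell\<bar> < m" using a ell_pos by (simp add: pos_divide_less_eq mult.commute)
    have "m \<le> z0" "m \<le> 1 - z0" using m(2)[of 0] m(2)[of 1] z01 by (auto simp: A_def)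
    then have "0 \<le> z0 + (a - a0) / ell" "z0 + (a - a0) / ell < 1" using d by linarith+
    moreover have "a / ell = of_int \<lfloor>a0 / ell\<rfloor> + (z0 + (a - a0) / ell)"
      by (simp add: z0_def frac_def diff_divide_distrib)
    ultimately have fr: "frac (a / ell) = z0 + (a - a0) / ell"
      by (simp add: frac_unique_iff)
    show ?thesis
    proof (intro conjI ballI)
      fix b assume "b \<in> A"
      then have "m \<le> \<bar>z0 - b\<bar>" by (rule m)
      then show "frac (a / ell) < b \<longleftrightarrow> z0 < b" "frac (a / ell) \<noteq> b" using fr d by linarith+
    qed (rule fr)
  qed
  have side: "frac (a / ell) < b \<longleftrightarrow> z0 < b" "frac (a / ell) \<noteq> b"
    if "\<bar>a - a0\<bar> < ell * m" "b \<in> A" for a b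
    using z that by blast+
  have fr: "frac (a / ell) = z0 + (a - a0) / ell" if "\<bar>a - a0\<bar> < ell * m" for a using z that by blast
  have bA: "1 - \<epsilon> \<in> A" "1 - \<epsilon> + \<epsilon> * \<kappa> \<in> A" "1 - \<epsilon> * \<kappa> \<in> A" "0 \<in> A" by (auto simp: A_def)
  have ne: "z0 \<noteq> 1 - \<epsilon>" "z0 \<noteq> 1 - \<epsilon> + \<epsilon> * \<kappa>" "z0 \<noteq> 1 - \<epsilon> * \<kappa>" using z0A by (auto simp: A_def)
  have tent: "tent (a / ell) = tent (a0 / ell) + slope a0 * (a - a0) / ell" if a: "\<bar>a - a0\<bar> < ell * m" for a
  proof (cases "z0 < 1 - \<epsilon>")
    case True
    then have "frac (a / ell) \<le> 1 - \<epsilon>" "frac (a0 / ell) \<le> 1 - \<epsilon>"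
      using side(1)[OF a bA(1)] by (auto simp: z0_def)
    then show ?thesis
      using True fr[OF a] by (simp add: tent_eq slope_def z0_def add_divide_distrib)
  next
    case False
    then have "1 - \<epsilon> \<le> frac (a / ell)" "1 - \<epsilon> \<le> frac (a0 / ell)"
      using side(1)[OF a bA(1)] by (auto simp: z0_def)
    then show ?thesis
      using False fr[OF a] by (simp add: tent_eq slope_def z0_def add_divide_distrib diff_divide_distrib mult.commute)
  qed
  have "\<exists>\<sigma>. \<forall>a. \<bar>a - a0\<bar> < ell * m \<longrightarrow> plateau (a / ell) = plateau (a0 / ell) + \<sigma> * (a - a0)"
  proof -
    consider "z0 < 1 - \<epsilon>" | "1 - \<epsilon> < z0" "z0 < 1 - \<epsilon> + \<epsilon> * \<kappa>"
      | "1 - \<epsilon> + \<epsilon> * \<kappa> < z0" "z0 < 1 - \<epsilon> * \<kappa>" | "1 - \<epsilon> * \<kappa> < z0"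
      using ne by linarith
    then show ?thesis
    proof cases
      case 1
      then have "plateau (a0 / ell) = 0" by (intro plateau_eq(1)) (simp add: z0_def)
      moreover have "plateau (a / ell) = 0" if a: "\<bar>a - a0\<bar> < ell * m" for a
        using side(1)[OF a bA(1)] 1 by (intro plateau_eq(1)) simp
      ultimately show ?thesis by (intro exI[of _ 0]) auto
    next
      case 2
      then have "plateau (a0 / ell) = (z0 - (1 - \<epsilon>)) / (\<epsilon> * \<kappa>)" by (subst plateau_eq(2)) (simp_all add: z0_def)
      moreover have "plateau (a / ell) = (z0 + (a - a0) / ell - (1 - \<epsilon>)) / (\<epsilon> * \<kappa>)" if a: "\<bar>a - a0\<bar> < ell * m" for a
        using side(1)[OF a bA(1)] side(1)[OF a bA(2)] 2 by (subst plateau_eq(2)) (simp_all add: fr[OF a])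
      ultimately show ?thesis
        by (intro exI[of _ "1 / (ell * (\<epsilon> * \<kappa>))"]) (auto simp: diff_divide_distrib add_divide_distrib)
    next
      case 3
      then have "plateau (a0 / ell) = 1" by (intro plateau_eq(3)) (simp_all add: z0_def)
      moreover have "plateau (a / ell) = 1" if a: "\<bar>a - a0\<bar> < ell * m" for a
        using side(1)[OF a bA(2)] side(1)[OF a bA(3)] 3 by (intro plateau_eq(3)) simp_all
      ultimately show ?thesis by (intro exI[of _ 0]) auto
    next
      case 4
      then have "plateau (a0 / ell) = (1 - z0) / (\<epsilon> * \<kappa>)" by (subst plateau_eq(4)) (simp_all add: z0_def)
      moreover have "plateau (a / ell) = (1 - (z0 + (a - a0) / ell)) / (\<epsilon> * \<kappa>)" if a: "\<bar>a - a0\<bar> < ell * m" for a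
        using side(1)[OF a bA(3)] 4 by (subst plateau_eq(4)) (simp_all add: fr[OF a])
      ultimately show ?thesis
        by (intro exI[of _ "- 1 / (ell * (\<epsilon> * \<kappa>))"]) (auto simp: diff_divide_distrib add_divide_distrib)
    qed
  qed
  then obtain \<sigma> where pl: "\<And>a. \<bar>a - a0\<bar> < ell * m \<Longrightarrow> plateau (a / ell) = plateau (a0 / ell) + \<sigma> * (a - a0)" by blast
  have nk: "a \<notin> kinks" if a: "\<bar>a - a0\<bar> < ell * m" for a
    using side(2)[OF a] bA unfolding kinks_def by blast
  have "0 < ell * m" using m(1) ell_pos by (rule mult_pos_pos[rotated])
  then show ?thesis using nk tent pl by (rule that)
qed

lemma countable_kinks: "countable kinks"
proof -
  let ?B = "{0, 1 - \<epsilon>, 1 - \<epsilon> + \<epsilon> * \<kappa>, 1 - \<epsilon> * \<kappa>}"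
  have "kinks \<subseteq> (\<lambda>(k :: int, b). ell * (of_int k + b)) ` (UNIV \<times> ?B)"
  proof
    fix a assume "a \<in> kinks"
    then have "frac (a / ell) \<in> ?B" by (simp add: kinks_def)
    moreover have "a = ell * (of_int \<lfloor>a / ell\<rfloor> + frac (a / ell))" using ell_pos by (simp add: frac_def)
    ultimately show "a \<in> (\<lambda>(k :: int, b). ell * (of_int k + b)) ` (UNIV \<times> ?B)"
      by (intro image_eqI[of _ _ "(\<lfloor>a / ell\<rfloor>, frac (a / ell))"]) auto
  qed
  then show ?thesis by (rule countable_subset) auto
qed

lemma open_regular: "open {u :: real \<times> real. fst u \<notin> kinks}"
proof -
  have "open (- kinks)"
    unfolding open_dist
  proof
    fix a0 assume "a0 \<in> - kinks"
    then obtain e where "0 < e" "\<And>a. \<bar>a - a0\<bar> < e \<Longrightarrow> a \<notin> kinks" using locally_affine by (metis ComplD)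
    then show "\<exists>e>0. \<forall>y. dist y a0 < e \<longrightarrow> y \<in> - kinks" by (auto simp: dist_real_def)
  qed
  then have "open (fst -` (- kinks) :: (real \<times> real) set)" by (intro open_vimage) (auto intro: continuous_intros)
  then show ?thesis by (simp add: vimage_def)
qed

section \<open>Smoothness and Jacobian almost everywhere\<close>

lemma AE_regular: "AE u in square_measure. fst u \<notin> kinks"
  by (rule AE_square_measure_fst[OF countable_kinks])

text \<open>The image of the regular points under \<open>skew\<close> is open, hence Borel. It
  therefore carries the almost sure statement even when measurability of \<open>P\<close> is
  unknown.\<close>

lemma AE_torus_regular:
  assumes "\<And>u. fst u \<notin> kinks \<Longrightarrow> P (skew u)"
  shows "AE x in torus_measure. P x"
proof -
  let ?G = "skew ` {u. fst u \<notin> kinks}"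
  have "?G \<in> sets borel" by (intro borel_open open_skew_image open_regular)
  then have "AE x in torus_measure. x \<in> ?G"
    unfolding torus_measure_eq using AE_regular by (subst AE_distr_iff) auto
  then show ?thesis by eventually_elim (use assms in auto)
qed

text \<open>The first derivative is the constant \<open>D\<close>, so all higher ones
  vanish.\<close>

lemma Ck_on_affine:
  fixes f :: "'a::euclidean_space \<Rightarrow> 'b::real_normed_vector"
  assumes "\<And>u. (f has_derivative D) (at u)"
  shows "Ck_on k U f"
proof (cases k)
  case 0
  have "continuous_on U f"
    using has_derivative_continuous[OF assms] by (intro continuous_at_imp_continuous_on) auto
  then show ?thesis by (simp add: 0)
next
  case (Suc j)
  have const: "Ck_on j U (\<lambda>_::'a. c)" for c :: 'b and j
  proof (induction j arbitrary: c)
    case (Suc j)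
    have "frechet_derivative (\<lambda>_::'a. c) (at u) = (\<lambda>_. 0)" for u
      by (rule frechet_derivative_at[symmetric]) simp
    then show ?case using Suc.IH by simp
  qed simp
  have "frechet_derivative f (at u) = D" for u using frechet_derivative_at[OF assms] by simp
  moreover have "f differentiable (at u)" for u using assms by (rule differentiableI)
  ultimately show ?thesis using const by (simp add: Suc)
qed

text \<open>In the coordinates \<open>(a, b)\<close> the differential is triangular, with diagonal
  \<open>p\<close> and 1 and off-diagonal entry \<open>q\<close>. Passing to the angles conjugates
  it by a linear map, so the determinant remains \<open>p\<close>.\<close>

lemma flow_locally_affine:
  assumes "fst u \<notin> kinks"
  obtains U g D where "open U" "(fst u + snd u, snd u) \<in> U"
    "\<And>v. v \<in> U \<Longrightarrow> flow t (torus_of v) = torus_of (g v)" "\<And>v. (g has_derivative D) (at v)"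
    "fst (D (1, 0)) * snd (D (0, 1)) - fst (D (0, 1)) * snd (D (1, 0)) = 1 - gain t * slope (fst u)"
proof -
  define a0 where "a0 = fst u"
  obtain e \<sigma> where e: "0 < e"
    "\<And>a. \<bar>a - a0\<bar> < e \<Longrightarrow> tent (a / ell) = tent (a0 / ell) + slope a0 * (a - a0) / ell"
    "\<And>a. \<bar>a - a0\<bar> < e \<Longrightarrow> plateau (a / ell) = plateau (a0 / ell) + \<sigma> * (a - a0)"
    using locally_affine[of a0] assms a0_def by metis
  define p q where "p = 1 - gain t * slope a0" and "q = \<sigma> * (turn T t - turn (T / 2) t)"
  define A where "A v = squeeze t a0 + p * (fst v - snd v - a0)" for v :: "real \<times> real"
  define B where "B v = snd v + shear t a0 + q * (fst v - snd v - a0)" for v :: "real \<times> real"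
  define g where "g v = (A v + B v, B v)" for v
  define D where "D h = (p * (fst h - snd h) + snd h + q * (fst h - snd h), snd h + q * (fst h - snd h))" for h :: "real \<times> real"
  define U where "U = {v :: real \<times> real. \<bar>fst v - snd v - a0\<bar> < e}"
  show ?thesis
  proof (rule that[of U g D])
    show "open U" unfolding U_def by (intro open_Collect_less continuous_intros)
    show "(fst u + snd u, snd u) \<in> U" using e(1) by (simp add: U_def a0_def)
    show "flow t (torus_of v) = torus_of (g v)" if "v \<in> U" for v
    proof -
      have v: "\<bar>fst v - snd v - a0\<bar> < e" using that by (simp add: U_def)
      have "ell * gain t * (slope a0 * (fst v - snd v - a0) / ell) = gain t * slope a0 * (fst v - snd v - a0)"
        using ell_pos by simp
      then have "squeeze t (fst v - snd v) = A v"
        by (simp add: squeeze_def A_def p_def e(2)[OF v] distrib_left left_diff_distrib)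
      moreover have "snd v + shear t (fst v - snd v) = B v"
        by (simp add: shear_def B_def q_def e(3)[OF v] algebra_simps)
      ultimately have "pos t (fst v - snd v, snd v) = (A v, B v)" by (simp add: pos_def)
      then show ?thesis
        by (simp add: torus_of_eq_skew[of v] flow_skew g_def skew_def[of "(A v, B v)"])
    qed
    show "(g has_derivative D) (at v)" for v
      unfolding g_def A_def B_def
      by (rule has_derivative_eq_rhs, (rule derivative_intros)+) (simp add: D_def fun_eq_iff algebra_simps)
    show "fst (D (1, 0)) * snd (D (0, 1)) - fst (D (0, 1)) * snd (D (1, 0)) = 1 - gain t * slope (fst u)"
      by (simp add: D_def p_def a0_def algebra_simps)
  qed
qed

lemma flow_smooth:
  assumes "fst u \<notin> kinks"
  shows "torus_smooth_at (flow t) (skew u)"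
proof -
  obtain U g D where "open U" "(fst u + snd u, snd u) \<in> U"
    "\<And>v. v \<in> U \<Longrightarrow> flow t (torus_of v) = torus_of (g v)" "\<And>v. (g has_derivative D) (at v)"
    using flow_locally_affine[OF assms] by metis
  then show ?thesis
    unfolding torus_smooth_at_def skew_def using Ck_on_affine[of g D]
    by (intro exI[of _ U] exI[of _ g] conjI) auto
qed

lemma flow_derivative:
  assumes "fst u \<notin> kinks"
  shows "\<exists>D. torus_has_derivative (flow t) D (skew u)"
    and "torus_jac (flow t) (skew u) = 1 - gain t * slope (fst u)"
proof -
  obtain U g D where g: "open U" "(fst u + snd u, snd u) \<in> U"
    "\<And>v. v \<in> U \<Longrightarrow> flow t (torus_of v) = torus_of (g v)" "\<And>v. (g has_derivative D) (at v)"
    and D: "fst (D (1, 0)) * snd (D (0, 1)) - fst (D (0, 1)) * snd (D (1, 0)) = 1 - gain t * slope (fst u)"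
    using flow_locally_affine[OF assms] by metis
  have "\<forall>\<^sub>F v in nhds (fst u + snd u, snd u). flow t (torus_of v) = torus_of (g v)"
    unfolding eventually_nhds using g by blast
  then have "torus_has_derivative (flow t) D (skew u)"
    unfolding torus_has_derivative_def skew_def using g(4) by blast
  then show "\<exists>D. torus_has_derivative (flow t) D (skew u)"
    and "torus_jac (flow t) (skew u) = 1 - gain t * slope (fst u)"
    using D by (auto simp: torus_jac_eq)
qed

end

section \<open>Families of paths\<close>

lemma lipschitz_continuous_map_path:
  fixes X :: "'a::metric_space \<Rightarrow> real \<Rightarrow> torus cone"
  assumes X: "\<And>u. X u \<in> paths T R" and L: "\<And>u v. pdist T R (X u) (X v) \<le> L * dist u v"
  shows "continuous_map euclidean (path_topology T R) X"
proof -
  interpret P: Metric_space "paths T R" "pdist T R"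
    by (rule Metric_space_mspace_mdist)
  have "continuous_map Met_TC.mtopology P.mtopology X"
    unfolding Met_TC.metric_continuous_map[OF P.Metric_space_axioms]
  proof (intro conjI ballI allI impI)
    show "range X \<subseteq> paths T R" using X by auto
    fix u :: 'a and e :: real assume e: "0 < e"
    show "\<exists>d>0. \<forall>v. v \<in> UNIV \<and> dist u v < d \<longrightarrow> pdist T R (X u) (X v) < e"
    proof (intro exI[of _ "e / (\<bar>L\<bar> + 1)"] conjI allI impI)
      fix v assume v: "v \<in> UNIV \<and> dist u v < e / (\<bar>L\<bar> + 1)"
      have "pdist T R (X u) (X v) \<le> (\<bar>L\<bar> + 1) * dist u v"
        using L[of u v] by (rule order_trans) (auto intro!: mult_right_mono)
      also have "\<dots> < e" using v by (simp add: field_simps)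
      finally show "pdist T R (X u) (X v) < e" .
    qed (use e in auto)
  qed
  then show ?thesis by (simp add: mtopology_of_def)
qed

lemma continuous_path_vimage:
  assumes "continuous_map euclidean (path_topology T R) X" "openin (path_topology T R) U"
  shows "open (X -` U)"
  using openin_continuous_map_preimage[OF assms] by (simp add: vimage_def)

lemma continuous_path_measurable:
  fixes X :: "'a::metric_space \<Rightarrow> real \<Rightarrow> torus cone"
  assumes "continuous_map euclidean (path_topology T R) X"
  shows "X \<in> measurable borel (path_borel T R)"
proof (rule measurable_path_borelI)
  show "X u \<in> paths T R" for u
    using continuous_map_funspace[OF assms] by auto
  show "X -` U \<inter> space borel \<in> sets borel" if "openin (path_topology T R) U" for U
    using continuous_path_vimage[OF assms that] by simp
qed

lemma compact_image_path_borel: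
  fixes X :: "'a::metric_space \<Rightarrow> real \<Rightarrow> torus cone"
  assumes "continuous_map euclidean (path_topology T R) X" "compact C"
  shows "X ` C \<in> sets (path_borel T R)"
proof (rule closedin_path_borel)
  interpret P: Metric_space "paths T R" "pdist T R"
    by (rule Metric_space_mspace_mdist)
  have "compactin (path_topology T R) (X ` C)"
    using image_compactin[OF _ assms(1), of C] assms(2) by simp
  then show "closedin (path_topology T R) (X ` C)"
    by (intro compactin_imp_closedin) (auto simp: mtopology_of_def P.Hausdorff_space_mtopology)
qed

text \<open>The lower bound needs a Borel set of full measure on which the integrand is large; the
  image of a compact set serves as such.\<close>

lemma AE_distr_compact_image:
  fixes Y :: "real \<times> real \<Rightarrow> real \<Rightarrow> torus cone"
  assumes Y: "continuous_map euclidean (path_topology T R) Y"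
    and S [measurable]: "S \<in> measurable borel borel" and SC: "\<And>u. u \<in> fund_square \<Longrightarrow> S u \<in> C" and C: "compact C"
  shows "AE z in push T R (\<lambda>u. Y (S u)). z \<in> Y ` C"
proof -
  note [measurable] = continuous_path_measurable[OF Y] compact_image_path_borel[OF Y C]
  have "AE u in square_measure. u \<in> fund_square"
    unfolding square_measure_def by (intro AE_uniform_measureI) (auto simp: sets_fund_square)
  then have "AE u in square_measure. Y (S u) \<in> Y ` C"
    by eventually_elim (use SC in auto)
  moreover have "{z \<in> space (path_borel T R). z \<in> Y ` C} = Y ` C"
    using sets.sets_into_space[OF compact_image_path_borel[OF Y C]] by auto
  ultimately show ?thesis by (subst AE_distr_iff) simp_all
qed

lemma emeasure_distr_square:
  assumes "X \<in> measurable borel (path_borel T R)"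
  shows "emeasure (push T R X) (space (push T R X)) = 1"
proof -
  have "X \<in> measurable square_measure (path_borel T R)" using assms by (simp cong: measurable_cong_sets)
  moreover have "X -` paths T R = UNIV"
    using measurable_space[OF assms] by auto
  moreover have "paths T R \<in> sets (path_borel T R)"
    using sets.top[of "path_borel T R"] by simp
  ultimately show ?thesis
    using prob_space_square_measure by (simp add: emeasure_distr)
qed

text \<open>Because \<open>skew\<close> is a quotient map, preimages of open sets under
  \<open>P\<close> are open as soon as they are so under \<open>X\<close>. This replaces a
  measurable choice of representatives.\<close>

lemma measurable_torus_path:
  assumes X: "continuous_map euclidean (path_topology T R) X" and P: "\<And>u. P (skew u) = X u"
  shows "P \<in> measurable borel (path_borel T R)"
proof (rule measurable_path_borelI)
  fix x
  obtain u where u: "skew u = x" by (rule skew_surj)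
  show "P x \<in> paths T R"
    using continuous_map_funspace[OF X] P[of u] u by auto
next
  fix U assume U: "openin (path_topology T R) U"
  have "skew -` (P -` U) = X -` U" by (auto simp: P)
  then have "open (P -` U)"
    using continuous_path_vimage[OF X U] by (simp add: open_vimage_skew_iff[symmetric])
  then show "P -` U \<inter> space borel \<in> sets borel" by simp
qed

text \<open>The phase \<beta> treats both populations at once: \<open>\<beta> = 0\<close> is the
  cosine of the thick particles, \<open>\<beta> = pi / 2\<close> the sine of the thin ones.\<close>

definition wave :: "real \<Rightarrow> real \<Rightarrow> real \<Rightarrow> real" where
  "wave T \<beta> t = cos (pi * t / T - \<beta>)"

lemma wave_lipschitz:
  assumes "0 < T"
  shows "\<bar>wave T \<beta> t - wave T \<beta> s\<bar> \<le> pi / T * \<bar>t - s\<bar>"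
proof -
  have "\<bar>wave T \<beta> t - wave T \<beta> s\<bar> = \<bar>sin (pi * t / T - \<beta> + pi / 2) - sin (pi * s / T - \<beta> + pi / 2)\<bar>"
    by (simp add: wave_def sin_add)
  also have "\<dots> \<le> \<bar>(pi * t / T - \<beta> + pi / 2) - (pi * s / T - \<beta> + pi / 2)\<bar>" by (rule abs_sin_diff_le)
  also have "\<dots> = pi / T * \<bar>t - s\<bar>"
    using assms by (simp add: diff_divide_distrib[symmetric] right_diff_distrib[symmetric] abs_mult)
  finally show ?thesis .
qed

section \<open>Particle paths of the striped flow\<close>

locale striped_torus = stripes +
  fixes R :: real and xbar :: torus
  assumes R: "0 < R"
begin

text \<open>The radius is left free so that the paths before and after the rescaling, which have the
  same base curves, are instances of one family.\<close>

definition fpath :: "(real \<Rightarrow> real) \<Rightarrow> real \<times> real \<Rightarrow> real \<Rightarrow> torus cone" where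
  "fpath \<rho> u = (\<lambda>t\<in>{0..T}. cone_pt (skew (pos t u)) (\<rho> t))"

definition radius :: "(real \<Rightarrow> real) \<Rightarrow> bool" where
  "radius \<rho> \<longleftrightarrow> (\<exists>B K. \<forall>s t. 0 \<le> \<rho> t \<and> \<rho> t \<le> B \<and> \<bar>\<rho> s - \<rho> t\<bar> \<le> K * \<bar>s - t\<bar>)"

lemma fpath_time_lipschitz:
  assumes "radius \<rho>"
  obtains L where "\<And>s t u. cdist R (cone_pt (skew (pos s u)) (\<rho> s)) (cone_pt (skew (pos t u)) (\<rho> t)) \<le> L * \<bar>s - t\<bar>"
proof -
  obtain B K where \<rho>: "\<And>t. 0 \<le> \<rho> t" "\<And>t. \<rho> t \<le> B" "\<And>s t. \<bar>\<rho> s - \<rho> t\<bar> \<le> K * \<bar>s - t\<bar>"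
    using assms unfolding radius_def by blast
  define M where "M = 2 * pi / T * ell + (1 + R) * (pi / \<delta>)"
  have "cdist R (cone_pt (skew (pos s u)) (\<rho> s)) (cone_pt (skew (pos t u)) (\<rho> t)) \<le> (K + B * M) * \<bar>s - t\<bar>"
    for s t u
  proof -
    have "torus_dist R (skew (pos s u)) (skew (pos t u)) \<le>
       \<bar>squeeze t (fst u) - squeeze s (fst u)\<bar> + (1 + R) * \<bar>shear t (fst u) - shear s (fst u)\<bar>"
      using torus_dist_skew_le[OF R, of "pos s u" "pos t u"] by (simp add: pos_def)
    also have "\<dots> \<le> 2 * pi / T * ell * \<bar>t - s\<bar> + (1 + R) * (pi / \<delta> * \<bar>t - s\<bar>)"
      using R by (intro add_mono mult_left_mono squeeze_time_lipschitz shear_time_lipschitz) auto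
    also have "\<dots> = M * \<bar>s - t\<bar>" by (simp add: M_def distrib_right abs_minus_commute)
    finally have d: "torus_dist R (skew (pos s u)) (skew (pos t u)) \<le> M * \<bar>s - t\<bar>" .
    have "cdist R (cone_pt (skew (pos s u)) (\<rho> s)) (cone_pt (skew (pos t u)) (\<rho> t)) \<le>
       \<bar>\<rho> s - \<rho> t\<bar> + \<rho> t * torus_dist R (skew (pos s u)) (skew (pos t u))"
      by (rule cone_dist_le[OF R \<rho>(1) \<rho>(1)])
    also have "\<dots> \<le> K * \<bar>s - t\<bar> + B * (M * \<bar>s - t\<bar>)"
      using \<rho>(1)[of t] \<rho>(2)[of t] \<rho>(3)[of s t] d torus_dist_ge_0 by (intro add_mono mult_mono) auto
    finally show ?thesis by (simp add: distrib_right mult.assoc)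
  qed
  then show ?thesis by (rule that)
qed

lemma fpath_mem:
  assumes "radius \<rho>"
  shows "fpath \<rho> u \<in> paths T R"
proof -
  obtain L where "\<And>s t u. cdist R (cone_pt (skew (pos s u)) (\<rho> s)) (cone_pt (skew (pos t u)) (\<rho> t)) \<le> L * \<bar>s - t\<bar>"
    by (rule fpath_time_lipschitz[OF assms]) blast
  then show ?thesis unfolding fpath_def by (intro lipschitz_path_mem[OF R])
qed

text \<open>At a given time the paths of two labels have equal radii, so only the torus distance of
  their positions counts, and that is Lipschitz in the label.\<close>

lemma continuous_fpath:
  assumes "radius \<rho>"
  shows "continuous_map euclidean (path_topology T R) (fpath \<rho>)"
proof -
  obtain B K where \<rho>: "\<And>t. 0 \<le> \<rho> t" "\<And>t. \<rho> t \<le> B" "\<And>s t. \<bar>\<rho> s - \<rho> t\<bar> \<le> K * \<bar>s - t\<bar>"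
    using assms unfolding radius_def by blast
  define M where "M = (1 + 1 / \<epsilon>) + (1 + R) * (1 + pi / (\<epsilon> * \<kappa> * ell))"
  show ?thesis
  proof (rule lipschitz_continuous_map_path)
    show "fpath \<rho> u \<in> paths T R" for u using assms by (rule fpath_mem)
    fix u v :: "real \<times> real"
    have "cdist R (fpath \<rho> u t) (fpath \<rho> v t) \<le> (B * M) * dist u v" if t: "t \<in> {0..T}" for t
    proof -
      have c: "\<bar>fst v - fst u\<bar> \<le> dist u v" "\<bar>snd v - snd u\<bar> \<le> dist u v"
        using dist_fst_le[of u v] dist_snd_le[of u v] by (auto simp: dist_real_def)
      have ek: "0 \<le> pi / (\<epsilon> * \<kappa> * ell)" using eps kap ell_pos by simp
      have "torus_dist R (skew (pos t u)) (skew (pos t v)) \<le>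
         \<bar>squeeze t (fst v) - squeeze t (fst u)\<bar> + (1 + R) * \<bar>(snd v - snd u) + (shear t (fst v) - shear t (fst u))\<bar>"
        using torus_dist_skew_le[OF R, of "pos t u" "pos t v"] by (simp add: pos_def algebra_simps)
      also have "\<dots> \<le> (1 + 1 / \<epsilon>) * dist u v + (1 + R) * (dist u v + pi / (\<epsilon> * \<kappa> * ell) * dist u v)"
      proof (intro add_mono mult_left_mono)
        show "\<bar>squeeze t (fst v) - squeeze t (fst u)\<bar> \<le> (1 + 1 / \<epsilon>) * dist u v"
          using c eps by (intro order_trans[OF squeeze_lipschitz] mult_left_mono) auto
        have "\<bar>shear t (fst v) - shear t (fst u)\<bar> \<le> pi / (\<epsilon> * \<kappa> * ell) * dist u v"
          using c ek by (intro order_trans[OF shear_lipschitz] mult_left_mono) auto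
        then show "\<bar>(snd v - snd u) + (shear t (fst v) - shear t (fst u))\<bar> \<le> dist u v + pi / (\<epsilon> * \<kappa> * ell) * dist u v"
          using c by linarith
      qed (use R in auto)
      also have "\<dots> = M * dist u v" by (simp add: M_def algebra_simps)
      finally have d: "torus_dist R (skew (pos t u)) (skew (pos t v)) \<le> M * dist u v" .
      have "cdist R (fpath \<rho> u t) (fpath \<rho> v t) \<le> \<rho> t * torus_dist R (skew (pos t u)) (skew (pos t v))"
        using t \<rho>(1) torus_dist_ge_0 by (simp add: fpath_def cone_dist_same_radius)
      also have "\<dots> \<le> B * (M * dist u v)"
        using \<rho>(1)[of t] \<rho>(2)[of t] d torus_dist_ge_0 by (intro mult_mono) auto
      finally show ?thesis by (simp add: mult.assoc)
    qed
    then show "pdist T R (fpath \<rho> u) (fpath \<rho> v) \<le> (B * M) * dist u v"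
      using T R assms by (subst mdist_path_space_le) (auto simp: fpath_mem)
  qed
qed

lemma fpath_invariant: "skew u = skew v \<Longrightarrow> fpath \<rho> u = fpath \<rho> v"
  by (simp add: fpath_def flow_skew[symmetric])

subsection \<open>Action\<close>

definition gain_rate :: "real \<Rightarrow> real" where
  "gain_rate t = (1 - 2 * \<epsilon>) * (2 * sin (pi * t / T) * (cos (pi * t / T) * (pi / T)))"

definition turn_rate :: "real \<Rightarrow> real \<Rightarrow> real" where
  "turn_rate c t = (if c - \<delta> < t \<and> t < c then pi / \<delta> else 0)"

definition vel_a :: "real \<Rightarrow> real \<Rightarrow> real" where
  "vel_a t a = - (ell * gain_rate t * tent (a / ell))"

definition vel_b :: "real \<Rightarrow> real \<Rightarrow> real" where
  "vel_b t a = turn_rate (T / 2) t + plateau (a / ell) * (turn_rate T t - turn_rate (T / 2) t)"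

definition vel :: "real \<Rightarrow> real \<Rightarrow> real \<times> real" where
  "vel t a = (vel_a t a + vel_b t a, vel_b t a)"

lemma gain_derivative: "(gain has_real_derivative gain_rate t) (at t within S)"
  unfolding gain_def gain_rate_def using T
  by (auto intro!: derivative_eq_intros simp: field_simps)

lemma turn_derivative:
  assumes "t \<notin> {c - \<delta>, c}"
  shows "(turn c has_real_derivative turn_rate c t) (at t)"
proof -
  consider "t < c - \<delta>" | "c - \<delta> < t" "t < c" | "c < t" using assms del by force
  then show ?thesis
  proof cases
    case 1
    have "(turn c has_real_derivative 0) (at t)"
      by (rule DERIV_cong_ev[THEN iffD1, OF refl _ refl, of "\<lambda>_. 0" _ t])
        (use 1 in \<open>auto simp: turn_before eventually_nhds_metric dist_real_def intro!: exI[of _ "c - \<delta> - t"]\<close>)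
    then show ?thesis using 1 del by (simp add: turn_rate_def)
  next
    case 2
    have "((\<lambda>t. pi * ((t - c + \<delta>) / \<delta>)) has_real_derivative pi / \<delta>) (at t)"
      using del by (auto intro!: derivative_eq_intros)
    moreover have "pi * ((s - c + \<delta>) / \<delta>) = turn c s" if "c - \<delta> < s" "s < c" for s
      unfolding turn_def using that del by (subst clamp01_eq(3)) (auto simp: field_simps)
    then have "\<forall>\<^sub>F s in nhds t. pi * ((s - c + \<delta>) / \<delta>) = turn c s"
      using eventually_nhds_in_open[of "{c - \<delta><..<c}" t] 2 by (auto elim!: eventually_mono)
    ultimately have "(turn c has_real_derivative pi / \<delta>) (at t)"
      by (subst DERIV_cong_ev[OF refl _ refl]) (auto elim: eventually_mono)
    then show ?thesis using 2 by (simp add: turn_rate_def)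
  next
    case 3
    have "\<forall>\<^sub>F s in nhds t. pi = turn c s"
      using eventually_nhds_in_open[of "{c<..}" t] 3 by (auto elim!: eventually_mono simp: turn_after)
    then have "(turn c has_real_derivative 0) (at t)"
      by (subst DERIV_cong_ev[OF refl _ refl, of _ "\<lambda>_. pi"]) (auto elim: eventually_mono)
    then show ?thesis using 3 by (simp add: turn_rate_def)
  qed
qed

text \<open>The excluded times are the ends of the two turning windows, where the speed of the shear
  jumps.\<close>

lemma fpath_velocity:
  assumes "t \<notin> {T / 2 - \<delta>, T / 2, T - \<delta>, T}"
  shows "torus_has_velocity (\<lambda>t. skew (pos t u)) (vel t (fst u)) t S"
proof -
  have d: "(turn c has_real_derivative turn_rate c t) (at t within S)" if "c \<in> {T / 2, T}" for c
    using assms that by (intro has_field_derivative_at_within[OF turn_derivative]) auto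
  have A: "((\<lambda>t. squeeze t (fst u)) has_real_derivative vel_a t (fst u)) (at t within S)"
    unfolding squeeze_def vel_a_def by (auto intro!: derivative_eq_intros gain_derivative)
  have B: "((\<lambda>t. shear t (fst u)) has_real_derivative vel_b t (fst u)) (at t within S)"
    unfolding shear_def vel_b_def by (auto intro!: derivative_eq_intros d)
  show ?thesis
    unfolding torus_has_velocity_def
  proof (intro exI conjI)
    let ?U = "\<lambda>s. (squeeze s (fst u) + (snd u + shear s (fst u)), snd u + shear s (fst u))"
    show "torus_of (?U t) = skew (pos t u)" by (simp add: skew_def pos_def)
    show "\<forall>\<^sub>F s in at t within S. torus_of (?U s) = skew (pos s u)" by (simp add: skew_def pos_def)
    have "((\<lambda>s. squeeze s (fst u) + (snd u + shear s (fst u))) has_vector_derivative (vel_a t (fst u) + vel_b t (fst u))) (at t within S)"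
       "((\<lambda>s. snd u + shear s (fst u)) has_vector_derivative vel_b t (fst u)) (at t within S)"
      using A B unfolding has_real_derivative_iff_has_vector_derivative[symmetric]
      by (auto intro!: derivative_eq_intros)
    then show "(?U has_vector_derivative vel t (fst u)) (at t within S)"
      unfolding vel_def by (rule has_vector_derivative_Pair)
  qed
qed

lemma measurable_vel [measurable]: "(\<lambda>t. vel t a) \<in> borel_measurable borel"
  unfolding vel_def vel_a_def vel_b_def gain_rate_def turn_rate_def by measurable

lemma fpath_action:
  assumes \<rho>: "radius \<rho>" and pos: "\<And>t. 0 < \<rho> t" and d: "\<And>t. (\<rho> has_real_derivative \<rho>' t) (at t)"
    and [measurable]: "\<rho>' \<in> borel_measurable borel"
  shows "path_action xbar T R (fpath \<rho> u) =
    (\<integral>\<^sup>+t\<in>{0..T}. ennreal ((\<rho> t)\<^sup>2 * (torus_norm R (vel t (fst u)))\<^sup>2 + (\<rho>' t)\<^sup>2) \<partial>lborel)"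
proof -
  obtain L where L: "\<And>s t u. cdist R (cone_pt (skew (pos s u)) (\<rho> s)) (cone_pt (skew (pos t u)) (\<rho> t)) \<le> L * \<bar>s - t\<bar>"
    by (rule fpath_time_lipschitz[OF \<rho>]) blast
  have "continuous_on UNIV \<rho>"
    using d by (auto intro!: continuous_at_imp_continuous_on DERIV_isCont)
  then have [measurable]: "\<rho> \<in> borel_measurable borel" by (rule borel_measurable_continuous_onI)
  show ?thesis
    unfolding fpath_def
  proof (rule path_action_eq[where F = "{T / 2 - \<delta>, T / 2, T - \<delta>, T}" and L = L])
    show "(\<rho> has_vector_derivative \<rho>' t) (at t within {0..T})" for t
      using has_field_derivative_at_within[OF d] by (simp add: has_real_derivative_iff_has_vector_derivative)
  qed (use R T L pos fpath_velocity in \<open>auto simp: less_imp_le\<close>)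
qed

subsection \<open>Radii\<close>

abbreviation osc :: "real \<Rightarrow> real \<Rightarrow> real" where
  "osc \<equiv> wave T"

text \<open>Current relative width of the thick part for \<open>\<beta> = 0\<close> and of the thin
  part for \<open>\<beta> = pi / 2\<close>. The factor \<open>1 - 2 * \<epsilon>\<close> lets it run
  between \<epsilon> and \<open>1 - \<epsilon>\<close>, so the two widths are exchanged at time
  \<open>T / 2\<close>.\<close>

definition mass :: "real \<Rightarrow> real \<Rightarrow> real" where
  "mass \<beta> t = \<epsilon> + (1 - 2 * \<epsilon>) * (osc \<beta> t)\<^sup>2"

text \<open>The constant \<open>c\<close> is the reciprocal of the initial width before the
  rescaling, which gives the root of the Jacobian, and 2 after it.\<close>

definition rad :: "real \<Rightarrow> real \<Rightarrow> real \<Rightarrow> real" where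
  "rad c \<beta> t = sqrt (c * mass \<beta> t)"

lemma mass_bounds: "\<epsilon> \<le> mass \<beta> t" "mass \<beta> t \<le> 1 - \<epsilon>"
proof -
  have "0 \<le> (osc \<beta> t)\<^sup>2" "(osc \<beta> t)\<^sup>2 \<le> 1" by (auto simp: wave_def abs_square_le_1)
  then have "0 \<le> (1 - 2 * \<epsilon>) * (osc \<beta> t)\<^sup>2" "(1 - 2 * \<epsilon>) * (osc \<beta> t)\<^sup>2 \<le> (1 - 2 * \<epsilon>) * 1"
    using eps by (auto intro!: mult_left_mono)
  then show "\<epsilon> \<le> mass \<beta> t" "mass \<beta> t \<le> 1 - \<epsilon>" by (auto simp: mass_def)
qed

lemma mass_pos: "0 < mass \<beta> t"
  using mass_bounds(1)[of \<beta> t] eps by linarith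

lemma rad_pos: "0 < c \<Longrightarrow> 0 < rad c \<beta> t"
  using mass_pos by (simp add: rad_def)

definition rad_rate :: "real \<Rightarrow> real \<Rightarrow> real \<Rightarrow> real" where
  "rad_rate c \<beta> t = c * ((1 - 2 * \<epsilon>) * (2 * osc \<beta> t * (- sin (pi * t / T - \<beta>) * (pi / T)))) / (2 * rad c \<beta> t)"

lemma rad_derivative:
  assumes "0 < c"
  shows "(rad c \<beta> has_real_derivative rad_rate c \<beta> t) (at t)"
proof -
  have "((\<lambda>t. c * mass \<beta> t) has_real_derivative c * ((1 - 2 * \<epsilon>) * (2 * osc \<beta> t * (- sin (pi * t / T - \<beta>) * (pi / T))))) (at t)"
    unfolding mass_def wave_def using T by (auto intro!: derivative_eq_intros simp: field_simps)
  moreover have "0 < c * mass \<beta> t" using assms mass_pos by simp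
  ultimately have "((\<lambda>t. sqrt (c * mass \<beta> t)) has_real_derivative
     inverse (sqrt (c * mass \<beta> t)) / 2 * (c * ((1 - 2 * \<epsilon>) * (2 * osc \<beta> t * (- sin (pi * t / T - \<beta>) * (pi / T)))))) (at t)"
    by (intro DERIV_chain2[of sqrt] DERIV_real_sqrt)
  moreover have "rad c \<beta> = (\<lambda>t. sqrt (c * mass \<beta> t))" by (simp add: rad_def fun_eq_iff)
  moreover have "inverse r / 2 * x = x / (2 * r)" for r x :: real
    by (simp add: inverse_eq_divide)
  ultimately show ?thesis by (simp only: rad_rate_def rad_def)
qed

lemma measurable_rad_rate [measurable]: "rad_rate c \<beta> \<in> borel_measurable borel"
  unfolding rad_rate_def[abs_def] rad_def mass_def wave_def by measurable

text \<open>The radius stays above \<open>sqrt (c * \<epsilon>)\<close>, so the sum of two radii is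
  bounded below and the Lipschitz bound for the squares passes to the roots.\<close>

lemma radius_rad:
  assumes c: "0 < c"
  shows "radius (rad c \<beta>)"
  unfolding radius_def
proof (intro exI allI conjI)
  fix s t
  show "0 \<le> rad c \<beta> t" using rad_pos[OF c] by (rule less_imp_le)
  show "rad c \<beta> t \<le> sqrt c"
    unfolding rad_def using c mass_bounds(2)[of \<beta> t] eps by (simp add: mult_left_le)
  have "\<bar>(osc \<beta> s)\<^sup>2 - (osc \<beta> t)\<^sup>2\<bar> = \<bar>osc \<beta> s - osc \<beta> t\<bar> * \<bar>osc \<beta> s + osc \<beta> t\<bar>"
    by (simp add: abs_mult[symmetric] power2_eq_square algebra_simps)
  also have "\<dots> \<le> (pi / T * \<bar>s - t\<bar>) * 2"
  proof (intro mult_mono wave_lipschitz[OF T])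
    show "\<bar>osc \<beta> s + osc \<beta> t\<bar> \<le> 2"
      using abs_cos_le_one[of "pi * s / T - \<beta>"] abs_cos_le_one[of "pi * t / T - \<beta>"] unfolding wave_def by linarith
  qed (use T in auto)
  finally have o: "\<bar>(osc \<beta> s)\<^sup>2 - (osc \<beta> t)\<^sup>2\<bar> \<le> 2 * pi / T * \<bar>s - t\<bar>" by (simp add: mult_ac)
  have "\<bar>mass \<beta> s - mass \<beta> t\<bar> = (1 - 2 * \<epsilon>) * \<bar>(osc \<beta> s)\<^sup>2 - (osc \<beta> t)\<^sup>2\<bar>"
    using eps by (simp add: mass_def right_diff_distrib[symmetric] abs_mult)
  also have "\<dots> \<le> 1 * (2 * pi / T * \<bar>s - t\<bar>)" using eps o by (intro mult_mono) auto
  finally have m: "\<bar>mass \<beta> s - mass \<beta> t\<bar> \<le> 2 * pi / T * \<bar>s - t\<bar>" by simp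
  have r: "sqrt (c * \<epsilon>) \<le> rad c \<beta> s" "sqrt (c * \<epsilon>) \<le> rad c \<beta> t"
    unfolding rad_def using c mass_bounds(1) by (auto intro!: mult_left_mono)
  have ce: "0 < sqrt (c * \<epsilon>)" using c eps by simp
  have "\<bar>rad c \<beta> s - rad c \<beta> t\<bar> * sqrt (c * \<epsilon>) \<le> \<bar>rad c \<beta> s - rad c \<beta> t\<bar> * (rad c \<beta> s + rad c \<beta> t)"
    using r ce by (intro mult_left_mono) linarith+
  also have "\<dots> = \<bar>(rad c \<beta> s)\<^sup>2 - (rad c \<beta> t)\<^sup>2\<bar>"
  proof -
    have "(rad c \<beta> s)\<^sup>2 - (rad c \<beta> t)\<^sup>2 = (rad c \<beta> s - rad c \<beta> t) * (rad c \<beta> s + rad c \<beta> t)"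
      by (simp add: power2_eq_square algebra_simps)
    moreover have "0 \<le> rad c \<beta> s + rad c \<beta> t" using r ce by linarith
    ultimately show ?thesis by (simp add: abs_mult)
  qed
  also have "\<dots> = c * \<bar>mass \<beta> s - mass \<beta> t\<bar>"
    using c mass_pos[of \<beta> s] mass_pos[of \<beta> t] by (simp add: rad_def right_diff_distrib[symmetric] abs_mult)
  also have "\<dots> \<le> c * (2 * pi / T * \<bar>s - t\<bar>)" using c m by (intro mult_left_mono) auto
  finally show "\<bar>rad c \<beta> s - rad c \<beta> t\<bar> \<le> c * (2 * pi / T) / sqrt (c * \<epsilon>) * \<bar>s - t\<bar>"
    unfolding times_divide_eq_left pos_le_divide_eq[OF ce] by (simp add: mult.assoc)
qed

lemma rad_scale: "0 < c \<Longrightarrow> 0 < k \<Longrightarrow> rad c \<beta> t / k = rad (c / k\<^sup>2) \<beta> t"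
  by (simp add: rad_def real_sqrt_divide real_sqrt_mult)

text \<open>Each Jacobian is the current width of the part divided by its initial width: the thick
  part has lost \<open>gain t\<close>, the thin part has acquired it.\<close>

lemma jacobians:
  "1 - gain t * (1 / (1 - \<epsilon>)) = (1 / (1 - \<epsilon>)) * mass 0 t"
  "1 - gain t * (- 1 / \<epsilon>) = (1 / \<epsilon>) * mass (pi / 2) t"
proof -
  have "(osc 0 t)\<^sup>2 = 1 - (sin (pi * t / T))\<^sup>2" by (simp add: wave_def cos_squared_eq)
  then have "mass 0 t = 1 - \<epsilon> - gain t"
    unfolding mass_def gain_def by (simp only:) (simp add: algebra_simps)
  then show "1 - gain t * (1 / (1 - \<epsilon>)) = (1 / (1 - \<epsilon>)) * mass 0 t"
    using eps by (simp add: field_simps)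
  have "(osc (pi / 2) t)\<^sup>2 = (sin (pi * t / T))\<^sup>2" by (simp add: wave_def cos_diff)
  then have "mass (pi / 2) t = \<epsilon> + gain t" by (simp add: mass_def gain_def)
  then show "1 - gain t * (- 1 / \<epsilon>) = (1 / \<epsilon>) * mass (pi / 2) t"
    using eps by (simp add: add_divide_distrib)
qed

subsection \<open>The measure on paths generated by the flow\<close>

text \<open>The left end of each cell is left out to make the set open; these ends form a null
  set.\<close>

definition thick :: "(real \<times> real) set" where
  "thick = {u. 0 < frac (fst u / ell) \<and> frac (fst u / ell) < 1 - \<epsilon>}"

text \<open>Defined at every \<open>u\<close>, kinks included, so as to give a Borel representative
  of the almost everywhere defined paths of the flow.\<close>

definition jpath :: "real \<times> real \<Rightarrow> real \<Rightarrow> torus cone" where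
  "jpath u = (if u \<in> thick then fpath (rad (1 / (1 - \<epsilon>)) 0) u else fpath (rad (1 / \<epsilon>) (pi / 2)) u)"

lemma open_thick: "open thick"
proof -
  have "thick = (\<Union>k::int. {u :: real \<times> real. ell * of_int k < fst u \<and> fst u < ell * (of_int k + (1 - \<epsilon>))})"
  proof (intro set_eqI iffI)
    fix u assume "u \<in> thick"
    then have "0 < frac (fst u / ell)" "frac (fst u / ell) < 1 - \<epsilon>" by (auto simp: thick_def)
    moreover have "fst u / ell = of_int \<lfloor>fst u / ell\<rfloor> + frac (fst u / ell)" by (simp add: frac_def)
    ultimately have "of_int \<lfloor>fst u / ell\<rfloor> < fst u / ell" "fst u / ell < of_int \<lfloor>fst u / ell\<rfloor> + (1 - \<epsilon>)" by linarith+
    then have "ell * of_int \<lfloor>fst u / ell\<rfloor> < fst u \<and> fst u < ell * (of_int \<lfloor>fst u / ell\<rfloor> + (1 - \<epsilon>))"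
      using ell_pos by (simp add: pos_less_divide_eq pos_divide_less_eq mult.commute)
    then show "u \<in> (\<Union>k::int. {u :: real \<times> real. ell * of_int k < fst u \<and> fst u < ell * (of_int k + (1 - \<epsilon>))})" by blast
  next
    fix u assume "u \<in> (\<Union>k::int. {u :: real \<times> real. ell * of_int k < fst u \<and> fst u < ell * (of_int k + (1 - \<epsilon>))})"
    then obtain k :: int where k: "ell * of_int k < fst u" "fst u < ell * (of_int k + (1 - \<epsilon>))" by blast
    then have q: "of_int k < fst u / ell" "fst u / ell < of_int k + (1 - \<epsilon>)"
      using ell_pos by (simp_all add: pos_less_divide_eq pos_divide_less_eq mult.commute)
    then have "\<lfloor>fst u / ell\<rfloor> = k" using eps by (intro floor_unique) linarith+
    then show "u \<in> thick" using q by (simp add: thick_def frac_def)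
  qed
  moreover have "open \<dots>" by (intro open_UN ballI open_Collect_conj open_Collect_less continuous_intros)
  ultimately show ?thesis by simp
qed

lemma thick_invariant: "skew u = skew v \<Longrightarrow> u \<in> thick \<longleftrightarrow> v \<in> thick"
  by (auto simp: skew_eq_iff torus_rel_def thick_def frac_cell_periodic simp del: frac_gt_0_iff)

lemma jpath_invariant: "skew u = skew v \<Longrightarrow> jpath u = jpath v"
  using thick_invariant[of u v] fpath_invariant[of u v] by (simp add: jpath_def)

lemma rad_consts: "0 < 1 / (1 - \<epsilon>)" "0 < 1 / \<epsilon>"
  using eps by auto

lemma sqrt_jac_flow:
  assumes "fst u \<notin> kinks"
  shows "sqrt_jac flow t (skew u) = (if u \<in> thick then rad (1 / (1 - \<epsilon>)) 0 t else rad (1 / \<epsilon>) (pi / 2) t)"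
proof -
  have "frac (fst u / ell) \<noteq> 0" using assms by (auto simp: kinks_def)
  then have "0 < frac (fst u / ell)" using frac_ge_0[of "fst u / ell"] by linarith
  then have "slope (fst u) = (if u \<in> thick then 1 / (1 - \<epsilon>) else - 1 / \<epsilon>)"
    by (auto simp: slope_def thick_def)
  then show ?thesis
    using flow_derivative(2)[OF assms, of t] jacobians[of t] by (auto simp: sqrt_jac_def rad_def)
qed

lemma cone_path_flow:
  assumes "fst u \<notin> kinks"
  shows "cone_path T flow (sqrt_jac flow) (skew u) = jpath u"
    and "is_cone_path T R flow (sqrt_jac flow) (skew u)"
proof -
  show 1: "cone_path T flow (sqrt_jac flow) (skew u) = jpath u"
    unfolding cone_path_def jpath_def fpath_def by (auto simp: sqrt_jac_flow[OF assms] flow_skew)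
  show "is_cone_path T R flow (sqrt_jac flow) (skew u)"
    unfolding is_cone_path_def 1
    using fpath_mem radius_rad rad_pos rad_consts
    by (auto simp: sqrt_jac_flow[OF assms] jpath_def less_imp_le)
qed

lemma lifts_to_cone_flow: "lifts_to_cone T R flow"
  unfolding lifts_to_cone_def
  by (rule AE_torus_regular) (simp add: flow_derivative(1) cone_path_flow(2))

lemma flow_measure_flow:
  "flow_measure T R flow (sqrt_jac flow) = push T R jpath"
proof -
  \<comment> \<open>An arbitrary choice of lifts. No regularity of \<open>rep\<close> is used:
    measurability comes from the invariance of \<open>fpath\<close> and \<open>thick\<close> under
    periods.\<close>
  define rep where "rep x = (SOME u. skew u = x)" for x
  have rep: "skew (rep x) = x" for x
    unfolding rep_def by (rule someI_ex) (metis skew_surj)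
  let ?P = "\<lambda>x. jpath (rep x)"
  have P: "?P (skew u) = jpath u" for u by (rule jpath_invariant) (rule rep)
  have meas: "(\<lambda>x. fpath \<rho> (rep x)) \<in> measurable borel (path_borel T R)" if "radius \<rho>" for \<rho>
    using continuous_fpath[OF that] fpath_invariant[OF rep] by (rule measurable_torus_path)
  have "skew -` {x. rep x \<in> thick} = thick"
    using thick_invariant[OF rep] by (auto simp: vimage_def)
  then have "open {x. rep x \<in> thick}" using open_thick by (simp add: open_vimage_skew_iff[symmetric])
  then have "{x \<in> space borel. rep x \<in> thick} \<in> sets borel" by simp
  then have "?P \<in> measurable borel (path_borel T R)"
    unfolding jpath_def by (intro measurable_If meas radius_rad rad_consts)
  then have "?P \<in> measurable torus_measure (path_borel T R)" by (simp cong: measurable_cong_sets)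
  then have "flow_measure T R flow (sqrt_jac flow) = push T R (\<lambda>u. ?P (skew u))"
  proof (rule flow_measure_eq)
    show "AE x in torus_measure. is_cone_path T R flow (sqrt_jac flow) x \<and> cone_path T flow (sqrt_jac flow) x = ?P x"
      by (rule AE_torus_regular) (use cone_path_flow P in simp)
    show "(\<lambda>t\<in>{0..T}. cone_pt x 0) \<in> paths T R" for x
      by (rule lipschitz_path_mem[OF R, of T _ 0]) (simp add: cone_dist_same_point R)
  qed
  then show ?thesis by (simp add: P)
qed

end

section \<open>Rescaling\<close>

text \<open>A 1-homogeneous functional that equals the peak radius for both populations: thick
  particles attain it at time 0, thin ones at time \<open>T / 2\<close>.\<close>

definition path_size :: "real \<Rightarrow> (real \<Rightarrow> torus cone) \<Rightarrow> real" where
  "path_size T z = max (cone_r (z 0)) (cone_r (z (T / 2)))"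

lemma path_size_ge_0: "0 \<le> path_size T z"
  by (simp add: path_size_def cone_r_ge_0 le_max_iff_disj)

lemma path_size_lipschitz:
  assumes R: "0 < R" and T: "0 < T" and z: "z \<in> paths T R" "z' \<in> paths T R"
  shows "\<bar>path_size T z - path_size T z'\<bar> \<le> pdist T R z z'"
proof -
  have "\<bar>cone_r (z t) - cone_r (z' t)\<bar> \<le> pdist T R z z'" if "t \<in> {0..T}" for t
    using cone_r_dist_le cone_dist_path_le[OF R z that] by (rule order_trans)
  from this[of 0] this[of "T / 2"] T show ?thesis by (auto simp: path_size_def max_def)
qed

lemma measurable_path_size:
  assumes R: "0 < R" and T: "0 < T"
  shows "path_size T \<in> borel_measurable (path_borel T R)"
proof (rule measurable_path_real)
  interpret P: Metric_space "paths T R" "pdist T R"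
    by (rule Metric_space_mspace_mdist)
  have "continuous_map P.mtopology Met_TC.mtopology (path_size T)"
    unfolding P.metric_continuous_map[OF Met_TC.Metric_space_axioms]
  proof (intro conjI ballI allI impI)
    fix z and e :: real assume z: "z \<in> paths T R" and e: "0 < e"
    show "\<exists>d>0. \<forall>z'. z' \<in> paths T R \<and> pdist T R z z' < d \<longrightarrow> dist (path_size T z) (path_size T z') < e"
      using path_size_lipschitz[OF R T z] e by (intro exI[of _ e]) (auto simp: dist_real_def intro: order.strict_trans1)
  qed auto
  then show "continuous_map (path_topology T R) euclideanreal (path_size T)"
    by (simp add: mtopology_of_def)
qed

lemma one_homogeneous_path_size: "0 < T \<Longrightarrow> one_homogeneous xbar T R (path_size T)"
  unfolding one_homogeneous_def path_size_def
  by (auto simp: cone_r_ge_0 max_mult_distrib_left)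

definition path_scale :: "torus \<Rightarrow> real \<Rightarrow> real \<Rightarrow> (real \<Rightarrow> torus cone) \<Rightarrow> real \<Rightarrow> torus cone" where
  "path_scale xbar T k z = (\<lambda>t\<in>{0..T}. cone_pt (cone_x xbar (z t)) (k * cone_r (z t)))"

lemma path_scale_dist:
  assumes R: "0 < R" and k: "0 \<le> k" "0 \<le> k'" and t: "t \<in> {0..T}" "s \<in> {0..T}"
  shows "cdist R (path_scale xbar T k z t) (path_scale xbar T k' z' s) \<le>
     k * cdist R (z t) (z' s) + \<bar>k - k'\<bar> * cone_r (z' s)"
proof -
  let ?x = "cone_x xbar (z t)" and ?y = "cone_x xbar (z' s)" and ?r = "cone_r (z t)" and ?s = "cone_r (z' s)"
  have "cdist R (cone_pt ?x (k * ?r)) (cone_pt ?y (k' * ?s)) \<le>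
    cdist R (cone_pt ?x (k * ?r)) (cone_pt ?y (k * ?s)) + cdist R (cone_pt ?y (k * ?s)) (cone_pt ?y (k' * ?s))"
    by (rule cone_dist_triangle[OF R])
  also have "cdist R (cone_pt ?x (k * ?r)) (cone_pt ?y (k * ?s)) = k * cdist R (z t) (z' s)"
    using k by (simp add: cone_dist_scale cone_r_ge_0)
  also have "cdist R (cone_pt ?y (k * ?s)) (cone_pt ?y (k' * ?s)) = \<bar>k - k'\<bar> * ?s"
    using R k cone_r_ge_0[of "z' s"]
    by (simp add: cone_dist_same_point abs_mult left_diff_distrib[symmetric])
  finally show ?thesis using t by (simp add: path_scale_def)
qed

lemma path_scale_mem:
  assumes R: "0 < R" and k: "0 \<le> k" and z: "z \<in> paths T R"
  shows "path_scale xbar T k z \<in> paths T R"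
  unfolding path_space_continuous[OF R]
proof (intro conjI ballI allI impI)
  show "path_scale xbar T k z \<in> extensional {0..T}" by (simp add: path_scale_def)
  fix t e :: real assume t: "t \<in> {0..T}" and e: "0 < e"
  then have "0 < e / (k + 1)" using k by simp
  then obtain d where d: "0 < d" "\<And>s. s \<in> {0..T} \<Longrightarrow> \<bar>s - t\<bar> < d \<Longrightarrow> cdist R (z t) (z s) < e / (k + 1)"
    using z t unfolding path_space_continuous[OF R] by blast
  show "\<exists>d>0. \<forall>s\<in>{0..T}. \<bar>s - t\<bar> < d \<longrightarrow> cdist R (path_scale xbar T k z t) (path_scale xbar T k z s) < e"
  proof (intro exI[of _ d] conjI ballI impI)
    fix s assume s: "s \<in> {0..T}" "\<bar>s - t\<bar> < d"
    have "cdist R (path_scale xbar T k z t) (path_scale xbar T k z s) \<le> k * cdist R (z t) (z s)"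
      using path_scale_dist[OF R k k t s(1)] by simp
    also have "\<dots> \<le> (k + 1) * cdist R (z t) (z s)"
      using cone_dist_ge_0[OF R] by (intro mult_right_mono) auto
    also have "\<dots> < e" using d(2)[OF s] k by (simp add: pos_less_divide_eq mult.commute)
    finally show "cdist R (path_scale xbar T k z t) (path_scale xbar T k z s) < e" .
  qed (rule d)
qed

lemma path_rescale_eq_scale: "path_rescale xbar T \<theta> z = path_scale xbar T (1 / \<theta> z) z"
  by (simp add: path_rescale_def path_scale_def)

text \<open>Near a path of positive size the scaling factor is a Lipschitz function of the path. The
  error consists of the distance of the paths, amplified by that factor, and of the change of the
  factor times the radius.\<close>

lemma continuous_path_rescale:
  assumes R: "0 < R" and T: "0 < T" and C: "0 < C" and z: "z \<in> paths T R"
    and pos: "0 < path_size T z" and e: "0 < e"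
  shows "\<exists>d>0. \<forall>z'\<in>paths T R. pdist T R z z' < d \<longrightarrow> 0 < path_size T z' \<and>
     pdist T R (path_rescale xbar T (\<lambda>z. path_size T z / C) z) (path_rescale xbar T (\<lambda>z. path_size T z / C) z') < e"
proof -
  interpret P: Metric_space "paths T R" "pdist T R"
    by (rule Metric_space_mspace_mdist)
  let ?\<sigma> = "path_size T z"
  define o' :: "real \<Rightarrow> torus cone" where "o' = (\<lambda>t\<in>{0..T}. cone_pt xbar 0)"
  have o': "o' \<in> paths T R"
    unfolding o'_def by (rule lipschitz_path_mem[OF R, of T _ 0]) (simp add: cone_dist_same_point R)
  define B where "B = pdist T R z o'"
  have B: "cone_r (z t) \<le> B" if "t \<in> {0..T}" for t
  proof -
    have "\<bar>cone_r (z t) - cone_r (o' t)\<bar> \<le> B"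
      unfolding B_def using cone_r_dist_le cone_dist_path_le[OF R z o' that] by (rule order_trans)
    then show ?thesis using that by (simp add: o'_def)
  qed
  \<comment> \<open>The two summands are the two errors on a ball where the size is at least half of
    its value at the centre: the factor is then at most \<open>2 * C / ?\<sigma>\<close>, and its
    increments are at most \<open>2 * C / ?\<sigma>\<^sup>2\<close> times the distance.\<close>
  define M where "M = 2 * C / ?\<sigma> + 2 * C * B / ?\<sigma>\<^sup>2"
  have "0 \<le> B" unfolding B_def by simp
  then have M: "0 < M" unfolding M_def using C pos by (intro add_pos_nonneg) auto
  define d where "d = min (?\<sigma> / 2) (e / (2 * M))"
  have d: "0 < d" "d \<le> ?\<sigma> / 2" "d * M < e"
    using pos e M by (auto simp: d_def min_def field_simps)
  show ?thesis
  proof (intro exI[of _ d] conjI ballI impI)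
    fix z' assume z': "z' \<in> paths T R" and lt: "pdist T R z z' < d"
    let ?s = "path_size T z'"
    have s: "\<bar>?\<sigma> - ?s\<bar> < d" using path_size_lipschitz[OF R T z z'] lt by linarith
    then have s2: "?\<sigma> / 2 \<le> ?s" using d(2) by linarith
    then show s0: "0 < ?s" using pos by linarith
    have mem: "path_rescale xbar T (\<lambda>z. path_size T z / C) y \<in> paths T R" if "y \<in> paths T R" for y
      unfolding path_rescale_eq_scale using C path_size_ge_0 that by (intro path_scale_mem[OF R]) auto
    let ?k = "1 / (?\<sigma> / C)" and ?k' = "1 / (?s / C)"
    have k: "0 \<le> ?k" "0 \<le> ?k'" using pos s0 C by auto
    have k': "?k' \<le> 2 * C / ?\<sigma>"
      using s2 pos s0 C by (simp add: field_simps)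
    have "?k' - ?k = C * (?\<sigma> - ?s) / (?s * ?\<sigma>)" using pos s0 by (simp add: field_simps)
    then have "\<bar>?k' - ?k\<bar> = C * \<bar>?\<sigma> - ?s\<bar> / (?s * ?\<sigma>)" using pos s0 C by (simp add: abs_mult)
    also have "\<dots> \<le> C * d / ((?\<sigma> / 2) * ?\<sigma>)"
      using s s2 pos C d(1) by (intro frac_le mult_left_mono mult_right_mono) auto
    also have "\<dots> = d * (2 * C / ?\<sigma>\<^sup>2)" using pos by (simp add: power2_eq_square field_simps)
    finally have kk: "\<bar>?k' - ?k\<bar> \<le> d * (2 * C / ?\<sigma>\<^sup>2)" .
    have "pdist T R (path_rescale xbar T (\<lambda>z. path_size T z / C) z') (path_rescale xbar T (\<lambda>z. path_size T z / C) z) \<le> d * M"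
    proof (subst mdist_path_space_le)
      show "\<forall>t\<in>{0..T}. cdist R (path_rescale xbar T (\<lambda>z. path_size T z / C) z' t) (path_rescale xbar T (\<lambda>z. path_size T z / C) z t) \<le> d * M"
      proof
        fix t assume t: "t \<in> {0..T}"
        have "cdist R (z' t) (z t) \<le> d"
          using cone_dist_path_le[OF R z z' t] lt cone_dist_commute[OF R, of "z t" "z' t"] by linarith
        then have "?k' * cdist R (z' t) (z t) + \<bar>?k' - ?k\<bar> * cone_r (z t) \<le>
            (2 * C / ?\<sigma>) * d + (d * (2 * C / ?\<sigma>\<^sup>2)) * B"
          using k k' kk B[OF t] cone_r_ge_0[of "z t"] cone_dist_ge_0[OF R] d(1) C pos
          by (intro add_mono mult_mono) auto
        also have "\<dots> = d * M" by (simp add: M_def algebra_simps)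
        finally show "cdist R (path_rescale xbar T (\<lambda>z. path_size T z / C) z' t) (path_rescale xbar T (\<lambda>z. path_size T z / C) z t) \<le> d * M"
          unfolding path_rescale_eq_scale using path_scale_dist[OF R k(2) k(1) t t, of xbar z' z] by linarith
      qed
    qed (use R T mem z z' in auto)
    also have "\<dots> < e" by (rule d)
    finally show "pdist T R (path_rescale xbar T (\<lambda>z. path_size T z / C) z) (path_rescale xbar T (\<lambda>z. path_size T z / C) z') < e"
      by (simp add: P.commute)
  qed (rule d)
qed

text \<open>On the open set of paths of positive size the map is continuous; on the rest it is
  constant.\<close>

lemma measurable_path_rescale:
  assumes R: "0 < R" and T: "0 < T" and C: "0 < C"
  shows "path_rescale xbar T (\<lambda>z. path_size T z / C) \<in> measurable (path_borel T R) (path_borel T R)"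
proof (rule measurable_path_borelI)
  interpret P: Metric_space "paths T R" "pdist T R"
    by (rule Metric_space_mspace_mdist)
  let ?f = "path_rescale xbar T (\<lambda>z. path_size T z / C)"
  have mem: "?f y \<in> paths T R" if "y \<in> paths T R" for y
    unfolding path_rescale_eq_scale using C path_size_ge_0 that by (intro path_scale_mem[OF R]) auto
  then show "?f z \<in> paths T R" if "z \<in> space (path_borel T R)" for z
    using that by simp
  fix U assume U: "openin (path_topology T R) U"
  note [measurable] = measurable_path_size[OF R T]
  let ?V = "{z \<in> paths T R. 0 < path_size T z \<and> ?f z \<in> U}"
  have U': "\<And>z. z \<in> U \<Longrightarrow> \<exists>r>0. P.mball z r \<subseteq> U"
    using U by (auto simp: mtopology_of_def P.openin_mtopology)
  have "openin P.mtopology ?V"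
    unfolding P.openin_mtopology
  proof (intro conjI allI impI)
    show "?V \<subseteq> paths T R" by auto
    fix z assume "z \<in> ?V"
    then have z: "z \<in> paths T R" "0 < path_size T z" "?f z \<in> U" by auto
    obtain r where r: "0 < r" "P.mball (?f z) r \<subseteq> U" using U'[OF z(3)] by blast
    obtain d where d: "0 < d" "\<And>z'. z' \<in> paths T R \<Longrightarrow> pdist T R z z' < d \<Longrightarrow>
        0 < path_size T z' \<and> pdist T R (?f z) (?f z') < r"
      using continuous_path_rescale[OF R T C z(1,2) r(1)] by blast
    have "P.mball z d \<subseteq> ?V"
    proof
      fix z' assume "z' \<in> P.mball z d"
      then have z': "z' \<in> paths T R" "pdist T R z z' < d" by (auto simp: P.in_mball)
      then have "?f z' \<in> P.mball (?f z) r" using d(2)[OF z'] mem z(1) by (auto simp: P.in_mball)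
      then show "z' \<in> ?V" using r(2) d(2)[OF z'] z' by auto
    qed
    then show "\<exists>r>0. P.mball z r \<subseteq> ?V" using d(1) by blast
  qed
  then have V: "?V \<in> sets (path_borel T R)" by (intro openin_path_borel) (simp add: mtopology_of_def)
  let ?o = "\<lambda>t\<in>{0..T}. cone_pt xbar 0"
  \<comment> \<open>Division by zero gives radius 0, so a path of size 0 is sent to the constant
    path at the apex.\<close>
  have "?f z = ?o" if "\<not> 0 < path_size T z" for z
    using that path_size_ge_0[of T z] by (auto simp: path_rescale_def fun_eq_iff intro: cone_pt_radius_0)
  then have "z \<in> ?f -` U \<inter> space (path_borel T R) \<longleftrightarrow>
     z \<in> ?V \<union> {z \<in> space (path_borel T R). \<not> 0 < path_size T z \<and> ?o \<in> U}" for z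
    by (cases "0 < path_size T z") auto
  then have "?f -` U \<inter> space (path_borel T R) =
     ?V \<union> {z \<in> space (path_borel T R). \<not> 0 < path_size T z \<and> ?o \<in> U}"
    by (rule set_eqI)
  moreover have "{z \<in> space (path_borel T R). \<not> 0 < path_size T z \<and> ?o \<in> U} \<in> sets (path_borel T R)"
    by measurable
  ultimately show "?f -` U \<inter> space (path_borel T R) \<in> sets (path_borel T R)"
    using V by simp
qed

lemma path_rescale_fpath_aux:
  assumes "\<And>t. 0 < \<rho> t" "0 < \<theta> z" "z = (\<lambda>t\<in>{0..T}. cone_pt (x t) (\<rho> t))"
  shows "path_rescale xbar T \<theta> z = (\<lambda>t\<in>{0..T}. cone_pt (x t) (\<rho> t / \<theta> z))"
  unfolding path_rescale_def using assms(1,2) by (auto simp: assms(3) fun_eq_iff less_imp_le)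

section \<open>Splitting of the particles into two populations\<close>

context striped_torus
begin

text \<open>\<open>spread1\<close> and \<open>spread0\<close> turn a label \<open>u\<close>, uniform
  on the square, into an initial position in the thick or thin part of the same cell. A particle can
  thus be compared with the limit path that starts at its label.\<close>

definition spread1 :: "real \<times> real \<Rightarrow> real \<times> real" where
  "spread1 u = (stretch ell 0 (1 - \<epsilon>) (fst u), snd u)"

definition spread0 :: "real \<times> real \<Rightarrow> real \<times> real" where
  "spread0 u = (stretch ell (1 - \<epsilon>) 1 (fst u), snd u)"

lemma measurable_spread [measurable]: "spread1 \<in> borel_measurable borel" "spread0 \<in> borel_measurable borel"
  unfolding spread1_def spread0_def by measurable

lemma measurable_fpath [measurable]: "radius \<rho> \<Longrightarrow> fpath \<rho> \<in> measurable borel (path_borel T R)"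
  by (rule continuous_path_measurable[OF continuous_fpath])

lemma measurable_jpath [measurable]: "jpath \<in> measurable borel (path_borel T R)"
  unfolding jpath_def
  by (intro measurable_If measurable_fpath radius_rad rad_consts) (use open_thick in simp)

definition rescaled :: "(real \<Rightarrow> torus cone) measure" where
  "rescaled = half_sum (push T R (\<lambda>u. fpath (rad 2 0) (spread1 u)))
     (push T R (\<lambda>u. fpath (rad 2 (pi / 2)) (spread0 u)))"

lemma path_size_fpath:
  assumes "\<And>t. 0 \<le> \<rho> t"
  shows "path_size T (fpath \<rho> u) = max (\<rho> 0) (\<rho> (T / 2))"
  using assms T by (simp add: path_size_def fpath_def)

lemma mass_values: "mass 0 0 = 1 - \<epsilon>" "mass 0 (T / 2) = \<epsilon>" "mass (pi / 2) 0 = \<epsilon>" "mass (pi / 2) (T / 2) = 1 - \<epsilon>"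
  using T by (simp_all add: mass_def wave_def)

lemma path_size_jpath: "path_size T (jpath u) = (if u \<in> thick then 1 else sqrt ((1 - \<epsilon>) / \<epsilon>))"
proof -
  have nn: "0 \<le> rad (1 / (1 - \<epsilon>)) 0 t" "0 \<le> rad (1 / \<epsilon>) (pi / 2) t" for t
    using rad_pos rad_consts less_imp_le by blast+
  have "rad (1 / (1 - \<epsilon>)) 0 0 = 1" "rad (1 / (1 - \<epsilon>)) 0 (T / 2) \<le> 1"
    "rad (1 / \<epsilon>) (pi / 2) 0 = 1" "rad (1 / \<epsilon>) (pi / 2) (T / 2) = sqrt ((1 - \<epsilon>) / \<epsilon>)" "1 \<le> sqrt ((1 - \<epsilon>) / \<epsilon>)"
    using eps by (simp_all add: rad_def mass_values)
  then show ?thesis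
    using nn by (simp add: jpath_def path_size_fpath)
qed

lemma thick_iff_AE: "AE u in square_measure. u \<in> thick \<longleftrightarrow> frac (fst u / ell) \<in> {0..<1 - \<epsilon>}"
  and thin_iff_AE: "AE u in square_measure. u \<notin> thick \<longleftrightarrow> frac (fst u / ell) \<in> {1 - \<epsilon>..<1}"
proof -
  have 1: "AE u in square_measure. frac (fst u / ell) \<noteq> 0"
    using AE_regular by eventually_elim (auto simp: kinks_def)
  show "AE u in square_measure. u \<in> thick \<longleftrightarrow> frac (fst u / ell) \<in> {0..<1 - \<epsilon>}"
    using 1
  proof eventually_elim
    case (elim u)
    then show ?case
      using frac_ge_0[of "fst u / ell"]
      unfolding thick_def mem_Collect_eq atLeastLessThan_iff by linarith
  qed
  show "AE u in square_measure. u \<notin> thick \<longleftrightarrow> frac (fst u / ell) \<in> {1 - \<epsilon>..<1}"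
    using 1
  proof eventually_elim
    case (elim u)
    then show ?case
      using frac_ge_0[of "fst u / ell"] frac_lt_1[of "fst u / ell"]
      unfolding thick_def mem_Collect_eq atLeastLessThan_iff by linarith
  qed
qed

text \<open>Each type of particles is spread uniformly over the torus by an affine change of variables
  on every cell.\<close>

lemma nn_integral_thick_thin:
  assumes [measurable]: "F \<in> borel_measurable borel" "G \<in> borel_measurable borel"
  shows "(\<integral>\<^sup>+u. (if u \<in> thick then F u else G u) \<partial>square_measure) =
    ennreal (1 - \<epsilon>) * (\<integral>\<^sup>+u. F (spread1 u) \<partial>square_measure) + ennreal \<epsilon> * (\<integral>\<^sup>+u. G (spread0 u) \<partial>square_measure)"
proof -
  have "(\<integral>\<^sup>+u. (if u \<in> thick then F u else G u) \<partial>square_measure) =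
     (\<integral>\<^sup>+u. indicator {0..<1 - \<epsilon>} (frac (fst u / ell)) * F u + indicator {1 - \<epsilon>..<1} (frac (fst u / ell)) * G u \<partial>square_measure)"
  proof (rule nn_integral_cong_AE)
    show "AE u in square_measure. (if u \<in> thick then F u else G u) =
        indicator {0..<1 - \<epsilon>} (frac (fst u / ell)) * F u + indicator {1 - \<epsilon>..<1} (frac (fst u / ell)) * G u"
      using thick_iff_AE thin_iff_AE by eventually_elim (auto simp: indicator_def)
  qed
  also have "\<dots> = (\<integral>\<^sup>+u. indicator {0..<1 - \<epsilon>} (frac (fst u / ell)) * F u \<partial>square_measure) +
     (\<integral>\<^sup>+u. indicator {1 - \<epsilon>..<1} (frac (fst u / ell)) * G u \<partial>square_measure)"
    by (intro nn_integral_add) measurable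
  also have "(\<integral>\<^sup>+u. indicator {0..<1 - \<epsilon>} (frac (fst u / ell)) * F u \<partial>square_measure) =
      ennreal (1 - \<epsilon> - 0) * (\<integral>\<^sup>+u. F (spread1 u) \<partial>square_measure)"
    unfolding spread1_def using eps by (intro nn_integral_square_stretch[OF _ N ell_def]) auto
  also have "(\<integral>\<^sup>+u. indicator {1 - \<epsilon>..<1} (frac (fst u / ell)) * G u \<partial>square_measure) =
      ennreal (1 - (1 - \<epsilon>)) * (\<integral>\<^sup>+u. G (spread0 u) \<partial>square_measure)"
    unfolding spread0_def using eps by (intro nn_integral_square_stretch[OF _ N ell_def]) auto
  finally show ?thesis by simp
qed

text \<open>Weighted by the squared size, both populations have mass \<open>1 - \<epsilon>\<close>:
  one as \<open>(1 - \<epsilon>) * 1\<close>, the other as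
  \<open>\<epsilon> * ((1 - \<epsilon>) / \<epsilon>)\<close>. After normalisation each has mass
  1/2, and both radii acquire the constant 2.\<close>

lemma rescales_to_rescaled:
  "rescales_to xbar T R (flow_measure T R flow (sqrt_jac flow)) rescaled"
proof -
  let ?\<mu> = "push T R jpath"
  \<comment> \<open>The norm of \<open>path_size\<close> for the measure of the flow, the sum of the
    two equal contributions.\<close>
  let ?C = "sqrt (2 * (1 - \<epsilon>))"
  let ?\<theta> = "\<lambda>z. path_size T z / ?C"
  note [measurable] = measurable_path_size[OF R T] measurable_path_rescale[OF R T]
  have jm [measurable]: "jpath \<in> measurable square_measure (path_borel T R)"
    by (simp cong: measurable_cong_sets)
  have C: "0 < ?C" using eps by simp
  have e1: "0 < (1 - \<epsilon>) / \<epsilon>" using eps by simp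
  have size_pos: "0 < path_size T (jpath u)" for u
    using e1 by (simp add: path_size_jpath)
  have nn: "(\<integral>\<^sup>+z. ennreal ((path_size T z)\<^sup>2) \<partial>?\<mu>) = ennreal (2 * (1 - \<epsilon>))"
  proof -
    have "(\<integral>\<^sup>+z. ennreal ((path_size T z)\<^sup>2) \<partial>?\<mu>) = (\<integral>\<^sup>+u. (if u \<in> thick then 1 else ennreal ((1 - \<epsilon>) / \<epsilon>)) \<partial>square_measure)"
      using e1 by (subst nn_integral_distr) (auto simp: path_size_jpath intro!: nn_integral_cong)
    also have "\<dots> = ennreal (1 - \<epsilon>) * 1 + ennreal \<epsilon> * ennreal ((1 - \<epsilon>) / \<epsilon>)"
      by (subst nn_integral_thick_thin) (auto simp: prob_space_square_measure)
    also have "\<dots> = ennreal (2 * (1 - \<epsilon>))"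
      using eps by (simp add: ennreal_mult[symmetric] ennreal_plus[symmetric] del: ennreal_plus)
    finally show ?thesis .
  qed
  have int: "integrable ?\<mu> (\<lambda>z. (path_size T z)\<^sup>2)"
    by (rule integrableI_nn_integral_finite[OF _ _ nn]) (use eps in auto)
  have "(\<integral>z. (path_size T z)\<^sup>2 \<partial>?\<mu>) = 2 * (1 - \<epsilon>)"
    by (rule integral_eq_nn_integral[THEN trans]) (use eps nn in auto)
  then have dil: "dilation xbar T R (\<lambda>z. path_size T z / sqrt (\<integral>z. (path_size T z)\<^sup>2 \<partial>?\<mu>)) ?\<mu> = dilation xbar T R ?\<theta> ?\<mu>"
    by simp
  have pos: "AE z in ?\<mu>. 0 < path_size T z"
  proof (subst AE_distr_iff)
    show "{z \<in> space (path_borel T R). 0 < path_size T z} \<in> sets (path_borel T R)" by measurable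
  qed (use size_pos in auto)
  have resc: "path_rescale xbar T ?\<theta> (jpath u) = (if u \<in> thick then fpath (rad 2 0) u else fpath (rad 2 (pi / 2)) u)" for u
  proof -
    have \<theta>: "0 < ?\<theta> (jpath u)" using size_pos C by simp
    show ?thesis
    proof (cases "u \<in> thick")
      case True
      have "rad (1 / (1 - \<epsilon>)) 0 t / ?\<theta> (jpath u) = rad 2 0 t" for t
      proof -
        have "(?\<theta> (jpath u))\<^sup>2 = 1 / (2 * (1 - \<epsilon>))" using True eps by (simp add: path_size_jpath power_divide)
        then have "1 / (1 - \<epsilon>) / (?\<theta> (jpath u))\<^sup>2 = 2" using eps by (simp add: field_simps)
        then show ?thesis using rad_scale[OF rad_consts(1) \<theta>] by simp
      qed
      then show ?thesis
        using True path_rescale_fpath_aux[where \<rho> = "rad (1 / (1 - \<epsilon>)) 0" and \<theta> = ?\<theta> and z = "jpath u" and x = "\<lambda>t. skew (pos t u)" and T = T]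
          rad_pos[OF rad_consts(1)] \<theta>
        by (simp add: jpath_def fpath_def)
    next
      case False
      have "rad (1 / \<epsilon>) (pi / 2) t / ?\<theta> (jpath u) = rad 2 (pi / 2) t" for t
      proof -
        have "(?\<theta> (jpath u))\<^sup>2 = 1 / (2 * \<epsilon>)"
          using False eps e1 by (simp add: path_size_jpath power_divide) (simp add: field_simps)
        then have "1 / \<epsilon> / (?\<theta> (jpath u))\<^sup>2 = 2" using eps by simp
        then show ?thesis using rad_scale[OF rad_consts(2) \<theta>] by simp
      qed
      then show ?thesis
        using False path_rescale_fpath_aux[where \<rho> = "rad (1 / \<epsilon>) (pi / 2)" and \<theta> = ?\<theta> and z = "jpath u" and x = "\<lambda>t. skew (pos t u)" and T = T]
          rad_pos[OF rad_consts(2)] \<theta>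
        by (simp add: jpath_def fpath_def)
    qed
  qed
  have "dilation xbar T R ?\<theta> ?\<mu> = rescaled"
  proof (rule measure_eqI)
    show "sets (dilation xbar T R ?\<theta> ?\<mu>) = sets rescaled" by (simp add: dilation_def rescaled_def)
    fix A assume "A \<in> sets (dilation xbar T R ?\<theta> ?\<mu>)"
    then have A [measurable]: "A \<in> sets (path_borel T R)" by (simp add: dilation_def)
    have m1 [measurable]: "fpath (rad 2 \<beta>) \<in> measurable borel (path_borel T R)" for \<beta>
      by (intro measurable_fpath radius_rad) simp
    let ?F = "\<lambda>u. indicator A (fpath (rad 2 0) u) :: ennreal" and ?G = "\<lambda>u. indicator A (fpath (rad 2 (pi / 2)) u) :: ennreal"
    have "emeasure (dilation xbar T R ?\<theta> ?\<mu>) A =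
       emeasure (density ?\<mu> (\<lambda>z. ennreal ((?\<theta> z)\<^sup>2))) (path_rescale xbar T ?\<theta> -` A \<inter> space (path_borel T R))"
      unfolding dilation_def using measurable_path_rescale[OF R T C] by (subst emeasure_distr) (auto cong: measurable_cong_sets)
    also have "\<dots> = (\<integral>\<^sup>+z. ennreal ((?\<theta> z)\<^sup>2) * indicator (path_rescale xbar T ?\<theta> -` A \<inter> space (path_borel T R)) z \<partial>?\<mu>)"
      using measurable_sets[OF measurable_path_rescale[OF R T C] A] by (subst emeasure_density) auto
    also have "\<dots> = (\<integral>\<^sup>+u. ennreal ((?\<theta> (jpath u))\<^sup>2) * indicator (path_rescale xbar T ?\<theta> -` A \<inter> space (path_borel T R)) (jpath u) \<partial>square_measure)"
      using measurable_sets[OF measurable_path_rescale[OF R T C] A] by (subst nn_integral_distr) auto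
    also have "\<dots> = (\<integral>\<^sup>+u. (if u \<in> thick then ennreal (1 / (2 * (1 - \<epsilon>))) * ?F u else ennreal (1 / (2 * \<epsilon>)) * ?G u) \<partial>square_measure)"
    proof (intro nn_integral_cong)
      fix u
      have "jpath u \<in> space (path_borel T R)" using measurable_space[OF jm, of u] by simp
      then have "indicator (path_rescale xbar T ?\<theta> -` A \<inter> space (path_borel T R)) (jpath u) =
          (indicator A (path_rescale xbar T ?\<theta> (jpath u)) :: ennreal)"
        by (simp add: indicator_def)
      also have "\<dots> = (if u \<in> thick then ?F u else ?G u)" unfolding resc by simp
      finally have "indicator (path_rescale xbar T ?\<theta> -` A \<inter> space (path_borel T R)) (jpath u) = (if u \<in> thick then ?F u else ?G u)" .
      moreover have "(?\<theta> (jpath u))\<^sup>2 = (if u \<in> thick then 1 / (2 * (1 - \<epsilon>)) else 1 / (2 * \<epsilon>))"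
        using eps e1 by (simp add: path_size_jpath power_divide) (simp add: field_simps)
      ultimately show "ennreal ((?\<theta> (jpath u))\<^sup>2) * indicator (path_rescale xbar T ?\<theta> -` A \<inter> space (path_borel T R)) (jpath u) =
         (if u \<in> thick then ennreal (1 / (2 * (1 - \<epsilon>))) * ?F u else ennreal (1 / (2 * \<epsilon>)) * ?G u)"
        by (simp only: if_distrib[of ennreal] split: if_split) simp
    qed
    also have "\<dots> = ennreal (1 - \<epsilon>) * (\<integral>\<^sup>+u. ennreal (1 / (2 * (1 - \<epsilon>))) * ?F (spread1 u) \<partial>square_measure) +
        ennreal \<epsilon> * (\<integral>\<^sup>+u. ennreal (1 / (2 * \<epsilon>)) * ?G (spread0 u) \<partial>square_measure)"
      by (rule nn_integral_thick_thin) measurable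
    also have "\<dots> = ennreal (1 / 2) * (\<integral>\<^sup>+u. ?F (spread1 u) \<partial>square_measure) + ennreal (1 / 2) * (\<integral>\<^sup>+u. ?G (spread0 u) \<partial>square_measure)"
    proof -
      have "ennreal (1 - \<epsilon>) * ennreal (1 / (2 * (1 - \<epsilon>))) = ennreal (1 / 2)" "ennreal \<epsilon> * ennreal (1 / (2 * \<epsilon>)) = ennreal (1 / 2)"
        using eps by (auto simp: ennreal_mult[symmetric] simp del: ennreal_half)
      then show ?thesis by (simp add: nn_integral_cmult mult.assoc[symmetric])
    qed
    also have "\<dots> = ((\<integral>\<^sup>+u. ?F (spread1 u) \<partial>square_measure) + (\<integral>\<^sup>+u. ?G (spread0 u) \<partial>square_measure)) / 2"
      by (simp add: divide_ennreal_def distrib_left mult.commute)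
    also have "\<dots> = emeasure rescaled A"
    proof -
      have "(\<integral>\<^sup>+u. ?F (spread1 u) \<partial>square_measure) = emeasure (push T R (\<lambda>u. fpath (rad 2 0) (spread1 u))) A"
        "(\<integral>\<^sup>+u. ?G (spread0 u) \<partial>square_measure) = emeasure (push T R (\<lambda>u. fpath (rad 2 (pi / 2)) (spread0 u))) A"
        by (subst nn_integral_indicator[symmetric], simp, subst nn_integral_distr, auto)+
      then show ?thesis unfolding rescaled_def using A by (subst emeasure_half_sum) auto
    qed
    finally show "emeasure (dilation xbar T R ?\<theta> ?\<mu>) A = emeasure rescaled A" .
  qed
  then have "rescaled = dilation xbar T R (\<lambda>z. path_size T z / sqrt (\<integral>z. (path_size T z)\<^sup>2 \<partial>?\<mu>)) ?\<mu>"
    by (simp only: dil)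
  then show ?thesis
    unfolding rescales_to_def flow_measure_flow
    by (intro bexI[of _ "path_size T"] conjI one_homogeneous_path_size T pos int measurable_path_size R) 
qed

end

section \<open>The limit flow\<close>

text \<open>Both halves of the limit are instances of \<open>step_path\<close>: with \<open>(c, \<beta>) = (T, \<pi> / 2)\<close> for the first one,
  which never turns before the final time, and \<open>(c, \<beta>) = (T / 2, 0)\<close> for the second one. The turn
  happens at the apex of the cone.\<close>

definition step_angle :: "real \<Rightarrow> real \<Rightarrow> real" where
  "step_angle c t = (if t \<le> c then 0 else pi)"

definition step_path :: "real \<Rightarrow> real \<Rightarrow> real \<Rightarrow> real \<times> real \<Rightarrow> real \<Rightarrow> torus cone" where
  "step_path T c \<beta> u = (\<lambda>t\<in>{0..T}. cone_pt (skew (fst u, snd u + step_angle c t)) (sqrt 2 * \<bar>wave T \<beta> t\<bar>))"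

lemma wave_le_1: "\<bar>wave T \<beta> t\<bar> \<le> 1"
  by (simp add: wave_def)

text \<open>On one side of \<open>c\<close> only the radius changes. Across \<open>c\<close> the
  angle jumps, but both radii are at most linear in the distance to \<open>c\<close>, so the route
  through the apex is short enough.\<close>

lemma step_path_time_lipschitz:
  assumes R: "0 < R" and T: "0 < T" and c: "wave T \<beta> c = 0"
  shows "cdist R (cone_pt (skew (fst u, snd u + step_angle c s)) (sqrt 2 * \<bar>wave T \<beta> s\<bar>))
     (cone_pt (skew (fst u, snd u + step_angle c t)) (sqrt 2 * \<bar>wave T \<beta> t\<bar>)) \<le> sqrt 2 * (pi / T) * \<bar>s - t\<bar>"
    (is "?d s t \<le> _")
proof (cases "s \<le> c \<longleftrightarrow> t \<le> c")
  case True
  then have "step_angle c s = step_angle c t" by (simp add: step_angle_def)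
  then have "?d s t = \<bar>sqrt 2 * \<bar>wave T \<beta> s\<bar> - sqrt 2 * \<bar>wave T \<beta> t\<bar>\<bar>"
    using R by (simp add: cone_dist_same_point)
  also have "\<dots> = sqrt 2 * \<bar>\<bar>wave T \<beta> s\<bar> - \<bar>wave T \<beta> t\<bar>\<bar>"
    by (simp add: right_diff_distrib[symmetric] abs_mult)
  also have "\<dots> \<le> sqrt 2 * \<bar>wave T \<beta> s - wave T \<beta> t\<bar>" by (intro mult_left_mono) auto
  also have "\<dots> \<le> sqrt 2 * (pi / T * \<bar>s - t\<bar>)" by (intro mult_left_mono wave_lipschitz T) auto
  finally show ?thesis by (simp only: mult.assoc)
next
  case False
  have w: "\<bar>wave T \<beta> r\<bar> \<le> pi / T * \<bar>r - c\<bar>" for r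
    using wave_lipschitz[OF T, of \<beta> r c] c by simp
  have "?d s t \<le> sqrt 2 * \<bar>wave T \<beta> s\<bar> + sqrt 2 * \<bar>wave T \<beta> t\<bar>"
    by (rule cone_dist_le_sum) auto
  also have "\<dots> \<le> sqrt 2 * (pi / T * \<bar>s - c\<bar>) + sqrt 2 * (pi / T * \<bar>t - c\<bar>)"
    using w by (intro add_mono mult_left_mono) auto
  also have "\<dots> = sqrt 2 * (pi / T) * (\<bar>s - c\<bar> + \<bar>t - c\<bar>)" by (simp only: distrib_left mult.assoc)
  also have "\<bar>s - c\<bar> + \<bar>t - c\<bar> = \<bar>s - t\<bar>" using False by auto
  finally show ?thesis .
qed

lemma step_path_mem:
  assumes "0 < R" "0 < T" "wave T \<beta> c = 0"
  shows "step_path T c \<beta> u \<in> paths T R"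
  unfolding step_path_def by (rule lipschitz_path_mem[OF assms(1)]) (rule step_path_time_lipschitz[OF assms])

lemma continuous_step_path:
  assumes R: "0 < R" and T: "0 < T" and c: "wave T \<beta> c = 0"
  shows "continuous_map euclidean (path_topology T R) (step_path T c \<beta>)"
proof (rule lipschitz_continuous_map_path)
  show "step_path T c \<beta> u \<in> paths T R" for u by (rule step_path_mem[OF assms])
  fix u v :: "real \<times> real"
  have "cdist R (step_path T c \<beta> u t) (step_path T c \<beta> v t) \<le> (sqrt 2 * (2 + R)) * dist u v"
    if t: "t \<in> {0..T}" for t
  proof -
    let ?x = "skew (fst u, snd u + step_angle c t)" and ?y = "skew (fst v, snd v + step_angle c t)"
    have d: "\<bar>fst v - fst u\<bar> \<le> dist u v" "\<bar>snd v - snd u\<bar> \<le> dist u v"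
      using dist_fst_le[of u v] dist_snd_le[of u v] by (auto simp: dist_real_def)
    have "torus_dist R ?x ?y \<le> \<bar>fst v - fst u\<bar> + (1 + R) * \<bar>snd v - snd u\<bar>"
      using torus_dist_skew_le[OF R, of "(fst u, snd u + step_angle c t)" "(fst v, snd v + step_angle c t)"] by simp
    also have "\<dots> \<le> dist u v + (1 + R) * dist u v"
      using R d by (intro add_mono mult_left_mono) auto
    finally have td: "torus_dist R ?x ?y \<le> (2 + R) * dist u v" by (simp add: algebra_simps)
    have "cdist R (step_path T c \<beta> u t) (step_path T c \<beta> v t) \<le> sqrt 2 * \<bar>wave T \<beta> t\<bar> * torus_dist R ?x ?y"
      using t torus_dist_ge_0 by (simp add: step_path_def cone_dist_same_radius)
    also have "\<dots> \<le> sqrt 2 * 1 * ((2 + R) * dist u v)"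
      using td torus_dist_ge_0 wave_le_1 by (intro mult_mono) auto
    finally show ?thesis by (simp add: mult.assoc)
  qed
  then show "pdist T R (step_path T c \<beta> u) (step_path T c \<beta> v) \<le> (sqrt 2 * (2 + R)) * dist u v"
    using T R step_path_mem[OF assms] by (subst mdist_path_space_le) auto
qed

lemma step_path_action:
  assumes R: "0 < R" and T: "0 < T" and c: "wave T \<beta> c = 0"
    and F: "finite F" "c \<in> F" "\<And>t. t \<in> {0..T} - F \<Longrightarrow> wave T \<beta> t \<noteq> 0"
  shows "path_action xbar T R (step_path T c \<beta> u) = (\<integral>\<^sup>+t\<in>{0..T}. ennreal (2 * (sin (pi * t / T - \<beta>) * (pi / T))\<^sup>2) \<partial>lborel)"
proof -
  let ?x = "\<lambda>t. skew (fst u, snd u + step_angle c t)" and ?\<rho> = "\<lambda>t. sqrt 2 * \<bar>wave T \<beta> t\<bar>"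
  let ?w' = "\<lambda>t. - (sin (pi * t / T - \<beta>) * (pi / T))"
  \<comment> \<open>At zeros of the wave the value is a convention, chosen so that the square is
    given by the same formula at all times.\<close>
  let ?\<rho>' = "\<lambda>t. if wave T \<beta> t = 0 then sqrt 2 * ?w' t else sqrt 2 * (sgn (wave T \<beta> t) * ?w' t)"
  have dw: "(wave T \<beta> has_real_derivative ?w' t) (at t within {0..T})" for t
    unfolding wave_def using T by (auto intro!: derivative_eq_intros simp: field_simps)
  have "path_action xbar T R (step_path T c \<beta> u) =
     (\<integral>\<^sup>+t\<in>{0..T}. ennreal ((?\<rho> t)\<^sup>2 * (torus_norm R ((\<lambda>_. 0) t))\<^sup>2 + (?\<rho>' t)\<^sup>2) \<partial>lborel)"
    unfolding step_path_def
  proof (rule path_action_eq[where x = ?x and \<rho> = ?\<rho> and \<rho>' = ?\<rho>' and v = "\<lambda>_. 0" and L = "sqrt 2 * (pi / T)" and F = F])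
    show "cdist R (cone_pt (?x s) (?\<rho> s)) (cone_pt (?x t) (?\<rho> t)) \<le> sqrt 2 * (pi / T) * \<bar>s - t\<bar>" for s t
      by (rule step_path_time_lipschitz[OF R T c])
    fix t assume t: "t \<in> {0..T} - F"
    then have w: "wave T \<beta> t \<noteq> 0" by (rule F)
    then show "0 < ?\<rho> t" by simp
    have "t \<noteq> c" using t F(2) by auto
    then have "\<forall>\<^sub>F s in at t. step_angle c s = step_angle c t"
    proof (cases "t < c")
      case True
      then show ?thesis
        using eventually_at_topological[of "\<lambda>s. step_angle c s = step_angle c t" t UNIV]
        by (auto simp: step_angle_def intro!: exI[of _ "{..<c}"])
    next
      case False
      then show ?thesis
        using \<open>t \<noteq> c\<close> eventually_at_topological[of "\<lambda>s. step_angle c s = step_angle c t" t UNIV]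
        by (auto simp: step_angle_def intro!: exI[of _ "{c<..}"])
    qed
    then have ev: "\<forall>\<^sub>F s in at t within {0..T}. step_angle c s = step_angle c t"
      by (rule filter_leD[OF at_le[OF subset_UNIV], rotated])
    let ?U = "\<lambda>s::real. (fst u + (snd u + step_angle c t), snd u + step_angle c t)"
    show "torus_has_velocity ?x 0 t {0..T}"
      unfolding torus_has_velocity_def
    proof (intro exI[of _ ?U] conjI)
      show "torus_of (?U t) = ?x t" by (simp add: skew_def)
      show "\<forall>\<^sub>F s in at t within {0..T}. torus_of (?U s) = ?x s"
        using ev by eventually_elim (simp add: skew_def)
      show "(?U has_vector_derivative 0) (at t within {0..T})" by simp
    qed
    have "((\<lambda>t. \<bar>wave T \<beta> t\<bar>) has_real_derivative sgn (wave T \<beta> t) * ?w' t) (at t within {0..T})"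
    proof -
      have "((\<lambda>s. sgn (wave T \<beta> t) * wave T \<beta> s) has_derivative (*) (sgn (wave T \<beta> t) * ?w' t)) (at t within {0..T})"
        using DERIV_cmult[OF dw[of t], of "sgn (wave T \<beta> t)"] by (simp add: has_field_derivative_def)
      moreover have "\<forall>\<^sub>F s in at t within {0..T}. sgn (wave T \<beta> t) * wave T \<beta> s = \<bar>wave T \<beta> s\<bar>"
      proof -
        have "((\<lambda>s. sgn (wave T \<beta> t) * wave T \<beta> s) \<longlongrightarrow> sgn (wave T \<beta> t) * wave T \<beta> t) (at t within {0..T})"
          using DERIV_continuous[OF dw[of t]] by (intro tendsto_intros) (simp add: continuous_within)
        moreover have "0 < sgn (wave T \<beta> t) * wave T \<beta> t" using w by (simp add: sgn_if)
        ultimately have "\<forall>\<^sub>F s in at t within {0..T}. 0 < sgn (wave T \<beta> t) * wave T \<beta> s" by (rule order_tendstoD)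
        then show ?thesis by eventually_elim (use w in \<open>auto simp: sgn_if split: if_splits\<close>)
      qed
      moreover have "sgn (wave T \<beta> t) * wave T \<beta> t = \<bar>wave T \<beta> t\<bar>" by (simp add: sgn_if)
      ultimately have "((\<lambda>s. \<bar>wave T \<beta> s\<bar>) has_derivative (*) (sgn (wave T \<beta> t) * ?w' t)) (at t within {0..T})"
        by (rule has_derivative_transform_eventually) (use t in simp)
      then show ?thesis by (simp add: has_field_derivative_def)
    qed
    from DERIV_cmult[OF this, of "sqrt 2"] have "(?\<rho> has_real_derivative ?\<rho>' t) (at t within {0..T})"
      using w by (simp only: if_False)
    then show "(?\<rho> has_vector_derivative ?\<rho>' t) (at t within {0..T})"
      by (simp add: has_real_derivative_iff_has_vector_derivative)
  next
    show "?\<rho> \<in> borel_measurable borel" "?\<rho>' \<in> borel_measurable borel"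
      unfolding wave_def by measurable
  qed (use R T F(1) in auto)
  also have "\<dots> = (\<integral>\<^sup>+t\<in>{0..T}. ennreal (2 * (sin (pi * t / T - \<beta>) * (pi / T))\<^sup>2) \<partial>lborel)"
  proof -
    have sq: "(sqrt 2 * y)\<^sup>2 = 2 * y\<^sup>2" for y :: real by (simp add: power_mult_distrib)
    have "(?\<rho>' t)\<^sup>2 = 2 * (sin (pi * t / T - \<beta>) * (pi / T))\<^sup>2" for t
    proof (cases "wave T \<beta> t = 0")
      case True
      then show ?thesis by (simp only: if_True sq power2_minus refl)
    next
      case False
      then have "(sgn (wave T \<beta> t))\<^sup>2 = 1" by (simp add: sgn_if)
      with False show ?thesis by (simp only: if_False sq) (simp only: power_mult_distrib power2_minus mult_1_left)
    qed
    then show ?thesis by (simp add: torus_norm_def)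
  qed
  finally show ?thesis .
qed

text \<open>All paths are continuous here, so \<open>cone_path\<close> is its own Borel
  representative.\<close>

lemma flow_measure_step:
  assumes R: "0 < R" and T: "0 < T" and c: "wave T \<beta> c = 0"
    and eq: "\<And>t u. t \<in> {0..T} \<Longrightarrow> \<phi> t (skew u) = skew (fst u, snd u + step_angle c t)"
    and l: "\<And>t x. t \<in> {0..T} \<Longrightarrow> l t x = sqrt 2 * \<bar>wave T \<beta> t\<bar>"
  shows "flow_measure T R \<phi> l = push T R (step_path T c \<beta>)"
proof -
  have P: "cone_path T \<phi> l (skew u) = step_path T c \<beta> u" for u
    using eq l by (auto simp: cone_path_def step_path_def fun_eq_iff)
  have "cone_path T \<phi> l \<in> measurable torus_measure (path_borel T R)"
    using measurable_torus_path[OF continuous_step_path[OF R T c] P] by (simp cong: measurable_cong_sets)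
  then have "flow_measure T R \<phi> l = push T R (\<lambda>u. cone_path T \<phi> l (skew u))"
  proof (rule flow_measure_eq)
    have "is_cone_path T R \<phi> l x" for x
    proof -
      obtain u where "skew u = x" by (rule skew_surj)
      then have "cone_path T \<phi> l x = step_path T c \<beta> u" using P by metis
      then show ?thesis using l step_path_mem[OF R T c, of u] by (simp add: is_cone_path_def)
    qed
    then show "AE x in torus_measure. is_cone_path T R \<phi> l x \<and> cone_path T \<phi> l x = cone_path T \<phi> l x" by simp
    show "(\<lambda>t\<in>{0..T}. cone_pt x 0) \<in> paths T R" for x
      by (rule lipschitz_path_mem[OF R, of T _ 0]) (simp add: cone_dist_same_point R)
  qed
  then show ?thesis by (simp add: P)
qed

lemma wave_zeros:
  assumes "0 < T"
  shows "wave T (pi / 2) T = 0" "wave T 0 (T / 2) = 0"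
    and "\<And>t. t \<in> {0..T} - {0, T} \<Longrightarrow> wave T (pi / 2) t \<noteq> 0"
    and "\<And>t. t \<in> {0..T} - {T / 2} \<Longrightarrow> wave T 0 t \<noteq> 0"
proof -
  show "wave T (pi / 2) T = 0" "wave T 0 (T / 2) = 0" using assms by (simp_all add: wave_def cos_diff)
  show "wave T (pi / 2) t \<noteq> 0" if "t \<in> {0..T} - {0, T}" for t
  proof -
    have "0 < pi * t / T" "pi * t / T < pi" using that assms by (auto simp: field_simps)
    then show ?thesis using sin_gt_zero[of "pi * t / T"] by (simp add: wave_def cos_diff)
  qed
  show "wave T 0 t \<noteq> 0" if t: "t \<in> {0..T} - {T / 2}" for t
  proof
    assume "wave T 0 t = 0"
    then have c: "cos (pi * t / T) = cos (pi / 2)" by (simp add: wave_def)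
    have b: "0 \<le> pi * t / T" "pi * t / T \<le> pi" using t assms by (auto simp: field_simps)
    have "pi * t / T = pi / 2" by (rule cos_inj_pi[OF b _ _ c]) simp_all
    then have "pi * (t / T) = pi * (1 / 2)" by simp
    then have "t / T = 1 / 2" by (simp only: mult_cancel_left pi_neq_zero simp_thms)
    then have "t = T / 2" using assms by (simp add: divide_eq_eq)
    then show False using t by simp
  qed
qed

lemma mu_star_eq:
  assumes R: "0 < R" and T: "0 < T"
  shows "mu_star T R = half_sum (push T R (step_path T T (pi / 2)))
     (push T R (step_path T (T / 2) 0))"
proof -
  have "flow_measure T R (\<lambda>t x. x) (zeta0 T) = push T R (step_path T T (pi / 2))"
  proof (rule flow_measure_step[OF R T wave_zeros(1)[OF T]])
    fix t x assume t: "t \<in> {0..T}"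
    have "0 \<le> pi * t / T" "pi * t / T \<le> pi" using t T by (auto simp: field_simps)
    then show "zeta0 T t x = sqrt 2 * \<bar>wave T (pi / 2) t\<bar>"
      using sin_ge_zero[of "pi * t / T"] by (simp add: zeta0_def wave_def cos_diff)
  qed (simp add: step_angle_def)
  moreover have "flow_measure T R (psi1 T) (zeta1 T) = push T R (step_path T (T / 2) 0)"
    by (rule flow_measure_step[OF R T wave_zeros(2)[OF T]])
      (simp_all add: psi1_def step_angle_def half_turn_skew zeta1_def wave_def)
  ultimately show ?thesis by (simp add: mu_star_def)
qed

section \<open>Estimates\<close>

context striped_torus
begin

text \<open>The particle follows the single turn that ends at \<open>c\<close>, not an interpolation
  of the two turns.\<close>

definition clean :: "real \<Rightarrow> real \<times> real \<Rightarrow> bool" where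
  "clean c v \<longleftrightarrow> (\<forall>t. shear t (fst v) = turn c t \<and> vel_b t (fst v) = turn_rate c t)"

lemma affine_frac_bounds:
  fixes x :: real
  assumes "0 \<le> \<alpha>" "\<alpha> < \<beta>" "\<beta> \<le> 1"
  shows "0 \<le> \<alpha> + (\<beta> - \<alpha>) * frac x" "\<alpha> + (\<beta> - \<alpha>) * frac x < 1"
proof -
  define p where "p = (\<beta> - \<alpha>) * frac x"
  have "p < (\<beta> - \<alpha>) * 1"
    unfolding p_def using assms frac_lt_1[of x] by (intro mult_strict_left_mono) auto
  also have "\<dots> \<le> 1 - \<alpha>" using assms by simp
  finally have "\<alpha> + p < 1" by simp
  moreover have "0 \<le> p" unfolding p_def using assms by simp
  ultimately show "0 \<le> \<alpha> + (\<beta> - \<alpha>) * frac x" "\<alpha> + (\<beta> - \<alpha>) * frac x < 1"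
    using assms(1) by (simp_all add: p_def)
qed

lemma frac_stretch:
  assumes "0 \<le> \<alpha>" "\<alpha> < \<beta>" "\<beta> \<le> 1"
  shows "frac (stretch ell \<alpha> \<beta> a / ell) = \<alpha> + (\<beta> - \<alpha>) * frac (a / ell)"
proof -
  let ?z = "\<alpha> + (\<beta> - \<alpha>) * frac (a / ell)"
  have z: "0 \<le> ?z" "?z < 1"
    using affine_frac_bounds[OF assms, of "a / ell"] by auto
  have "stretch ell \<alpha> \<beta> a / ell = of_int \<lfloor>a / ell\<rfloor> + ?z"
    using ell_pos by (simp add: stretch_def add.assoc)
  then have "frac (stretch ell \<alpha> \<beta> a / ell) = frac ?z" by (simp only: frac_add_of_int_left)
  also have "\<dots> = ?z" using z by (simp only: frac_eq)
  finally show ?thesis .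
qed

lemma stretch_near:
  assumes "0 \<le> \<alpha>" "\<alpha> < \<beta>" "\<beta> \<le> 1"
  shows "\<bar>stretch ell \<alpha> \<beta> a - a\<bar> \<le> ell"
proof -
  let ?z = "frac (a / ell)"
  have "a = ell * (of_int \<lfloor>a / ell\<rfloor> + ?z)" using ell_pos by (simp add: frac_def)
  then have "stretch ell \<alpha> \<beta> a - a = stretch ell \<alpha> \<beta> a - ell * (of_int \<lfloor>a / ell\<rfloor> + ?z)" by simp
  also have "\<dots> = ell * ((\<alpha> + (\<beta> - \<alpha>) * ?z) - ?z)" by (simp add: stretch_def algebra_simps)
  finally have "\<bar>stretch ell \<alpha> \<beta> a - a\<bar> = ell * \<bar>(\<alpha> + (\<beta> - \<alpha>) * ?z) - ?z\<bar>" using ell_pos by (simp add: abs_mult)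
  also have "\<dots> \<le> ell * 1"
  proof (rule mult_left_mono)
    show "\<bar>(\<alpha> + (\<beta> - \<alpha>) * ?z) - ?z\<bar> \<le> 1"
      using affine_frac_bounds[OF assms, of "a / ell"] frac_ge_0[of "a / ell"] frac_lt_1[of "a / ell"] by linarith
  qed (use ell_pos in simp)
  finally show ?thesis by simp
qed

text \<open>Described in terms of labels: \<open>spread0\<close> carries these two end pieces of
  relative width \<kappa> to the ramps of width \<open>\<epsilon> * \<kappa>\<close> in the thin
  part.\<close>

definition transition :: "(real \<times> real) set" where
  "transition = {u. frac (fst u / ell) \<in> {0..<\<kappa>}} \<union> {u. frac (fst u / ell) \<in> {1 - \<kappa>..<1}}"

lemma clean_spread1: "clean (T / 2) (spread1 u)"
proof -
  have "frac (fst (spread1 u) / ell) = (1 - \<epsilon>) * frac (fst u / ell)"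
    using frac_stretch[of 0 "1 - \<epsilon>" "fst u"] eps by (simp add: spread1_def)
  also have "\<dots> \<le> (1 - \<epsilon>) * 1" using eps frac_lt_1[of "fst u / ell"] by (intro mult_left_mono) auto
  finally have "plateau (fst (spread1 u) / ell) = 0" by (intro plateau_eq(1)) simp
  then show ?thesis by (simp add: clean_def shear_def vel_b_def)
qed

lemma clean_spread0:
  assumes "u \<notin> transition"
  shows "clean T (spread0 u)"
proof -
  let ?z = "frac (fst u / ell)"
  have z: "\<kappa> \<le> ?z" "?z \<le> 1 - \<kappa>"
    using assms frac_ge_0[of "fst u / ell"] frac_lt_1[of "fst u / ell"]
    unfolding transition_def Un_iff mem_Collect_eq atLeastLessThan_iff by linarith+
  have fr: "frac (fst (spread0 u) / ell) = (1 - \<epsilon>) + \<epsilon> * ?z"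
    using frac_stretch[of "1 - \<epsilon>" 1 "fst u"] eps by (simp add: spread0_def)
  have "\<epsilon> * \<kappa> \<le> \<epsilon> * ?z" "\<epsilon> * ?z \<le> \<epsilon> * (1 - \<kappa>)" using z eps by (auto intro!: mult_left_mono)
  then have "plateau (fst (spread0 u) / ell) = 1"
    by (intro plateau_eq(3)) (simp_all add: fr algebra_simps)
  then show ?thesis by (simp add: clean_def shear_def vel_b_def)
qed

lemma transition_sets [measurable]: "transition \<in> sets borel"
  and emeasure_transition: "emeasure square_measure transition \<le> ennreal (2 * \<kappa>)"
proof -
  let ?A = "{u :: real \<times> real. frac (fst u / ell) \<in> {0..<\<kappa>}}" and ?B = "{u :: real \<times> real. frac (fst u / ell) \<in> {1 - \<kappa>..<1}}"
  have [measurable]: "?A \<in> sets borel" "?B \<in> sets borel"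
    using measurable_sets[of "\<lambda>u :: real \<times> real. frac (fst u / ell)" borel borel "{0..<\<kappa>}"]
      measurable_sets[of "\<lambda>u :: real \<times> real. frac (fst u / ell)" borel borel "{1 - \<kappa>..<1}"]
    by (simp_all add: vimage_def)
  show "transition \<in> sets borel" unfolding transition_def by measurable
  have "emeasure square_measure transition \<le> emeasure square_measure ?A + emeasure square_measure ?B"
    unfolding transition_def by (rule emeasure_subadditive) auto
  also have "emeasure square_measure ?A = ennreal (\<kappa> - 0)"
    using kap by (intro emeasure_square_frac[OF N ell_def]) auto
  also have "emeasure square_measure ?B = ennreal (1 - (1 - \<kappa>))"
    using kap by (intro emeasure_square_frac[OF N ell_def]) auto
  also have "ennreal (\<kappa> - 0) + ennreal (1 - (1 - \<kappa>)) = ennreal (2 * \<kappa>)"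
    using kap by (simp add: ennreal_plus[symmetric] del: ennreal_plus)
  finally show "emeasure square_measure transition \<le> ennreal (2 * \<kappa>)" .
qed

text \<open>The squares differ by at most \<open>2 * \<epsilon>\<close>, and the square root is
  subadditive.\<close>

lemma rad_near:
  "\<bar>rad 2 \<beta> t - sqrt 2 * \<bar>osc \<beta> t\<bar>\<bar> \<le> sqrt (2 * \<epsilon>)"
proof -
  have sub: "sqrt x \<le> sqrt y + sqrt z" if "0 \<le> y" "0 \<le> z" "x \<le> y + z" for x y z :: real
    using that sqrt_add_le_add_sqrt[of y z] real_sqrt_le_mono[of x "y + z"] by linarith
  have o: "sqrt 2 * \<bar>osc \<beta> t\<bar> = sqrt (2 * (osc \<beta> t)\<^sup>2)" by (simp add: real_sqrt_mult)
  have "0 \<le> (osc \<beta> t)\<^sup>2" "(osc \<beta> t)\<^sup>2 \<le> 1" using wave_le_1[of T \<beta> t] by (auto simp: abs_square_le_1)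
  then have e: "0 \<le> \<epsilon> * (osc \<beta> t)\<^sup>2" "\<epsilon> * (osc \<beta> t)\<^sup>2 \<le> \<epsilon> * 1" using eps by (auto intro!: mult_left_mono)
  have "rad 2 \<beta> t \<le> sqrt (2 * (osc \<beta> t)\<^sup>2) + sqrt (2 * \<epsilon>)"
    unfolding rad_def using eps e by (intro sub) (auto simp: mass_def algebra_simps)
  moreover have "sqrt (2 * (osc \<beta> t)\<^sup>2) \<le> rad 2 \<beta> t + sqrt (2 * \<epsilon>)"
    unfolding rad_def using eps e mass_pos[of \<beta> t] by (intro sub) (auto simp: mass_def algebra_simps)
  ultimately show ?thesis unfolding o by linarith
qed

text \<open>Within the turning window the angles may be far apart, but both radii are small and the
  route through the apex applies. Outside the window the angles \<open>b\<close> agree exactly and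
  only \<open>a\<close> and the radii differ.\<close>

lemma fpath_near_step:
  assumes c: "osc \<beta> c = 0" and cl: "clean c v" and v: "\<bar>fst v - fst u\<bar> \<le> ell" "snd v = snd u"
  shows "pdist T R (fpath (rad 2 \<beta>) v) (step_path T c \<beta> u) \<le>
    sqrt (2 * \<epsilon>) + 2 * sqrt 2 * ell + 2 * sqrt 2 * (pi / T * \<delta>)"
proof (subst mdist_path_space_le)
  let ?e = "sqrt (2 * \<epsilon>) + 2 * sqrt 2 * ell + 2 * sqrt 2 * (pi / T * \<delta>)"
  show "\<forall>t\<in>{0..T}. cdist R (fpath (rad 2 \<beta>) v t) (step_path T c \<beta> u t) \<le> ?e"
  proof
    fix t assume t: "t \<in> {0..T}"
    let ?w = "sqrt 2 * \<bar>osc \<beta> t\<bar>" and ?y = "(fst u, snd u + step_angle c t)"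
    have r0: "0 \<le> rad 2 \<beta> t" using rad_pos[of 2 \<beta> t] by simp
    have eq: "cdist R (fpath (rad 2 \<beta>) v t) (step_path T c \<beta> u t) =
       cdist R (cone_pt (skew (pos t v)) (rad 2 \<beta> t)) (cone_pt (skew ?y) ?w)"
      using t by (simp add: fpath_def step_path_def)
    show "cdist R (fpath (rad 2 \<beta>) v t) (step_path T c \<beta> u t) \<le> ?e"
    proof (cases "c - \<delta> < t \<and> t \<le> c")
      case True
      have "\<bar>osc \<beta> t\<bar> \<le> pi / T * \<bar>t - c\<bar>" using wave_lipschitz[OF T, of \<beta> t c] c by simp
      also have "\<dots> \<le> pi / T * \<delta>" using True T by (intro mult_left_mono) auto
      finally have w: "?w \<le> sqrt 2 * (pi / T * \<delta>)" by (intro mult_left_mono) auto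
      have "cdist R (fpath (rad 2 \<beta>) v t) (step_path T c \<beta> u t) \<le> rad 2 \<beta> t + ?w"
        unfolding eq using r0 by (intro cone_dist_le_sum) auto
      also have "\<dots> \<le> ?e"
      proof -
        have "0 \<le> 2 * sqrt 2 * ell" using ell_pos by simp
        moreover have "2 * sqrt 2 * (pi / T * \<delta>) = sqrt 2 * (pi / T * \<delta>) + sqrt 2 * (pi / T * \<delta>)" by simp
        ultimately show ?thesis using rad_near[of \<beta> t] w unfolding abs_le_iff by linarith
      qed
      finally show ?thesis .
    next
      case False
      then have "turn c t = step_angle c t"
        using turn_before[of t c] turn_after[of c t] by (auto simp: step_angle_def)
      then have p: "pos t v = (squeeze t (fst v), snd u + step_angle c t)"
        using cl v by (simp add: pos_def clean_def)
      have "torus_dist R (skew (pos t v)) (skew ?y) \<le> \<bar>fst u - squeeze t (fst v)\<bar>"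
        using torus_dist_skew_le[OF R, of "pos t v" ?y] by (simp add: p)
      \<comment> \<open>One \<open>ell\<close> comes from placing the label in its part of the cell,
        the other from the squeezing.\<close>
      also have "\<dots> \<le> 2 * ell" using squeeze_near[of t "fst v"] v(1) by linarith
      finally have d: "torus_dist R (skew (pos t v)) (skew ?y) \<le> 2 * ell" .
      have "cdist R (fpath (rad 2 \<beta>) v t) (step_path T c \<beta> u t) \<le>
          \<bar>rad 2 \<beta> t - ?w\<bar> + ?w * torus_dist R (skew (pos t v)) (skew ?y)"
        unfolding eq using r0 by (intro cone_dist_le[OF R]) auto
      also have "\<dots> \<le> sqrt (2 * \<epsilon>) + (sqrt 2 * 1) * (2 * ell)"
        using d torus_dist_ge_0 wave_le_1 by (intro add_mono rad_near mult_mono) auto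
      also have "\<dots> \<le> ?e" using T del by simp
      finally show ?thesis .
    qed
  qed
qed (use T R c fpath_mem radius_rad step_path_mem in auto)

lemma rad_action_lower:
  "(\<integral>\<^sup>+t\<in>{0..T}. ennreal ((rad_rate 2 \<beta> t)\<^sup>2) \<partial>lborel) \<le> path_action xbar T R (fpath (rad 2 \<beta>) u)"
proof -
  have "path_action xbar T R (fpath (rad 2 \<beta>) u) =
    (\<integral>\<^sup>+t\<in>{0..T}. ennreal ((rad 2 \<beta> t)\<^sup>2 * (torus_norm R (vel t (fst u)))\<^sup>2 + (rad_rate 2 \<beta> t)\<^sup>2) \<partial>lborel)"
    by (rule fpath_action) (auto intro!: radius_rad rad_pos rad_derivative)
  then show ?thesis
    by (simp only:) (intro nn_integral_mono mult_right_mono ennreal_leI, auto)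
qed

lemma vel_norm_le: "(torus_norm R (vel t a))\<^sup>2 \<le> 2 * (vel_a t a)\<^sup>2 + (2 + R\<^sup>2) * (vel_b t a)\<^sup>2"
proof -
  have "(torus_norm R (vel t a))\<^sup>2 = (vel_a t a + vel_b t a)\<^sup>2 + R\<^sup>2 * (vel_b t a)\<^sup>2"
    by (simp add: torus_norm_def vel_def)
  moreover have "(vel_a t a + vel_b t a)\<^sup>2 \<le> 2 * (vel_a t a)\<^sup>2 + 2 * (vel_b t a)\<^sup>2"
    using zero_le_power2[of "vel_a t a - vel_b t a"] by (simp add: power2_eq_square algebra_simps)
  ultimately show ?thesis by (simp add: algebra_simps)
qed

lemma vel_a_le: "(vel_a t a)\<^sup>2 \<le> (2 * pi / T * ell)\<^sup>2"
proof -
  have "\<bar>sin (pi * t / T)\<bar> * \<bar>cos (pi * t / T)\<bar> \<le> 1 * 1" by (intro mult_mono) auto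
  then have "(1 - 2 * \<epsilon>) * (\<bar>sin (pi * t / T)\<bar> * \<bar>cos (pi * t / T)\<bar>) \<le> 1 * 1"
    using eps by (intro mult_mono) auto
  then have "(1 - 2 * \<epsilon>) * (\<bar>sin (pi * t / T)\<bar> * \<bar>cos (pi * t / T)\<bar>) * (2 * pi / T) \<le> 1 * (2 * pi / T)"
    using T by (intro mult_right_mono) auto
  moreover have "\<bar>gain_rate t\<bar> = (1 - 2 * \<epsilon>) * (\<bar>sin (pi * t / T)\<bar> * \<bar>cos (pi * t / T)\<bar>) * (2 * pi / T)"
    using eps T by (simp add: gain_rate_def abs_mult)
  ultimately have g: "\<bar>gain_rate t\<bar> \<le> 2 * pi / T" by simp
  have "\<bar>vel_a t a\<bar> = ell * \<bar>gain_rate t\<bar> * tent (a / ell)"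
    using ell_pos tent_bounds[of "a / ell"] by (simp add: vel_a_def abs_mult)
  also have "\<dots> \<le> ell * (2 * pi / T) * 1"
    using ell_pos tent_bounds[of "a / ell"] g T by (intro mult_mono) auto
  finally have "\<bar>vel_a t a\<bar> \<le> \<bar>2 * pi / T * ell\<bar>" using ell_pos T by (simp add: mult_ac)
  then show ?thesis by (simp only: abs_le_square_iff)
qed

lemma vel_b_le: "(vel_b t a)\<^sup>2 \<le> (pi / \<delta>)\<^sup>2"
proof -
  let ?p = "plateau (a / ell)"
  have r: "0 \<le> turn_rate c t" "turn_rate c t \<le> pi / \<delta>" for c using del by (auto simp: turn_rate_def)
  have "vel_b t a = (1 - ?p) * turn_rate (T / 2) t + ?p * turn_rate T t" by (simp add: vel_b_def algebra_simps)
  moreover have "0 \<le> \<dots>" using plateau_bounds[of "a / ell"] r by simp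
  moreover have "(1 - ?p) * turn_rate (T / 2) t + ?p * turn_rate T t \<le> (1 - ?p) * (pi / \<delta>) + ?p * (pi / \<delta>)"
    using plateau_bounds[of "a / ell"] r by (intro add_mono mult_left_mono) auto
  ultimately have "0 \<le> vel_b t a" "vel_b t a \<le> pi / \<delta>" by (simp_all add: algebra_simps)
  then show ?thesis by (rule power_mono[rotated])
qed

text \<open>The factor 4 combines the bound 2 for the squared radius with the 2 from splitting the
  square of \<open>vel_a + vel_b\<close>.\<close>

definition move_cost :: real where "move_cost = T * (4 * (2 * pi / T * ell)\<^sup>2)"
text \<open>A window of length \<delta>, in which the squared radius is at most
  \<open>2 * (\<epsilon> + (pi / T * \<delta>)\<^sup>2)\<close> and the squared speed is
  \<open>(pi / \<delta>)\<^sup>2\<close>; the weight \<open>2 + R\<^sup>2\<close> comes from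
  \<open>vel_norm_le\<close>.\<close>

definition turn_cost :: real where "turn_cost = \<delta> * (2 * (2 + R\<^sup>2) * ((\<epsilon> + (pi / T * \<delta>)\<^sup>2) * (pi / \<delta>)\<^sup>2))"
text \<open>For particles on a ramp the radius need not be small while they turn, so it is bounded
  by its global maximum during the whole time.\<close>

definition transition_cost :: real where "transition_cost = T * (2 * (2 + R\<^sup>2) * (pi / \<delta>)\<^sup>2)"

lemma rad_square_le: "(rad 2 \<beta> t)\<^sup>2 \<le> 2"
  using mass_bounds[of \<beta> t] eps by (simp add: rad_def)

text \<open>The tangential part of the action is split into the motion in \<open>a\<close>, small
  with the cells, and the turn. A clean particle turns only just before \<open>c\<close>, where the
  wave vanishes and its radius is small; for the others the crude speed bound is used at all
  times.\<close>

lemma rad_action_upper: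
  assumes c: "osc \<beta> c = 0"
  shows "path_action xbar T R (fpath (rad 2 \<beta>) v) \<le>
     (\<integral>\<^sup>+t\<in>{0..T}. ennreal ((rad_rate 2 \<beta> t)\<^sup>2) \<partial>lborel) + ennreal (move_cost + turn_cost) + (if clean c v then 0 else ennreal transition_cost)"
proof -
  let ?A = "4 * (2 * pi / T * ell)\<^sup>2" and ?K = "2 * (2 + R\<^sup>2) * ((\<epsilon> + (pi / T * \<delta>)\<^sup>2) * (pi / \<delta>)\<^sup>2)"
    and ?D = "2 * (2 + R\<^sup>2) * (pi / \<delta>)\<^sup>2"
  let ?d = "if clean c v then 0 else ?D"
  have K0: "0 \<le> ?K" "0 \<le> ?A" "0 \<le> ?D" "0 \<le> ?d" using eps by auto
  have pt: "(rad 2 \<beta> t)\<^sup>2 * (torus_norm R (vel t (fst v)))\<^sup>2 \<le> ?A + ?K * indicator {c - \<delta>..c} t + ?d" for t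
  proof -
    have r: "0 \<le> (rad 2 \<beta> t)\<^sup>2" by simp
    have "(rad 2 \<beta> t)\<^sup>2 * (torus_norm R (vel t (fst v)))\<^sup>2 \<le>
       (rad 2 \<beta> t)\<^sup>2 * (2 * (vel_a t (fst v))\<^sup>2 + (2 + R\<^sup>2) * (vel_b t (fst v))\<^sup>2)"
      by (rule mult_left_mono[OF vel_norm_le r])
    also have "\<dots> = (rad 2 \<beta> t)\<^sup>2 * (2 * (vel_a t (fst v))\<^sup>2) + (2 + R\<^sup>2) * ((rad 2 \<beta> t)\<^sup>2 * (vel_b t (fst v))\<^sup>2)"
      by (simp add: algebra_simps)
    also have "(rad 2 \<beta> t)\<^sup>2 * (2 * (vel_a t (fst v))\<^sup>2) \<le> 2 * (2 * (2 * pi / T * ell)\<^sup>2)"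
      by (intro mult_mono rad_square_le mult_left_mono vel_a_le) auto
    finally have 1: "(rad 2 \<beta> t)\<^sup>2 * (torus_norm R (vel t (fst v)))\<^sup>2 \<le>
        ?A + (2 + R\<^sup>2) * ((rad 2 \<beta> t)\<^sup>2 * (vel_b t (fst v))\<^sup>2)" by simp
    show ?thesis
    proof (cases "clean c v")
      case False
      have "(rad 2 \<beta> t)\<^sup>2 * (vel_b t (fst v))\<^sup>2 \<le> 2 * (pi / \<delta>)\<^sup>2"
        by (intro mult_mono rad_square_le vel_b_le) auto
      then have "(2 + R\<^sup>2) * ((rad 2 \<beta> t)\<^sup>2 * (vel_b t (fst v))\<^sup>2) \<le> (2 + R\<^sup>2) * (2 * (pi / \<delta>)\<^sup>2)"
        by (intro mult_left_mono) auto
      also have "\<dots> = ?d" using False by simp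
      finally have "(2 + R\<^sup>2) * ((rad 2 \<beta> t)\<^sup>2 * (vel_b t (fst v))\<^sup>2) \<le> ?d" .
      moreover have "0 \<le> ?K * indicator {c - \<delta>..c} t" using K0 by simp
      ultimately show ?thesis using 1 by linarith
    next
      case True
      then have vb: "vel_b t (fst v) = turn_rate c t" by (simp add: clean_def)
      have "(rad 2 \<beta> t)\<^sup>2 * (turn_rate c t)\<^sup>2 \<le> 2 * ((\<epsilon> + (pi / T * \<delta>)\<^sup>2) * (pi / \<delta>)\<^sup>2) * indicator {c - \<delta>..c} t"
      proof (cases "c - \<delta> < t \<and> t < c")
        case t: True
        have "\<bar>osc \<beta> t\<bar> \<le> pi / T * \<bar>t - c\<bar>" using wave_lipschitz[OF T, of \<beta> t c] c by simp
        also have "\<dots> \<le> pi / T * \<delta>" using t T by (intro mult_left_mono) auto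
        finally have "\<bar>osc \<beta> t\<bar>\<^sup>2 \<le> (pi / T * \<delta>)\<^sup>2" by (rule power_mono) simp
        then have "(1 - 2 * \<epsilon>) * (osc \<beta> t)\<^sup>2 \<le> 1 * (pi / T * \<delta>)\<^sup>2" using eps by (intro mult_mono) auto
        then have "mass \<beta> t \<le> \<epsilon> + (pi / T * \<delta>)\<^sup>2" by (simp add: mass_def)
        then have "(rad 2 \<beta> t)\<^sup>2 \<le> 2 * (\<epsilon> + (pi / T * \<delta>)\<^sup>2)" using mass_pos[of \<beta> t] by (simp add: rad_def)
        then have "(rad 2 \<beta> t)\<^sup>2 * (turn_rate c t)\<^sup>2 \<le> 2 * (\<epsilon> + (pi / T * \<delta>)\<^sup>2) * (turn_rate c t)\<^sup>2"
          by (rule mult_right_mono) simp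
        then show ?thesis using t by (simp add: turn_rate_def)
      next
        case False
        then show ?thesis using eps by (auto simp: turn_rate_def)
      qed
      then have "(2 + R\<^sup>2) * ((rad 2 \<beta> t)\<^sup>2 * (vel_b t (fst v))\<^sup>2) \<le>
          (2 + R\<^sup>2) * (2 * ((\<epsilon> + (pi / T * \<delta>)\<^sup>2) * (pi / \<delta>)\<^sup>2) * indicator {c - \<delta>..c} t)"
        unfolding vb by (intro mult_left_mono) auto
      also have "\<dots> = ?K * indicator {c - \<delta>..c} t" by (simp only: mult.assoc mult.left_commute)
      finally have "(2 + R\<^sup>2) * ((rad 2 \<beta> t)\<^sup>2 * (vel_b t (fst v))\<^sup>2) \<le> ?K * indicator {c - \<delta>..c} t" .
      then show ?thesis using 1 K0(4) by linarith
    qed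
  qed
  have "path_action xbar T R (fpath (rad 2 \<beta>) v) =
    (\<integral>\<^sup>+t\<in>{0..T}. ennreal ((rad 2 \<beta> t)\<^sup>2 * (torus_norm R (vel t (fst v)))\<^sup>2 + (rad_rate 2 \<beta> t)\<^sup>2) \<partial>lborel)"
    by (rule fpath_action) (auto intro!: radius_rad rad_pos rad_derivative)
  also have "\<dots> \<le> (\<integral>\<^sup>+t. ennreal ((rad_rate 2 \<beta> t)\<^sup>2) * indicator {0..T} t +
      (ennreal (?A + ?d) * indicator {0..T} t + ennreal ?K * indicator {c - \<delta>..c} t) \<partial>lborel)"
  proof (rule nn_integral_mono)
    fix t :: real
    have "ennreal ((rad 2 \<beta> t)\<^sup>2 * (torus_norm R (vel t (fst v)))\<^sup>2 + (rad_rate 2 \<beta> t)\<^sup>2) \<le>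
       ennreal ((?A + ?K * indicator {c - \<delta>..c} t + ?d) + (rad_rate 2 \<beta> t)\<^sup>2)"
      using pt by (intro ennreal_leI add_right_mono)
    also have "\<dots> = ennreal ((rad_rate 2 \<beta> t)\<^sup>2) + (ennreal (?A + ?d) + ennreal ?K * indicator {c - \<delta>..c} t)"
      using K0 by (cases "t \<in> {c - \<delta>..c}") (simp_all add: ennreal_plus[symmetric] add_ac del: ennreal_plus)
    finally show "ennreal ((rad 2 \<beta> t)\<^sup>2 * (torus_norm R (vel t (fst v)))\<^sup>2 + (rad_rate 2 \<beta> t)\<^sup>2) * indicator {0..T} t \<le>
       ennreal ((rad_rate 2 \<beta> t)\<^sup>2) * indicator {0..T} t + (ennreal (?A + ?d) * indicator {0..T} t + ennreal ?K * indicator {c - \<delta>..c} t)"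
      by (cases "t \<in> {0..T}") auto
  qed
  also have "\<dots> = (\<integral>\<^sup>+t\<in>{0..T}. ennreal ((rad_rate 2 \<beta> t)\<^sup>2) \<partial>lborel) + (ennreal (?A + ?d) * ennreal T + ennreal ?K * ennreal \<delta>)"
    using T del by (subst nn_integral_add, measurable, subst nn_integral_add, measurable) (simp add: nn_integral_cmult)
  also have "ennreal (?A + ?d) * ennreal T + ennreal ?K * ennreal \<delta> =
     ennreal (move_cost + turn_cost) + (if clean c v then 0 else ennreal transition_cost)"
  proof -
    have "ennreal (?A + ?d) * ennreal T + ennreal ?K * ennreal \<delta> = ennreal ((?A + ?d) * T + ?K * \<delta>)"
      using K0 T del by (simp add: ennreal_mult'[symmetric] ennreal_plus[symmetric] del: ennreal_plus)
    also have "(?A + ?d) * T + ?K * \<delta> = (move_cost + turn_cost) + (if clean c v then 0 else transition_cost)"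
      by (simp add: move_cost_def turn_cost_def transition_cost_def algebra_simps)
    also have "ennreal \<dots> = ennreal (move_cost + turn_cost) + ennreal (if clean c v then 0 else transition_cost)"
      using eps del T by (intro ennreal_plus) (auto simp: move_cost_def turn_cost_def transition_cost_def)
    finally show ?thesis by simp
  qed
  finally show ?thesis by (simp add: add.assoc)
qed

section \<open>Action of the rescaled measure\<close>

definition rad_action :: "real \<Rightarrow> ennreal" where
  "rad_action \<beta> = (\<integral>\<^sup>+t\<in>{0..T}. ennreal ((rad_rate 2 \<beta> t)\<^sup>2) \<partial>lborel)"

lemma fpath_distr_ge:
  fixes \<beta> :: real
  assumes "spread \<in> {spread1, spread0}"
  defines "\<nu> \<equiv> push T R (\<lambda>u. fpath (rad 2 \<beta>) (spread u))"
  obtains K where "K \<in> sets \<nu>" "AE z in \<nu>. z \<in> K" "\<And>z. z \<in> K \<Longrightarrow> rad_action \<beta> \<le> path_action xbar T R z" "emeasure \<nu> (space \<nu>) = 1"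
proof -
  \<comment> \<open>Labels lie in the square and are moved by at most one cell in \<open>a\<close>,
    so this compact rectangle contains all initial positions.\<close>
  let ?C = "{- ell..2 * pi + ell} \<times> {0..2 * pi}"
  let ?K = "fpath (rad 2 \<beta>) ` ?C"
  have cont: "continuous_map euclidean (path_topology T R) (fpath (rad 2 \<beta>))"
    by (intro continuous_fpath radius_rad) simp
  have C: "compact ?C" by (intro compact_Times) auto
  have sp [measurable]: "spread \<in> borel_measurable borel" using assms(1) by auto
  have near: "\<bar>fst (spread u) - fst u\<bar> \<le> ell" "snd (spread u) = snd u" for u
    using assms(1) stretch_near[of 0 "1 - \<epsilon>" "fst u"] stretch_near[of "1 - \<epsilon>" 1 "fst u"] eps
    by (auto simp: spread1_def spread0_def)
  show ?thesis
  proof (rule that[of ?K])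
    show "?K \<in> sets \<nu>" unfolding \<nu>_def by (simp add: compact_image_path_borel[OF cont C])
    show "AE z in \<nu>. z \<in> ?K"
      unfolding \<nu>_def
    proof (rule AE_distr_compact_image[OF cont sp _ C])
      fix u assume "u \<in> fund_square"
      then show "spread u \<in> ?C" using near[of u] by (cases u; cases "spread u") auto
    qed
    show "rad_action \<beta> \<le> path_action xbar T R z" if "z \<in> ?K" for z
      using that rad_action_lower by (auto simp: rad_action_def)
    show "emeasure \<nu> (space \<nu>) = 1"
      unfolding \<nu>_def
      by (rule emeasure_distr_square) (use measurable_compose[OF sp measurable_fpath[OF radius_rad]] in simp)
  qed
qed

lemma action_rescaled_ge: "(rad_action 0 + rad_action (pi / 2)) / 2 \<le> action xbar T R rescaled"
proof -
  let ?\<mu> = "push T R (\<lambda>u. fpath (rad 2 0) (spread1 u))"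
  let ?\<nu> = "push T R (\<lambda>u. fpath (rad 2 (pi / 2)) (spread0 u))"
  obtain K where K: "K \<in> sets ?\<mu>" "AE z in ?\<mu>. z \<in> K" "\<And>z. z \<in> K \<Longrightarrow> rad_action 0 \<le> path_action xbar T R z" "emeasure ?\<mu> (space ?\<mu>) = 1"
    using fpath_distr_ge[of spread1 0] by auto
  obtain L where L: "L \<in> sets ?\<nu>" "AE z in ?\<nu>. z \<in> L" "\<And>z. z \<in> L \<Longrightarrow> rad_action (pi / 2) \<le> path_action xbar T R z" "emeasure ?\<nu> (space ?\<nu>) = 1"
    using fpath_distr_ge[of spread0 "pi / 2"] by auto
  show ?thesis
    unfolding action_def rescaled_def by (rule nn_integral_half_sum_ge[OF _ K L]) simp
qed

text \<open>Labels in transition have measure at most \<open>2 * \<kappa>\<close> and occur in only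
  one of the two halves, hence the coefficient \<kappa> after averaging.\<close>

lemma action_rescaled_le:
  "action xbar T R rescaled \<le>
    (rad_action 0 + rad_action (pi / 2)) / 2 + ennreal (move_cost + turn_cost + transition_cost * \<kappa>)"
proof -
  let ?E = "ennreal (move_cost + turn_cost)"
  have costs: "0 \<le> move_cost" "0 \<le> turn_cost" "0 \<le> transition_cost"
    using eps del T by (auto simp: move_cost_def turn_cost_def transition_cost_def)
  have m [measurable]: "(\<lambda>u. fpath (rad 2 \<beta>) (spread u)) \<in> measurable square_measure (path_borel T R)"
    if "spread \<in> {spread1, spread0}" for spread \<beta>
  proof -
    have "spread \<in> borel_measurable borel" using that by auto
    from measurable_compose[OF this measurable_fpath[OF radius_rad]] show ?thesis by (simp cong: measurable_cong_sets)
  qed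
  have 1: "(\<integral>\<^sup>+z. path_action xbar T R z \<partial>push T R (\<lambda>u. fpath (rad 2 0) (spread1 u))) \<le> rad_action 0 + ?E"
  proof -
    have "(\<integral>\<^sup>+z. path_action xbar T R z \<partial>push T R (\<lambda>u. fpath (rad 2 0) (spread1 u))) \<le>
        (\<integral>\<^sup>+u. path_action xbar T R (fpath (rad 2 0) (spread1 u)) \<partial>square_measure)"
      by (rule nn_integral_distr_le) (simp add: m)
    also have "\<dots> \<le> (\<integral>\<^sup>+u. rad_action 0 + ?E \<partial>square_measure)"
    proof (rule nn_integral_mono)
      fix u
      show "path_action xbar T R (fpath (rad 2 0) (spread1 u)) \<le> rad_action 0 + ?E"
        using rad_action_upper[OF wave_zeros(2)[OF T], of "spread1 u"] clean_spread1[of u] by (simp add: rad_action_def)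
    qed
    finally show ?thesis using prob_space_square_measure by simp
  qed
  have 2: "(\<integral>\<^sup>+z. path_action xbar T R z \<partial>push T R (\<lambda>u. fpath (rad 2 (pi / 2)) (spread0 u))) \<le>
     rad_action (pi / 2) + ?E + ennreal transition_cost * ennreal (2 * \<kappa>)"
  proof -
    have "(\<integral>\<^sup>+z. path_action xbar T R z \<partial>push T R (\<lambda>u. fpath (rad 2 (pi / 2)) (spread0 u))) \<le>
        (\<integral>\<^sup>+u. path_action xbar T R (fpath (rad 2 (pi / 2)) (spread0 u)) \<partial>square_measure)"
      by (rule nn_integral_distr_le) (simp add: m)
    also have "\<dots> \<le> (\<integral>\<^sup>+u. (rad_action (pi / 2) + ?E) + ennreal transition_cost * indicator transition u \<partial>square_measure)"
    proof (rule nn_integral_mono)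
      fix u
      have "(if clean T (spread0 u) then 0 else ennreal transition_cost) \<le> ennreal transition_cost * indicator transition u"
        using clean_spread0[of u] by (auto simp: indicator_def)
      then have "rad_action (pi / 2) + ?E + (if clean T (spread0 u) then 0 else ennreal transition_cost) \<le>
         rad_action (pi / 2) + ?E + ennreal transition_cost * indicator transition u"
        by (rule add_left_mono)
      with rad_action_upper[OF wave_zeros(1)[OF T], of "spread0 u"]
      show "path_action xbar T R (fpath (rad 2 (pi / 2)) (spread0 u)) \<le> (rad_action (pi / 2) + ?E) + ennreal transition_cost * indicator transition u"
        unfolding rad_action_def by (rule order_trans)
    qed
    also have "\<dots> = (rad_action (pi / 2) + ?E) + ennreal transition_cost * emeasure square_measure transition"
      using prob_space_square_measure by (subst nn_integral_add) (auto simp: nn_integral_cmult)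
    also have "\<dots> \<le> (rad_action (pi / 2) + ?E) + ennreal transition_cost * ennreal (2 * \<kappa>)"
      by (intro add_left_mono mult_left_mono emeasure_transition) auto
    finally show ?thesis .
  qed
  have "action xbar T R rescaled \<le> ((rad_action 0 + ?E) + (rad_action (pi / 2) + ?E + ennreal transition_cost * ennreal (2 * \<kappa>))) / 2"
    unfolding action_def rescaled_def
    by (rule order_trans[OF nn_integral_half_sum_le]) (auto intro!: divide_right_mono_ennreal add_mono 1 2)
  also have "(rad_action 0 + ?E) + (rad_action (pi / 2) + ?E + ennreal transition_cost * ennreal (2 * \<kappa>)) =
     (rad_action 0 + rad_action (pi / 2)) + (?E + ?E + ennreal transition_cost * ennreal (2 * \<kappa>))"
    by (simp only: add_ac)
  also have "?E + ?E + ennreal transition_cost * ennreal (2 * \<kappa>) = ennreal (2 * (move_cost + turn_cost + transition_cost * \<kappa>))"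
    using costs kap by (simp add: ennreal_mult[symmetric] ennreal_plus[symmetric] del: ennreal_plus)
  also have "((rad_action 0 + rad_action (pi / 2)) + ennreal (2 * (move_cost + turn_cost + transition_cost * \<kappa>))) / 2 =
     (rad_action 0 + rad_action (pi / 2)) / 2 + ennreal (2 * (move_cost + turn_cost + transition_cost * \<kappa>)) / 2"
    by (simp add: divide_ennreal_def distrib_right)
  also have "ennreal (2 * (move_cost + turn_cost + transition_cost * \<kappa>)) / 2 = ennreal (2 * (move_cost + turn_cost + transition_cost * \<kappa>) / 2)"
    using costs kap by (intro ennreal_divide_numeral) auto
  also have "2 * (move_cost + turn_cost + transition_cost * \<kappa>) / 2 = move_cost + turn_cost + transition_cost * \<kappa>"
    by simp
  finally show ?thesis .
qed

end

section \<open>Passage to the limit\<close>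

text \<open>The radial action written out with \<epsilon> as an explicit argument, independent of
  the other data of the stripes, so that \<epsilon> can vary along a sequence.\<close>

definition wave_action :: "real \<Rightarrow> real \<Rightarrow> real \<Rightarrow> ennreal" where
  "wave_action T \<epsilon> \<beta> = (\<integral>\<^sup>+t\<in>{0..T}. ennreal (2 * ((1 - 2 * \<epsilon>) * (sin (pi * t / T - \<beta>) * (pi / T)))\<^sup>2 *
     (wave T \<beta> t)\<^sup>2 / (\<epsilon> + (1 - 2 * \<epsilon>) * (wave T \<beta> t)\<^sup>2)) \<partial>lborel)"

definition limit_action :: "real \<Rightarrow> real \<Rightarrow> ennreal" where
  "limit_action T \<beta> = (\<integral>\<^sup>+t\<in>{0..T}. ennreal (2 * (sin (pi * t / T - \<beta>) * (pi / T))\<^sup>2) \<partial>lborel)"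

lemma (in striped_torus) rad_action_eq: "rad_action \<beta> = wave_action T \<epsilon> \<beta>"
proof -
  have "(rad_rate 2 \<beta> t)\<^sup>2 = 2 * ((1 - 2 * \<epsilon>) * (sin (pi * t / T - \<beta>) * (pi / T)))\<^sup>2 * (osc \<beta> t)\<^sup>2 / mass \<beta> t" for t
  proof -
    have m: "0 < mass \<beta> t" by (rule mass_pos)
    define y where "y = (1 - 2 * \<epsilon>) * (sin (pi * t / T - \<beta>) * (pi / T))"
    have "2 * ((1 - 2 * \<epsilon>) * (2 * osc \<beta> t * (- sin (pi * t / T - \<beta>) * (pi / T)))) = - (4 * osc \<beta> t * y)"
      by (simp add: y_def)
    then have "(rad_rate 2 \<beta> t)\<^sup>2 = (4 * osc \<beta> t * y)\<^sup>2 / (2 * rad 2 \<beta> t)\<^sup>2"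
      by (simp only: rad_rate_def power_divide power2_minus)
    also have "(4 * osc \<beta> t * y)\<^sup>2 = 16 * (y\<^sup>2 * (osc \<beta> t)\<^sup>2)" by (simp add: power_mult_distrib)
    also have "(2 * rad 2 \<beta> t)\<^sup>2 = 8 * mass \<beta> t" using m by (simp add: rad_def power_mult_distrib)
    also have "16 * (y\<^sup>2 * (osc \<beta> t)\<^sup>2) / (8 * mass \<beta> t) = 2 * y\<^sup>2 * (osc \<beta> t)\<^sup>2 / mass \<beta> t"
      by simp
    also have "\<dots> = 2 * ((1 - 2 * \<epsilon>) * (sin (pi * t / T - \<beta>) * (pi / T)))\<^sup>2 * (osc \<beta> t)\<^sup>2 / mass \<beta> t"
      by (simp only: y_def)
    finally show ?thesis .
  qed
  then show ?thesis by (simp add: rad_action_def wave_action_def mass_def)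
qed

text \<open>Since \<open>(1 - 2 * \<epsilon>) * w\<^sup>2 \<le> \<epsilon> + (1 - 2 * \<epsilon>) *
  w\<^sup>2\<close>, the integrand is bounded by its limit, which is at most
  \<open>2 * (pi / T)\<^sup>2\<close>. It converges wherever the wave is nonzero, and dominated
  convergence applies.\<close>

lemma wave_action_tendsto:
  fixes e :: "nat \<Rightarrow> real"
  assumes T: "0 < T" and e: "\<And>n. 0 < e n" "\<And>n. e n < 1 / 2" "e \<longlonglongrightarrow> 0"
    and F: "finite F" "\<And>t. t \<in> {0..T} - F \<Longrightarrow> wave T \<beta> t \<noteq> 0"
  shows "(\<lambda>n. wave_action T (e n) \<beta>) \<longlonglongrightarrow> limit_action T \<beta>"
proof -
  define s where "s t = sin (pi * t / T - \<beta>) * (pi / T)" for t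
  define g where "g x t = 2 * ((1 - 2 * x) * s t)\<^sup>2 * (wave T \<beta> t)\<^sup>2 / (x + (1 - 2 * x) * (wave T \<beta> t)\<^sup>2)" for x t
  have [measurable]: "g x \<in> borel_measurable borel" "s \<in> borel_measurable borel" for x
    unfolding g_def s_def wave_def by measurable
  have AEF: "AE t in lborel. t \<notin> F"
    using finite_imp_null_set_lborel[OF F(1)] by (rule AE_not_in)
  have bound: "g (e n) t \<le> 2 * (s t)\<^sup>2" for n t
  proof -
    let ?w = "(wave T \<beta> t)\<^sup>2" and ?x = "e n"
    have w: "0 \<le> ?w" by simp
    have x: "0 < 1 - 2 * ?x" using e(2)[of n] by simp
    have d: "0 < ?x + (1 - 2 * ?x) * ?w" using e(1)[of n] x w by (intro add_pos_nonneg) auto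
    have "2 * ((1 - 2 * ?x) * s t)\<^sup>2 * ?w = (2 * (s t)\<^sup>2 * (1 - 2 * ?x)) * ((1 - 2 * ?x) * ?w)"
      by (simp add: power2_eq_square)
    also have "\<dots> \<le> (2 * (s t)\<^sup>2 * 1) * (?x + (1 - 2 * ?x) * ?w)"
      using x e(1)[of n] w by (intro mult_mono mult_left_mono) auto
    finally show ?thesis using d by (simp add: g_def pos_divide_le_eq)
  qed
  have lim: "(\<lambda>n. g (e n) t) \<longlonglongrightarrow> 2 * (s t)\<^sup>2" if "t \<in> {0..T} - F" for t
  proof -
    have w: "wave T \<beta> t \<noteq> 0" using F(2) that by blast
    have "(\<lambda>n. g (e n) t) \<longlonglongrightarrow> 2 * ((1 - 2 * 0) * s t)\<^sup>2 * (wave T \<beta> t)\<^sup>2 / (0 + (1 - 2 * 0) * (wave T \<beta> t)\<^sup>2)"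
      unfolding g_def using w by (intro tendsto_intros e(3)) auto
    then show ?thesis using w by simp
  qed
  have "(\<lambda>n. \<integral>\<^sup>+t. ennreal (g (e n) t) * indicator {0..T} t \<partial>lborel) \<longlonglongrightarrow> (\<integral>\<^sup>+t. ennreal (2 * (s t)\<^sup>2) * indicator {0..T} t \<partial>lborel)"
  proof (rule nn_integral_dominated_convergence[where w = "\<lambda>t. ennreal (2 * (pi / T)\<^sup>2) * indicator {0..T} t"])
    show "AE t in lborel. ennreal (g (e n) t) * indicator {0..T} t \<le> ennreal (2 * (pi / T)\<^sup>2) * indicator {0..T} t" for n
    proof (intro AE_I2 mult_right_mono ennreal_leI)
      fix t
      have "(sin (pi * t / T - \<beta>))\<^sup>2 * (pi / T)\<^sup>2 \<le> 1 * (pi / T)\<^sup>2"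
        by (intro mult_right_mono) (auto simp: abs_square_le_1)
      moreover have "(s t)\<^sup>2 = (sin (pi * t / T - \<beta>))\<^sup>2 * (pi / T)\<^sup>2" by (simp only: s_def power_mult_distrib)
      ultimately have "2 * (s t)\<^sup>2 \<le> 2 * (pi / T)\<^sup>2" by simp
      then show "g (e n) t \<le> 2 * (pi / T)\<^sup>2" using bound[of n t] by linarith
    qed auto
    show "(\<integral>\<^sup>+t. ennreal (2 * (pi / T)\<^sup>2) * indicator {0..T} t \<partial>lborel) < \<infinity>"
      using T by (subst nn_integral_cmult) (auto simp: ennreal_mult_less_top)
    show "AE t in lborel. (\<lambda>n. ennreal (g (e n) t) * indicator {0..T} t) \<longlonglongrightarrow> ennreal (2 * (s t)\<^sup>2) * indicator {0..T} t"
      using AEF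
    proof eventually_elim
      case (elim t)
      then show ?case using lim[of t] by (cases "t \<in> {0..T}") (auto intro: tendsto_ennrealI)
    qed
  qed auto
  then show ?thesis by (simp add: wave_action_def limit_action_def g_def s_def)
qed

lemma half_sum_commute:
  assumes "sets \<nu> = sets \<mu>"
  shows "half_sum \<mu> \<nu> = half_sum \<nu> \<mu>"
  using assms sets_eq_imp_space_eq[OF assms] by (simp add: half_sum_def add.commute)

text \<open>The action is constant on each family of step paths, so the estimate from below by Borel
  sets and the estimate from above by minorants give the same value.\<close>

lemma action_mu_star:
  assumes R: "0 < R" and T: "0 < T"
  shows "action xbar T R (mu_star T R) = (limit_action T 0 + limit_action T (pi / 2)) / 2"
proof -
  let ?D = "\<lambda>c \<beta>. push T R (step_path T c \<beta>)"
  have mu: "mu_star T R = half_sum (?D (T / 2) 0) (?D T (pi / 2))"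
    unfolding mu_star_eq[OF R T] by (rule half_sum_commute) simp
  have a1: "path_action xbar T R (step_path T (T / 2) 0 u) = limit_action T 0" for u
    unfolding limit_action_def by (rule step_path_action[OF R T wave_zeros(2)[OF T], of "{T / 2}"]) (use wave_zeros(4)[OF T] in auto)
  have a0: "path_action xbar T R (step_path T T (pi / 2) u) = limit_action T (pi / 2)" for u
    unfolding limit_action_def by (rule step_path_action[OF R T wave_zeros(1)[OF T], of "{0, T}"]) (use wave_zeros(3)[OF T] in auto)
  have cont: "continuous_map euclidean (path_topology T R) (step_path T c \<beta>)" if "wave T \<beta> c = 0" for c \<beta>
    using that by (rule continuous_step_path[OF R T])
  have m: "step_path T c \<beta> \<in> measurable square_measure (path_borel T R)" if "wave T \<beta> c = 0" for c \<beta>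
    using continuous_path_measurable[OF cont[OF that]] by (simp cong: measurable_cong_sets)
  have C: "compact ({0..2 * pi} \<times> {0..2 * pi} :: (real \<times> real) set)" by (intro compact_Times) auto
  have K: "step_path T c \<beta> ` ({0..2 * pi} \<times> {0..2 * pi}) \<in> sets (?D c \<beta>)"
      "AE z in ?D c \<beta>. z \<in> step_path T c \<beta> ` ({0..2 * pi} \<times> {0..2 * pi})"
      "emeasure (?D c \<beta>) (space (?D c \<beta>)) = 1" if c: "wave T \<beta> c = 0" for c \<beta>
  proof -
    show "step_path T c \<beta> ` ({0..2 * pi} \<times> {0..2 * pi}) \<in> sets (?D c \<beta>)"
      by (simp add: compact_image_path_borel[OF cont[OF c] C])
    show "AE z in ?D c \<beta>. z \<in> step_path T c \<beta> ` ({0..2 * pi} \<times> {0..2 * pi})"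
      using AE_distr_compact_image[OF cont[OF c], of "\<lambda>u. u", OF _ _ C] by auto
    show "emeasure (?D c \<beta>) (space (?D c \<beta>)) = 1"
      by (rule emeasure_distr_square[OF continuous_path_measurable[OF cont[OF c]]])
  qed
  note K1 = K[OF wave_zeros(2)[OF T]] and K0 = K[OF wave_zeros(1)[OF T]]
  have "(limit_action T 0 + limit_action T (pi / 2)) / 2 \<le> action xbar T R (mu_star T R)"
    unfolding action_def mu
    by (rule nn_integral_half_sum_ge[OF _ K1(1,2) _ K1(3) K0(1,2) _ K0(3)]) (auto simp: a0 a1)
  moreover have "action xbar T R (mu_star T R) \<le> (limit_action T 0 + limit_action T (pi / 2)) / 2"
  proof -
    have "(\<integral>\<^sup>+z. path_action xbar T R z \<partial>?D c \<beta>) \<le> x"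
      if c: "wave T \<beta> c = 0" and x: "\<And>u. path_action xbar T R (step_path T c \<beta> u) = x" for c \<beta> x
      using nn_integral_distr_le[OF m[OF c], of "path_action xbar T R"] prob_space_square_measure by (simp add: x)
    from this[OF wave_zeros(2)[OF T] a1] this[OF wave_zeros(1)[OF T] a0]
    show ?thesis
      unfolding action_def mu
      by (intro order_trans[OF nn_integral_half_sum_le] divide_right_mono_ennreal add_mono) auto
  qed
  ultimately show ?thesis by (rule antisym[rotated])
qed

text \<open>All measures are images of one square measure. Almost sure convergence of the paths with
  a given label thus implies convergence of the integrals of bounded continuous functions by
  dominated convergence.\<close>

lemma integral_distr_tendsto:
  fixes f :: "(real \<Rightarrow> torus cone) \<Rightarrow> real"
  assumes f: "continuous_map (path_topology T R) euclideanreal f" "\<And>z. z \<in> paths T R \<Longrightarrow> \<bar>f z\<bar> \<le> B"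
    and X: "\<And>n. X n \<in> measurable borel (path_borel T R)" and Y: "Y \<in> measurable borel (path_borel T R)"
    and lim: "AE u in square_measure. (\<lambda>n. pdist T R (X n u) (Y u)) \<longlonglongrightarrow> 0"
  shows "(\<lambda>n. \<integral>z. f z \<partial>push T R (X n)) \<longlonglongrightarrow> (\<integral>z. f z \<partial>push T R Y)"
proof -
  interpret P: Metric_space "paths T R" "pdist T R"
    by (rule Metric_space_mspace_mdist)
  have fm [measurable]: "f \<in> borel_measurable (path_borel T R)" by (rule measurable_path_real[OF f(1)])
  have [measurable]: "X n \<in> measurable square_measure (path_borel T R)" "Y \<in> measurable square_measure (path_borel T R)" for n
    using X Y by (auto cong: measurable_cong_sets)
  have mem: "X n u \<in> paths T R" "Y u \<in> paths T R" for n u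
    using measurable_space[OF X, of u] measurable_space[OF Y, of u] by auto
  have fin: "finite_measure square_measure"
    by (rule finite_measureI) (use prob_space_square_measure in simp)
  have "(\<lambda>n. \<integral>u. f (X n u) \<partial>square_measure) \<longlonglongrightarrow> (\<integral>u. f (Y u) \<partial>square_measure)"
  proof (rule integral_dominated_convergence[where w = "\<lambda>_. B"])
    show "integrable square_measure (\<lambda>_. B)" by (rule finite_measure.integrable_const[OF fin])
    show "AE u in square_measure. (\<lambda>n. f (X n u)) \<longlonglongrightarrow> f (Y u)"
      using lim
    proof eventually_elim
      case (elim u)
      have "limitin P.mtopology (\<lambda>n. X n u) (Y u) sequentially"
        unfolding P.limitin_metric
      proof (intro conjI allI impI mem)
        fix e :: real assume "0 < e"
        then have "\<forall>\<^sub>F n in sequentially. pdist T R (X n u) (Y u) < e"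
          using elim by (rule order_tendstoD(2)[rotated])
        then show "\<forall>\<^sub>F n in sequentially. X n u \<in> paths T R \<and> pdist T R (X n u) (Y u) < e"
          by eventually_elim (use mem in simp)
      qed
      then have "limitin euclideanreal (f \<circ> (\<lambda>n. X n u)) (f (Y u)) sequentially"
        using f(1) by (intro continuous_map_limit) (auto simp: mtopology_of_def)
      then show ?case by (simp add: o_def)
    qed
    show "AE u in square_measure. norm (f (X n u)) \<le> B" for n using f(2) mem by simp
  qed measurable
  then show ?thesis by (simp add: integral_distr)
qed

lemma narrow_conv_half_sum:
  assumes X: "\<And>n. X n \<in> measurable borel (path_borel T R)" "\<And>n. X' n \<in> measurable borel (path_borel T R)"
    and Y: "Y \<in> measurable borel (path_borel T R)" "Y' \<in> measurable borel (path_borel T R)"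
    and lim: "AE u in square_measure. (\<lambda>n. pdist T R (X n u) (Y u)) \<longlonglongrightarrow> 0"
      "AE u in square_measure. (\<lambda>n. pdist T R (X' n u) (Y' u)) \<longlonglongrightarrow> 0"
  shows "narrow_conv T R (\<lambda>n. half_sum (push T R (X n)) (push T R (X' n)))
     (half_sum (push T R Y) (push T R Y'))"
  unfolding narrow_conv_def
proof (intro allI impI)
  fix f :: "(real \<Rightarrow> torus cone) \<Rightarrow> real"
  assume f: "continuous_map (path_topology T R) euclideanreal f \<and> bounded (f ` paths T R)"
  then obtain B where B: "\<And>z. z \<in> paths T R \<Longrightarrow> \<bar>f z\<bar> \<le> B"
    by (auto simp: bounded_iff)
  have fin: "finite_measure (push T R W)" if "W \<in> measurable borel (path_borel T R)" for W
    by (rule finite_measureI) (use emeasure_distr_square[OF that] in simp)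
  have int: "(\<integral>z. f z \<partial>half_sum (push T R W) (push T R W')) =
     ((\<integral>z. f z \<partial>push T R W) + (\<integral>z. f z \<partial>push T R W')) / 2"
    if "W \<in> measurable borel (path_borel T R)" "W' \<in> measurable borel (path_borel T R)" for W W'
    using that f B measurable_path_real[of T R f]
    by (intro integral_half_sum_bounded[where B = B] fin) auto
  show "(\<lambda>n. \<integral>z. f z \<partial>half_sum (push T R (X n)) (push T R (X' n)))
     \<longlonglongrightarrow> (\<integral>z. f z \<partial>half_sum (push T R Y) (push T R Y'))"
    unfolding int[OF X] int[OF Y] using f B X Y lim
    by (intro tendsto_intros integral_distr_tendsto[where B = B]) auto
qed

text \<open>What the limit needs to know about a single striped flow.\<close>

definition approximates ::
    "torus \<Rightarrow> real \<Rightarrow> real \<Rightarrow> real \<Rightarrow> real \<Rightarrow> real \<Rightarrow> real \<Rightarrow> (real \<Rightarrow> torus \<Rightarrow> torus) \<Rightarrow>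
     (real \<times> real \<Rightarrow> real \<Rightarrow> torus cone) \<Rightarrow> (real \<times> real \<Rightarrow> real \<Rightarrow> torus cone) \<Rightarrow> (real \<times> real) set \<Rightarrow> bool" where
  "approximates xbar T R \<epsilon> d k c \<phi> X X' A \<longleftrightarrow>
     continuous_flow T \<phi> \<and> (\<forall>t\<in>{0..T}. AE x in torus_measure. torus_smooth_at (\<phi> t) x) \<and>
     lifts_to_cone T R \<phi> \<and> \<phi> 0 = id \<and> \<phi> T = half_turn \<and>
     X \<in> measurable borel (path_borel T R) \<and> X' \<in> measurable borel (path_borel T R) \<and>
     rescales_to xbar T R (flow_measure T R \<phi> (sqrt_jac \<phi>))
       (half_sum (push T R X) (push T R X')) \<and>
     (\<forall>u. pdist T R (X u) (step_path T (T / 2) 0 u) \<le> d) \<and>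
     (\<forall>u. u \<notin> A \<longrightarrow> pdist T R (X' u) (step_path T T (pi / 2) u) \<le> d) \<and>
     A \<in> sets borel \<and> emeasure square_measure A \<le> ennreal k \<and>
     (let a = action xbar T R (half_sum (push T R X) (push T R X'));
          b = (wave_action T \<epsilon> 0 + wave_action T \<epsilon> (pi / 2)) / 2
      in b \<le> a \<and> a \<le> b + ennreal c)"

lemma (in striped_torus) approximates_flow:
  "approximates xbar T R \<epsilon> (sqrt (2 * \<epsilon>) + 2 * sqrt 2 * ell + 2 * sqrt 2 * (pi / T * \<delta>)) (2 * \<kappa>)
     (move_cost + turn_cost + transition_cost * \<kappa>) flow
     (\<lambda>u. fpath (rad 2 0) (spread1 u)) (\<lambda>u. fpath (rad 2 (pi / 2)) (spread0 u)) transition"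
  unfolding approximates_def rescaled_def[symmetric] Let_def
proof (intro conjI ballI allI impI)
  show "AE x in torus_measure. torus_smooth_at (flow t) x" for t
    by (rule AE_torus_regular) (rule flow_smooth)
  have near: "\<bar>fst (spread1 u) - fst u\<bar> \<le> ell" "\<bar>fst (spread0 u) - fst u\<bar> \<le> ell" "snd (spread1 u) = snd u" "snd (spread0 u) = snd u" for u
    using stretch_near[of 0 "1 - \<epsilon>" "fst u"] stretch_near[of "1 - \<epsilon>" 1 "fst u"] eps
    by (auto simp: spread1_def spread0_def)
  show "pdist T R (fpath (rad 2 0) (spread1 u)) (step_path T (T / 2) 0 u) \<le>
     sqrt (2 * \<epsilon>) + 2 * sqrt 2 * ell + 2 * sqrt 2 * (pi / T * \<delta>)" for u
    by (rule fpath_near_step[OF wave_zeros(2)[OF T] clean_spread1 near(1,3)])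
  show "pdist T R (fpath (rad 2 (pi / 2)) (spread0 u)) (step_path T T (pi / 2) u) \<le>
     sqrt (2 * \<epsilon>) + 2 * sqrt 2 * ell + 2 * sqrt 2 * (pi / T * \<delta>)" if "u \<notin> transition" for u
    by (rule fpath_near_step[OF wave_zeros(1)[OF T] clean_spread0[OF that] near(2,4)])
  have m: "fpath (rad 2 \<beta>) \<in> measurable borel (path_borel T R)" for \<beta>
    by (intro measurable_fpath radius_rad) simp
  show "(\<lambda>u. fpath (rad 2 0) (spread1 u)) \<in> measurable borel (path_borel T R)"
    by (rule measurable_compose[OF measurable_spread(1) m])
  show "(\<lambda>u. fpath (rad 2 (pi / 2)) (spread0 u)) \<in> measurable borel (path_borel T R)"
    by (rule measurable_compose[OF measurable_spread(2) m])
  show "(wave_action T \<epsilon> 0 + wave_action T \<epsilon> (pi / 2)) / 2 \<le> action xbar T R rescaled"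
    using action_rescaled_ge by (simp only: rad_action_eq)
  show "action xbar T R rescaled \<le> (wave_action T \<epsilon> 0 + wave_action T \<epsilon> (pi / 2)) / 2 + ennreal (move_cost + turn_cost + transition_cost * \<kappa>)"
    using action_rescaled_le by (simp only: rad_action_eq)
qed (rule continuous_flow_flow lifts_to_cone_flow flow_0 flow_T rescales_to_rescaled transition_sets emeasure_transition)+

text \<open>With \<open>\<epsilon> = q\<^sup>2\<close>, \<open>\<delta> = q T / 2\<close>, \<open>\<kappa> = q\<^sup>3\<close> and cells of length \<open>2 \<pi> q\<close>, all errors are \<open>O(q)\<close>.\<close>

lemma approximates_exists:
  fixes N :: nat
  assumes R: "0 < R" and T: "0 < T" and N: "3 \<le> N" and q: "q = 1 / real N"
  shows "\<exists>\<phi> X X' A. approximates xbar T R (q\<^sup>2) ((sqrt 2 + 4 * sqrt 2 * pi + sqrt 2 * pi) * q) (2 * q ^ 3)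
     ((T * (4 * (4 * pi\<^sup>2 / T)\<^sup>2) * q + T * (2 + R\<^sup>2) * (1 + (pi / 2)\<^sup>2) * (2 * pi / T)\<^sup>2 + T * (2 * (2 + R\<^sup>2) * (2 * pi / T)\<^sup>2)) * q)
     \<phi> X X' A"
proof -
  \<comment> \<open>With at least three cells \<open>q\<close> is small enough for the constraints
    on \<epsilon>, \<delta> and \<kappa>.\<close>
  have q0: "0 < q" "q \<le> 1 / 3" unfolding q using N by (simp_all add: field_simps)
  have q2: "q\<^sup>2 \<le> 1 / 9"
    using power_mono[of q "1 / 3" 2] q0 by (simp add: power2_eq_square)
  have q3: "q ^ 3 \<le> 1 / 27"
    using power_mono[of q "1 / 3" 3] q0 by (simp add: power3_eq_cube)
  interpret striped_torus N T "q\<^sup>2" "q * T / 2" "q ^ 3" R xbar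
    by unfold_locales (use R T N q0 q2 q3 in auto)
  have l: "ell = 2 * pi * q" by (simp add: ell_def q)
  have d: "pi / T * (q * T / 2) = pi / 2 * q" "pi / (q * T / 2) = 2 * pi / T / q"
    using T q0 by (simp_all add: field_simps)
  have "sqrt (2 * q\<^sup>2) + 2 * sqrt 2 * ell + 2 * sqrt 2 * (pi / T * (q * T / 2)) = (sqrt 2 + 4 * sqrt 2 * pi + sqrt 2 * pi) * q"
    unfolding l d using q0 by (simp add: real_sqrt_mult algebra_simps)
  moreover have "move_cost = T * (4 * (4 * pi\<^sup>2 / T)\<^sup>2) * q * q"
    unfolding move_cost_def l by (simp add: power2_eq_square)
  moreover have "turn_cost = T * (2 + R\<^sup>2) * (1 + (pi / 2)\<^sup>2) * (2 * pi / T)\<^sup>2 * q"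
  proof -
    have "turn_cost = q * T / 2 * (2 * (2 + R\<^sup>2) * ((q\<^sup>2 + (pi / 2 * q)\<^sup>2) * (2 * pi / T / q)\<^sup>2))"
      unfolding turn_cost_def d ..
    moreover have "(q\<^sup>2 + (pi / 2 * q)\<^sup>2) * (2 * pi / T / q)\<^sup>2 = (1 + (pi / 2)\<^sup>2) * (2 * pi / T)\<^sup>2"
    proof -
      have "q\<^sup>2 + (pi / 2 * q)\<^sup>2 = (1 + (pi / 2)\<^sup>2) * q\<^sup>2"
        by (simp only: power_mult_distrib distrib_right mult_1_left)
      moreover have "(2 * pi / T / q)\<^sup>2 = (2 * pi / T)\<^sup>2 / q\<^sup>2" by (rule power_divide)
      ultimately show ?thesis using q0 by simp
    qed
    moreover have "q * T / 2 * (2 * x * (y * z)) = T * x * y * z * q" for x y z :: real by simp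
    ultimately show ?thesis by (simp only:)
  qed
  moreover have "transition_cost * q ^ 3 = T * (2 * (2 + R\<^sup>2) * (2 * pi / T)\<^sup>2) * q"
  proof -
    have "(2 * pi / T / q)\<^sup>2 = (2 * pi / T)\<^sup>2 / q\<^sup>2" by (rule power_divide)
    then have "transition_cost * q ^ 3 = T * (2 * (2 + R\<^sup>2) * ((2 * pi / T)\<^sup>2 / q\<^sup>2)) * (q\<^sup>2 * q)"
      unfolding transition_cost_def d by (simp add: power2_eq_square power3_eq_cube)
    then show ?thesis using q0 by simp
  qed
  ultimately show ?thesis
    using approximates_flow by (auto simp: distrib_right)
qed

theorem theorem7p12:
  fixes R T :: real and xbar :: torus
  assumes "R > 0" and "T > 0"
  shows "\<exists>\<phi> :: nat \<Rightarrow> real \<Rightarrow> torus \<Rightarrow> torus.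
      (\<forall>n. continuous_flow T (\<phi> n)) \<and>
      (\<forall>n. \<forall>t\<in>{0..T}. AE x in torus_measure. torus_smooth_at (\<phi> n t) x) \<and>
      (\<forall>n. lifts_to_cone T R (\<phi> n)) \<and>
      (\<forall>n. \<phi> n 0 = id \<and> \<phi> n T = half_turn) \<and>
      (\<exists>\<mu> :: nat \<Rightarrow> (real \<Rightarrow> torus cone) measure.
         (\<forall>n. rescales_to xbar T R (flow_measure T R (\<phi> n) (sqrt_jac (\<phi> n))) (\<mu> n)) \<and>
         narrow_conv T R \<mu> (mu_star T R) \<and>
         (\<lambda>n. action xbar T R (\<mu> n)) \<longlonglongrightarrow> action xbar T R (mu_star T R))"
proof -
  \<comment> \<open>The index is shifted by 3 so that already the first flow satisfies the
    constraints on the parameters.\<close>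
  define q where "q n = 1 / real (n + 3)" for n
  define D where "D = sqrt 2 + 4 * sqrt 2 * pi + sqrt 2 * pi"
  define C where "C x = (T * (4 * (4 * pi\<^sup>2 / T)\<^sup>2) * x + T * (2 + R\<^sup>2) * (1 + (pi / 2)\<^sup>2) * (2 * pi / T)\<^sup>2 + T * (2 * (2 + R\<^sup>2) * (2 * pi / T)\<^sup>2)) * x" for x
  have q: "0 < q n" "q n \<le> 1 / 3" for n by (auto simp: q_def field_simps)
  have q_lim: "q \<longlonglongrightarrow> 0"
    unfolding q_def using LIMSEQ_ignore_initial_segment[OF lim_1_over_n, of 3] by simp
  have "\<forall>n. \<exists>\<phi> X X' A. approximates xbar T R ((q n)\<^sup>2) (D * q n) (2 * q n ^ 3) (C (q n)) \<phi> X X' A"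
  proof
    fix n
    show "\<exists>\<phi> X X' A. approximates xbar T R ((q n)\<^sup>2) (D * q n) (2 * q n ^ 3) (C (q n)) \<phi> X X' A"
      unfolding C_def D_def by (rule approximates_exists[OF assms, where N = "n + 3"]) (simp_all add: q_def)
  qed
  then obtain \<phi> X X' A where ap: "\<And>n. approximates xbar T R ((q n)\<^sup>2) (D * q n) (2 * q n ^ 3) (C (q n)) (\<phi> n) (X n) (X' n) (A n)"
    by metis
  note ap' = ap[unfolded approximates_def Let_def]
  let ?D = "\<lambda>X. push T R X"
  define \<mu> where "\<mu> n = half_sum (?D (X n)) (?D (X' n))" for n
  have X: "X n \<in> measurable borel (path_borel T R)" "X' n \<in> measurable borel (path_borel T R)" for n
    using ap'[of n] by auto
  have near: "pdist T R (X n u) (step_path T (T / 2) 0 u) \<le> D * q n"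
    "u \<notin> A n \<Longrightarrow> pdist T R (X' n u) (step_path T T (pi / 2) u) \<le> D * q n" for n u
    using ap'[of n] by (elim conjE; blast)+
  have Y: "step_path T (T / 2) 0 \<in> measurable borel (path_borel T R)" "step_path T T (pi / 2) \<in> measurable borel (path_borel T R)"
    using assms wave_zeros[of T] by (auto intro!: continuous_path_measurable continuous_step_path)
  have Dq: "(\<lambda>n. D * q n) \<longlonglongrightarrow> 0" using tendsto_mult[OF tendsto_const q_lim, of D] by simp
  have lim1: "AE u in square_measure. (\<lambda>n. pdist T R (X n u) (step_path T (T / 2) 0 u)) \<longlonglongrightarrow> 0"
  proof (rule AE_I2)
    fix u
    show "(\<lambda>n. pdist T R (X n u) (step_path T (T / 2) 0 u)) \<longlonglongrightarrow> 0"
      by (rule tendsto_sandwich[OF _ _ tendsto_const Dq]) (simp_all add: near(1))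
  qed
  have sm: "A n \<in> sets square_measure" "emeasure square_measure (A n) \<le> ennreal (2 * q n ^ 3)" for n
    using ap'[of n] by auto
  have lim0: "AE u in square_measure. (\<lambda>n. pdist T R (X' n u) (step_path T T (pi / 2) u)) \<longlonglongrightarrow> 0"
  proof -
    have fin: "emeasure square_measure (A n) < \<infinity>" for n
      using sm(2)[of n] by (rule le_less_trans) simp
    \<comment> \<open>The cubes of \<open>q n\<close> are summable, so by Borel-Cantelli almost
      every label lies in only finitely many of the exceptional sets; from then on the distance
      bound holds.\<close>
    have "summable (\<lambda>n. measure square_measure (A n))"
    proof (rule summable_comparison_test')
      have "summable (\<lambda>n. inverse (real (n + 3)) ^ 3)"
        using inverse_power_summable[of 3, where 'a = real] by (subst summable_iff_shift) (simp add: power_inverse)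
      then show "summable (\<lambda>n. 2 * q n ^ 3)" by (intro summable_mult) (simp add: q_def inverse_eq_divide)
      show "norm (measure square_measure (A n)) \<le> 2 * q n ^ 3" for n
        using sm(2)[of n] q(1)[of n] by (simp add: measure_def enn2real_leI)
    qed
    from borel_cantelli_AE1[OF sm(1) fin this]
    show ?thesis
    proof eventually_elim
      case (elim u)
      show ?case
      proof (rule tendsto_sandwich[OF _ _ tendsto_const Dq])
        show "\<forall>\<^sub>F n in sequentially. pdist T R (X' n u) (step_path T T (pi / 2) u) \<le> D * q n"
          using elim by eventually_elim (simp add: near(2))
      qed auto
    qed
  qed
  have "mu_star T R = half_sum (?D (step_path T (T / 2) 0)) (?D (step_path T T (pi / 2)))"
    unfolding mu_star_eq[OF assms] by (rule half_sum_commute) simp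
  then have narrow: "narrow_conv T R \<mu> (mu_star T R)"
    unfolding \<mu>_def[abs_def] using narrow_conv_half_sum[OF X Y lim1 lim0] by simp
  have "(\<lambda>n. action xbar T R (\<mu> n)) \<longlonglongrightarrow> (limit_action T 0 + limit_action T (pi / 2)) / 2"
  \<comment> \<open>The radial action \<open>?b n\<close> bounds from below; from above it does so
    up to \<open>C (q n)\<close>, which tends to 0 because every term of \<open>C\<close> contains
    the factor \<open>q n\<close>.\<close>
  proof (rule tendsto_sandwich)
    let ?b = "\<lambda>n. (wave_action T ((q n)\<^sup>2) 0 + wave_action T ((q n)\<^sup>2) (pi / 2)) / 2"
    show "\<forall>\<^sub>F n in sequentially. ?b n \<le> action xbar T R (\<mu> n)"
      "\<forall>\<^sub>F n in sequentially. action xbar T R (\<mu> n) \<le> ?b n + ennreal (C (q n))"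
      unfolding \<mu>_def using ap' by auto
    have q2: "0 < (q n)\<^sup>2" "(q n)\<^sup>2 < 1 / 2" for n
      using q[of n] power_mono[of "q n" "1 / 3" 2] by (auto simp: power2_eq_square)
    have q2_lim: "(\<lambda>n. (q n)\<^sup>2) \<longlonglongrightarrow> 0" using tendsto_power[OF q_lim, of 2] by simp
    have "(\<lambda>n. wave_action T ((q n)\<^sup>2) 0) \<longlonglongrightarrow> limit_action T 0"
      by (rule wave_action_tendsto[OF assms(2) q2 q2_lim, of "{T / 2}"]) (use wave_zeros(4)[OF assms(2)] in auto)
    moreover have "(\<lambda>n. wave_action T ((q n)\<^sup>2) (pi / 2)) \<longlonglongrightarrow> limit_action T (pi / 2)"
      by (rule wave_action_tendsto[OF assms(2) q2 q2_lim, of "{0, T}"]) (use wave_zeros(3)[OF assms(2)] in auto)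
    ultimately show b: "?b \<longlonglongrightarrow> (limit_action T 0 + limit_action T (pi / 2)) / 2"
      unfolding divide_ennreal_def mult.commute[of _ "inverse 2 :: ennreal"]
      by (intro ennreal_tendsto_cmult tendsto_add) (auto simp: ennreal_half[symmetric] simp del: ennreal_half)
    have "(\<lambda>n. C (q n)) \<longlonglongrightarrow> C 0"
      unfolding C_def by (intro tendsto_intros q_lim)
    then have "(\<lambda>n. ennreal (C (q n))) \<longlonglongrightarrow> 0"
      using tendsto_ennrealI[of "\<lambda>n. C (q n)" 0] by (simp add: C_def)
    from tendsto_add[OF b this] show "(\<lambda>n. ?b n + ennreal (C (q n))) \<longlonglongrightarrow> (limit_action T 0 + limit_action T (pi / 2)) / 2"
      by simp
  qed
  then have act: "(\<lambda>n. action xbar T R (\<mu> n)) \<longlonglongrightarrow> action xbar T R (mu_star T R)"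
    by (simp add: action_mu_star[OF assms])
  show ?thesis
    using ap' narrow act unfolding \<mu>_def[symmetric]
    by (intro exI[of _ \<phi>] conjI allI ballI exI[of _ \<mu>]) auto
qed

end
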